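(* Let $k\ge1$ be an integer, $\lambda,\mu>0$, $\theta>0$, $\alpha\in(0,1)$. The sojourn times $S^{\theta,\alpha}$ of the queue length process $\{L^{\theta,\alpha}(t)\}_{t\ge0}$ of the tempered Erlang queue in a non-zero state are independent and identically distributed with \begin{equation*} \Pr(S^{\theta,\alpha}>t)=e^{-\theta t}\sum_{q=0}^{\infty}(\theta t)^q\sum_{r=0}^{\infty}(-(\lambda+k\mu) t^\alpha)^rE_{\alpha, r\alpha+q+1}^r(\theta^\alpha t^\alpha),\qquad t\ge0. \end{equation*}
   Context: Erlang queue: $\{Q(t)\}_{t\ge0}$, $Q(t)=(N(t),S(t))$, is the continuous-time Markov chain on $\{(0,0)\}\cup S$, $S=\{(n,s)\in\mathbb{N}\times\mathbb{N}: n\ge1,\ 1\le s\le k\}$, started at $(0,0)$, with Poisson arrivals of rate $\lambda$ and Erlang service with $k$ phases each exponential of rate $k\mu$; transition rates: $(0,0)\to(1,k)$ and $(n,s)\to(n+1,s)$ at rate $\lambda$; $(n,s)\to(n,s-1)$ at rate $k\mu$ for $s\ge2$; $(n,1)\to(n-1,k)$ at rate $k\mu$ for $n\ge2$; $(1,1)\to(0,0)$ at rate $k\mu$. Let $D_{\theta,\alpha}$ be the subordinator with $\mathbb{E}e^{-sD_{\theta,\alpha}(t)}=e^{-t((s+\theta)^\alpha-\theta^\alpha)}$, $Y_{\theta,\alpha}(t)=\inf\{x>0:D_{\theta,\alpha}(x)>t\}$ independent of $Q$, and $Q^{\theta,\alpha}(t)=Q(Y_{\theta,\alpha}(t))$.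 Queue length process: $L^{\theta,\alpha}(t)=g_k(Q^{\theta,\alpha}(t))$ with $g_k(n,s)=k(n-1)+s$, $g_k(0,0)=0$. A sojourn time is the time $L^{\theta,\alpha}$ spends in a state before transitioning to another state. Three-parameter Mittag-Leffler function: $E_{\alpha,b}^{\gamma}(x)=\sum_{j\ge0}\frac{(\gamma)_j x^j}{j!\Gamma(\alpha j+b)}$ with Pochhammer symbol $(\gamma)_j$, $(\gamma)_0=1$ (so $E^0_{\alpha,b}(x)=1/\Gamma(b)$). *)

theory Defs
  imports "HOL-Probability.Probability" "HOL-Library.Infinite_Set"
begin

text \<open>Transition rates of the Erlang queue on states (n,s) :: nat \<times> nat
  (state space {(0,0)} \<union> {(n,s). n \<ge> 1, 1 \<le> s \<le> k}).\<close>
definition erlang_rate :: "nat \<Rightarrow> real \<Rightarrow> real \<Rightarrow> nat \<times> nat \<Rightarrow> nat \<times> nat \<Rightarrow> real" where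
  "erlang_rate k lam mu x y =
     (if x = (0,0) then (if y = (1,k) then lam else 0)
      else (if y = (fst x + 1, snd x) then lam else 0)
         + (if snd x \<ge> 2 \<and> y = (fst x, snd x - 1) then real k * mu else 0)
         + (if snd x = 1 \<and> fst x \<ge> 2 \<and> y = (fst x - 1, k) then real k * mu else 0)
         + (if x = (1,1) \<and> y = (0,0) then real k * mu else 0))"

definition exit_rate :: "nat \<Rightarrow> real \<Rightarrow> real \<Rightarrow> nat \<times> nat \<Rightarrow> real" where
  "exit_rate k lam mu x = (\<Sum>\<^sub>\<infinity>y\<in>-{x}. erlang_rate k lam mu x y)"

definition jump_prob :: "nat \<Rightarrow> real \<Rightarrow> real \<Rightarrow> nat \<times> nat \<Rightarrow> nat \<times> nat \<Rightarrow> real" where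
  "jump_prob k lam mu x y =
     (if y = x then 0 else erlang_rate k lam mu x y / exit_rate k lam mu x)"

text \<open>Jump chain / holding time definition of a CTMC started at (0,0) with the above rates
  (Norris, Markov Chains, Sect. 2.6): J is the jump chain, H n the n-th holding time;
  their joint finite-dimensional law is prescribed, and Q is obtained pathwise.\<close>
definition erlang_ctmc ::
  "'w measure \<Rightarrow> nat \<Rightarrow> real \<Rightarrow> real \<Rightarrow> (real \<Rightarrow> 'w \<Rightarrow> nat \<times> nat) \<Rightarrow> bool" where
  "erlang_ctmc M k lam mu Q \<longleftrightarrow>
     (\<exists>(J :: nat \<Rightarrow> 'w \<Rightarrow> nat \<times> nat) (H :: nat \<Rightarrow> 'w \<Rightarrow> real).
        (\<forall>n. J n \<in> measurable M (count_space UNIV)) \<and>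
        (\<forall>n. H n \<in> borel_measurable M) \<and>
        (\<forall>n (x :: nat \<Rightarrow> nat \<times> nat) (s :: nat \<Rightarrow> real). (\<forall>i\<le>n. 0 \<le> s i) \<longrightarrow>
           measure M {\<omega> \<in> space M. \<forall>i\<le>n. J i \<omega> = x i \<and> H i \<omega> > s i} =
             (if x 0 = (0,0) then 1 else 0)
             * (\<Prod>i<n. jump_prob k lam mu (x i) (x (Suc i)))
             * (\<Prod>i\<le>n. exp (- exit_rate k lam mu (x i) * s i))) \<and>
        (\<forall>\<omega>\<in>space M. (\<forall>i. 0 < H i \<omega>) \<and>
            filterlim (\<lambda>n. \<Sum>i<n. H i \<omega>) at_top sequentially) \<and>
        (\<forall>\<omega>\<in>space M. \<forall>t n. (\<Sum>i<n. H i \<omega>) \<le> t \<and> t < (\<Sum>i\<le>n. H i \<omega>) \<longrightarrow>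
            Q t \<omega> = J n \<omega>))"

definition tempered_subordinator ::
  "'w measure \<Rightarrow> real \<Rightarrow> real \<Rightarrow> (real \<Rightarrow> 'w \<Rightarrow> real) \<Rightarrow> bool" where
  "tempered_subordinator M \<theta> \<alpha> D \<longleftrightarrow>
     (\<forall>t. D t \<in> borel_measurable M) \<and>
     (\<forall>\<omega>\<in>space M. D 0 \<omega> = 0 \<and> mono_on {0..} (\<lambda>t. D t \<omega>) \<and>
        (\<forall>t\<ge>0. continuous (at_right t) (\<lambda>x. D x \<omega>))) \<and>
     (\<forall>s t. 0 \<le> s \<longrightarrow> s \<le> t \<longrightarrow>
        distr M borel (\<lambda>\<omega>. D t \<omega> - D s \<omega>) = distr M borel (D (t - s))) \<and>
     (\<forall>n (ts :: nat \<Rightarrow> real). 0 \<le> ts 0 \<longrightarrow> (\<forall>i<n. ts i \<le> ts (Suc i)) \<longrightarrow>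
        prob_space.indep_vars M (\<lambda>_. borel) (\<lambda>i \<omega>. D (ts (Suc i)) \<omega> - D (ts i) \<omega>) {..<n}) \<and>
     (\<forall>s t. 0 \<le> s \<longrightarrow> 0 \<le> t \<longrightarrow>
        integral\<^sup>L M (\<lambda>\<omega>. exp (- s * D t \<omega>)) = exp (- t * ((s + \<theta>) powr \<alpha> - \<theta> powr \<alpha>)))"

definition inv_sub :: "(real \<Rightarrow> 'w \<Rightarrow> real) \<Rightarrow> real \<Rightarrow> 'w \<Rightarrow> real" where
  "inv_sub D t \<omega> = Inf {x. 0 < x \<and> D x \<omega> > t}"

definition indep_processes ::
  "'w measure \<Rightarrow> (real \<Rightarrow> 'w \<Rightarrow> 'a) \<Rightarrow> (real \<Rightarrow> 'w \<Rightarrow> real) \<Rightarrow> bool" where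
  "indep_processes M Q D \<longleftrightarrow>
     (\<lambda>\<omega> t. Q t \<omega>) \<in> measurable M (Pi\<^sub>M UNIV (\<lambda>_. count_space UNIV)) \<and>
     (\<lambda>\<omega> t. D t \<omega>) \<in> measurable M (Pi\<^sub>M UNIV (\<lambda>_. borel)) \<and>
     prob_space.indep_set M
       {(\<lambda>\<omega> t. Q t \<omega>) -` A \<inter> space M | A. A \<in> sets (Pi\<^sub>M UNIV (\<lambda>_. count_space UNIV))}
       {(\<lambda>\<omega> t. D t \<omega>) -` B \<inter> space M | B. B \<in> sets (Pi\<^sub>M UNIV (\<lambda>_. borel))}"

definition gk :: "nat \<Rightarrow> nat \<times> nat \<Rightarrow> nat" where
  "gk k x = (if x = (0,0) then 0 else k * (fst x - 1) + snd x)"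

definition Lproc :: "nat \<Rightarrow> (real \<Rightarrow> 'w \<Rightarrow> nat \<times> nat) \<Rightarrow> (real \<Rightarrow> 'w \<Rightarrow> real) \<Rightarrow> real \<Rightarrow> 'w \<Rightarrow> nat" where
  "Lproc k Q D t \<omega> = gk k (Q (inv_sub D t \<omega>) \<omega>)"

primrec jump_time :: "nat \<Rightarrow> (real \<Rightarrow> 'w \<Rightarrow> nat \<times> nat) \<Rightarrow> (real \<Rightarrow> 'w \<Rightarrow> real) \<Rightarrow> nat \<Rightarrow> 'w \<Rightarrow> real" where
  "jump_time k Q D 0 \<omega> = 0"
| "jump_time k Q D (Suc n) \<omega> =
     Inf {t. t > jump_time k Q D n \<omega> \<and> Lproc k Q D t \<omega> \<noteq> Lproc k Q D (jump_time k Q D n \<omega>) \<omega>}"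

definition sojourn :: "nat \<Rightarrow> (real \<Rightarrow> 'w \<Rightarrow> nat \<times> nat) \<Rightarrow> (real \<Rightarrow> 'w \<Rightarrow> real) \<Rightarrow> nat \<Rightarrow> 'w \<Rightarrow> real" where
  "sojourn k Q D n \<omega> = jump_time k Q D (Suc n) \<omega> - jump_time k Q D n \<omega>"

definition nz_sojourn :: "nat \<Rightarrow> (real \<Rightarrow> 'w \<Rightarrow> nat \<times> nat) \<Rightarrow> (real \<Rightarrow> 'w \<Rightarrow> real) \<Rightarrow> nat \<Rightarrow> 'w \<Rightarrow> real" where
  "nz_sojourn k Q D m \<omega> =
     sojourn k Q D (enumerate {n. Lproc k Q D (jump_time k Q D n \<omega>) \<omega> \<noteq> 0} m) \<omega>"

definition ML3 :: "real \<Rightarrow> real \<Rightarrow> real \<Rightarrow> real \<Rightarrow> real" where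
  "ML3 a b g x = (\<Sum>j. pochhammer g j * x ^ j / (fact j * Gamma (a * real j + b)))"

definition sojourn_survival :: "nat \<Rightarrow> real \<Rightarrow> real \<Rightarrow> real \<Rightarrow> real \<Rightarrow> real \<Rightarrow> real" where
  "sojourn_survival k lam mu \<theta> \<alpha> t =
     exp (- \<theta> * t) * (\<Sum>q. (\<theta> * t) ^ q *
        (\<Sum>r. (- (lam + real k * mu) * t powr \<alpha>) ^ r
              * ML3 \<alpha> (real r * \<alpha> + real q + 1) (real r) (\<theta> powr \<alpha> * t powr \<alpha>)))"

end

theory Submission
  imports Defs "HOL-Real_Asymp.Real_Asymp"
begin

text \<open>Let \<open>T\<^sub>n\<close> be the jump times of the queue \<open>Q\<close>. Since the subordinator \<open>D\<close> is almost surely strictly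
  increasing, the level process \<open>L\<close> jumps at the left limits \<open>D(T\<^sub>n-)\<close>. Approximating \<open>T\<^sub>n\<close> from the left by
  grid points and using the independence of \<open>Q\<close> and \<open>D\<close> together with the stationary independent
  increments of \<open>D\<close>, the joint Laplace transform of the sojourn times on a path event of the jump chain is
  that of the holding times evaluated at \<open>\<psi>(s) = (s + \<theta>)\<^sup>\<alpha> - \<theta>\<^sup>\<alpha>\<close>. Hence, given the path, the sojourn times are
  independent, and in a busy state they have Laplace transform \<open>\<beta> / (\<beta> + \<psi>(s))\<close> with \<open>\<beta> = \<lambda> + k \<mu>\<close>. The survival
  function thus has the transform \<open>\<psi>(s) / (s (\<beta> + \<psi>(s)))\<close>, which is also the transform of the Mittag-Leffler
  series, computed term by term; both functions agree by uniqueness of Laplace transforms.\<close>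

subsection \<open>Uniqueness of Laplace transforms\<close>

text \<open>Left limits appear because the inverse subordinator has reached \<open>T n\<close> at
  time \<open>t\<close> iff \<open>D x \<le> t\<close> for all \<open>x < T n\<close>. Three
  obstacles shape the proof. (a) Independence is assumed between the processes \<open>Q\<close> and
  \<open>D\<close>, whereas the jump chain and the holding times are mere existential witnesses; the
  jump times have to be recovered as functions of \<open>Q\<close> before independence applies. (b)
  Passing from tails to exponentials, and from exponentials to Borel sets, would call for
  multivariate uniqueness theorems. Instead all factors of a product but one are absorbed into a
  weight, and a one-dimensional result is applied to one coordinate after the other. (c) The
  transform of the triple series is computed for large arguments only, so uniqueness is stated from
  an arbitrary offset on; it yields equality almost everywhere, and one-sided continuity extends it
  to every \<open>t\<close>. Finally, which sojourn is the \<open>m\<close>-th busy one depends on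
  the path, but only on a finite prefix of bounded length, so a countable case distinction makes the
  indices deterministic.\<close>

lemma finite_measure_laplace_polynomial:
  fixes \<mu> \<nu> :: "real measure"
  assumes "finite_measure \<mu>" "finite_measure \<nu>" and sets [simp]: "sets \<mu> = sets borel" "sets \<nu> = sets borel"
    and pos: "AE x in \<mu>. 0 \<le> x" "AE x in \<nu>. 0 \<le> x"
    and eq: "\<And>n::nat. (\<integral>x. exp (- real n * x) \<partial>\<mu>) = (\<integral>x. exp (- real n * x) \<partial>\<nu>)"
    and p: "real_polynomial_function p"
  shows "(\<integral>x. p (exp (- x)) \<partial>\<mu>) = (\<integral>x. p (exp (- x)) \<partial>\<nu>)"
proof -
  interpret A: finite_measure \<mu> by fact
  interpret B: finite_measure \<nu> by fact
  have [measurable_cong]: "sets \<mu> = sets borel" "sets \<nu> = sets borel" by simp_all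
  obtain a n where p: "p = (\<lambda>x. \<Sum>i\<le>n. a i * x ^ i)"
    using p real_polynomial_function_iff_sum by blast
  have e: "exp (- x) ^ i = exp (- real i * x)" for x :: real and i
    by (simp add: exp_of_nat_mult [symmetric])
  have le1: "exp (- real i * x) \<le> 1" if "0 \<le> x" for x :: real and i
    using that by simp
  have i1: "integrable \<mu> (\<lambda>x. exp (- real i * x))" for i
    using pos(1) le1 by (intro A.integrable_const_bound [where B = 1]) auto
  have i2: "integrable \<nu> (\<lambda>x. exp (- real i * x))" for i
    using pos(2) le1 by (intro B.integrable_const_bound [where B = 1]) auto
  show ?thesis
    unfolding p e using i1 i2 eq by (subst (1 2) Bochner_Integration.integral_sum) auto
qed

text \<open>Substituting \<open>y = exp (- x)\<close> turns the Laplace transform at the natural numbers into the moments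
  of a measure on the unit interval, which determine it by Weierstrass approximation.\<close>

lemma finite_measure_laplace_unique:
  fixes \<mu> \<nu> :: "real measure"
  assumes "finite_measure \<mu>" "finite_measure \<nu>" and sets: "sets \<mu> = sets borel" "sets \<nu> = sets borel"
    and pos: "AE x in \<mu>. 0 \<le> x" "AE x in \<nu>. 0 \<le> x"
    and eq: "\<And>n::nat. (\<integral>x. exp (- real n * x) \<partial>\<mu>) = (\<integral>x. exp (- real n * x) \<partial>\<nu>)"
  shows "\<mu> = \<nu>"
proof -
  interpret A: finite_measure \<mu> by fact
  interpret B: finite_measure \<nu> by fact
  have [measurable_cong]: "sets \<mu> = sets borel" "sets \<nu> = sets borel" by fact+
  have [simp]: "space \<mu> = UNIV" "space \<nu> = UNIV"
    using sets[THEN sets_eq_imp_space_eq] by simp_all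
  interpret A: finite_borel_measure \<mu> by standard (simp_all add: sets)
  interpret B: finite_borel_measure \<nu> by standard (simp_all add: sets)
  let ?m = "measure \<mu> UNIV + measure \<nu> UNIV"
  \<comment> \<open>For \<open>0 \<le> x\<close> the argument \<open>exp (- x)\<close> stays in the
    compact interval \<open>{0..1}\<close>, on which \<open>f\<close> is bounded.\<close>
  have bnd: "integrable N (\<lambda>x. f (exp (- x)))"
    if "finite_measure N" "sets N = sets borel" "AE x in N. 0 \<le> x" "continuous_on {0..1} f" 
      "(\<lambda>x. f (exp (- x))) \<in> borel_measurable borel"
    for N :: "real measure" and f :: "real \<Rightarrow> real"
  proof -
    interpret N: finite_measure N by fact
    have [measurable_cong]: "sets N = sets borel" by fact
    note that(5) [measurable]
    have "compact (f ` {0..1})" using that(4) by (intro compact_continuous_image) auto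
    then obtain C where "\<And>y. y \<in> {0..1} \<Longrightarrow> norm (f y) \<le> C"
      by (metis bounded_iff compact_imp_bounded imageI)
    with that(3) show ?thesis
      by (intro N.integrable_const_bound [where B = C]) (auto elim!: eventually_mono)
  qed
  have cont: "(\<integral>x. f (exp (- x)) \<partial>\<mu>) = (\<integral>x. f (exp (- x)) \<partial>\<nu>)"
    if f: "continuous_on UNIV f" for f :: "real \<Rightarrow> real"
  proof (rule ccontr)
    let ?I = "\<integral>x. f (exp (- x)) \<partial>\<mu>" and ?J = "\<integral>x. f (exp (- x)) \<partial>\<nu>"
    assume ne: "?I \<noteq> ?J"
    \<comment> \<open>The two approximation errors add up to at most \<open>e * ?m\<close>, and this
      choice makes \<open>e * ?m\<close> smaller than the gap \<open>\<bar>?I - ?J\<bar>\<close>;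
      the \<open>+ 1\<close> keeps the denominator positive when both measures are null.\<close>
    define e where "e = \<bar>?I - ?J\<bar> / (2 * (?m + 1))"
    have mp: "?m + 1 > 0" by (simp add: add_nonneg_pos)
    with ne have "e > 0" by (simp add: e_def)
    then obtain p where p: "real_polynomial_function p" "\<And>x. x \<in> {0..1} \<Longrightarrow> \<bar>f x - p x\<bar> < e"
      using Stone_Weierstrass_real_polynomial_function [of "{0..1::real}" f e] f continuous_on_subset
      by blast
    have cp: "continuous_on A p" for A
      by (simp add: p(1) continuous_real_polymonial_function continuous_at_imp_continuous_on)
    have pm [measurable]: "p \<in> borel_measurable borel" "f \<in> borel_measurable borel"
      using cp f by (auto intro: borel_measurable_continuous_onI)
    have d: "\<bar>(\<integral>x. f (exp (- x)) \<partial>N) - (\<integral>x. p (exp (- x)) \<partial>N)\<bar> \<le> e * measure N UNIV"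
      if N: "finite_measure N" "sets N = sets borel" "AE x in N. 0 \<le> x" for N :: "real measure"
    proof -
      interpret N: finite_measure N by fact
      have [measurable_cong]: "sets N = sets borel" by fact
      have [simp]: "space N = UNIV" using N(2) by (metis sets_eq_imp_space_eq space_borel)
      have i: "integrable N (\<lambda>x. f (exp (- x)))" "integrable N (\<lambda>x. p (exp (- x)))"
        using f cp by (auto intro!: bnd[OF N] intro: continuous_on_subset)
      have "\<bar>\<integral>x. f (exp (- x)) - p (exp (- x)) \<partial>N\<bar> \<le> (\<integral>x. \<bar>f (exp (- x)) - p (exp (- x))\<bar> \<partial>N)"
        by (rule integral_abs_bound)
      also have "\<dots> \<le> (\<integral>x. e \<partial>N)"
        using N(3) p(2) i by (intro integral_mono_AE) (auto elim!: eventually_mono intro!: less_imp_le)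
      finally show ?thesis using i by (simp add: mult.commute)
    qed
    have "(\<integral>x. p (exp (- x)) \<partial>\<mu>) = (\<integral>x. p (exp (- x)) \<partial>\<nu>)"
      by (rule finite_measure_laplace_polynomial) (use assms p in auto)
    with d[of \<mu>] d[of \<nu>] have "\<bar>?I - ?J\<bar> \<le> e * ?m"
      using assms by (simp add: distrib_left)
    also have "\<dots> < e * (2 * (?m + 1))"
      using \<open>e > 0\<close> mp by (intro mult_strict_left_mono) auto
    also have "\<dots> = \<bar>?I - ?J\<bar>" using mp by (simp add: e_def)
    finally show False by simp
  qed
  have "cdf \<mu> = cdf \<nu>"
  proof
    fix t :: real
    \<comment> \<open>A continuous ramp: it is 1 from \<open>exp (- t)\<close> upwards and 0 below
      \<open>exp (- t) - 1 / k\<close>. Since \<open>exp (- x)\<close> decreases in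
      \<open>x\<close>, its limit at \<open>exp (- x)\<close> is the indicator of
      \<open>{..t}\<close>, so the integrals converge to the distribution function.\<close>
    define f where "f k y = max 0 (min 1 (1 + real k * (y - exp (- t))))" for k y
    have lim: "(\<lambda>k. f k (exp (- x))) \<longlonglongrightarrow> indicator {..t} x" for x
    proof (cases "x \<le> t")
      case True
      then have "f k (exp (- x)) = 1" for k by (simp add: f_def)
      with True show ?thesis by simp
    next
      case False
      then have "filterlim (\<lambda>k. (exp (- t) - exp (- x)) * real k) at_top sequentially"
        by (intro filterlim_tendsto_pos_mult_at_top [OF tendsto_const _ filterlim_real_sequentially]) simp
      then have "eventually (\<lambda>k. 1 \<le> (exp (- t) - exp (- x)) * real k) sequentially"
        by (simp add: filterlim_at_top)
      then have "eventually (\<lambda>k. f k (exp (- x)) = 0) sequentially"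
        by eventually_elim (auto simp: f_def algebra_simps max_def)
      with False show ?thesis by (simp add: tendsto_eventually)
    qed
    have l: "(\<lambda>k. \<integral>x. f k (exp (- x)) \<partial>N) \<longlonglongrightarrow> cdf N t"
      if N: "finite_measure N" "sets N = sets borel" for N :: "real measure"
    proof -
      interpret N: finite_measure N by fact
      have [measurable_cong]: "sets N = sets borel" by fact
      have "(\<lambda>k. \<integral>x. f k (exp (- x)) \<partial>N) \<longlonglongrightarrow> (\<integral>x. indicator {..t} x \<partial>N)"
        using lim unfolding f_def
        by (intro integral_dominated_convergence [where w = "\<lambda>_. 1"]) auto
      then show ?thesis using N(2) by (simp add: cdf_def)
    qed
    have "continuous_on UNIV (f k)" for k
      unfolding f_def by (intro continuous_intros)
    from cont[OF this] l[of \<mu>] l[of \<nu>] assms show "cdf \<mu> t = cdf \<nu> t"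
      by (auto intro: LIMSEQ_unique)
  qed
  then show ?thesis
    by (rule cdf_unique' [rotated 2]) unfold_locales
qed

text \<open>The factor \<open>exp (- c * t)\<close> is absorbed into the functions, which leaves
  transforms at the natural numbers. The difference \<open>d\<close> has no sign, so its positive
  and negative parts serve as densities of two finite measures with equal transforms; these measures
  coincide, hence so do the two parts, which forces \<open>d = 0\<close> almost everywhere.\<close>

lemma laplace_unique_AE:
  fixes g h :: "real \<Rightarrow> real"
  assumes g: "\<And>n::nat. integrable lborel (\<lambda>t. indicator {0<..} t * (exp (- (c + real n) * t) * g t))"
    and h: "\<And>n::nat. integrable lborel (\<lambda>t. indicator {0<..} t * (exp (- (c + real n) * t) * h t))"
    and eq: "\<And>n::nat. (\<integral>t. indicator {0<..} t * (exp (- (c + real n) * t) * g t) \<partial>lborel)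
      = (\<integral>t. indicator {0<..} t * (exp (- (c + real n) * t) * h t) \<partial>lborel)"
  shows "AE t in lborel. 0 < t \<longrightarrow> g t = h t"
proof -
  define d where "d t = indicator {0<..} t * (exp (- c * t) * (g t - h t))" for t
  have dn: "indicator {0<..} t * (exp (- (c + real n) * t) * g t) - indicator {0<..} t * (exp (- (c + real n) * t) * h t)
     = d t * exp (- real n * t)" for t n
    by (simp add: d_def exp_add [symmetric] algebra_simps flip: exp_add)
  have i: "integrable lborel (\<lambda>t. d t * exp (- real n * t))" for n
    using Bochner_Integration.integrable_diff[OF g h, of n n] unfolding dn .
  have z: "(\<integral>t. d t * exp (- real n * t) \<partial>lborel) = 0" for n
    using Bochner_Integration.integral_diff[OF g h, of n n] eq[of n] unfolding dn by simp
  have di: "integrable lborel d" using i[of 0] by simp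
  then have dm [measurable]: "d \<in> borel_measurable borel" by auto
  define P where "P = density lborel (\<lambda>t. ennreal (max 0 (d t)))"
  define N where "N = density lborel (\<lambda>t. ennreal (max 0 (- d t)))"
  have di2: "integrable lborel (\<lambda>t. max 0 (d t))" "integrable lborel (\<lambda>t. max 0 (- d t))"
    using di by auto
  have ip: "(\<integral>t. exp (- real n * t) \<partial>P) = (\<integral>t. max 0 (d t) * exp (- real n * t) \<partial>lborel)" for n
    unfolding P_def by (subst integral_density) auto
  have iN: "(\<integral>t. exp (- real n * t) \<partial>N) = (\<integral>t. max 0 (- d t) * exp (- real n * t) \<partial>lborel)" for n
    unfolding N_def by (subst integral_density) auto
  have ii: "integrable lborel (\<lambda>t. max 0 (d t) * exp (- real n * t))"
      "integrable lborel (\<lambda>t. max 0 (- d t) * exp (- real n * t))" for n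
    by (rule Bochner_Integration.integrable_bound[OF i[of n]]; simp add: abs_mult max_def)+
  have "P = N"
  proof (rule finite_measure_laplace_unique)
    show "finite_measure P" "finite_measure N"
      using di2 by (auto intro!: finite_measureI simp: P_def N_def emeasure_density real_integrable_def)
    show "AE x in P. 0 \<le> x" "AE x in N. 0 \<le> x"
      unfolding P_def N_def by (subst AE_density, simp, intro AE_I2, simp add: d_def indicator_def split: if_splits)+
    fix n :: nat
    have "(\<integral>t. exp (- real n * t) \<partial>P) - (\<integral>t. exp (- real n * t) \<partial>N) 
        = (\<integral>t. max 0 (d t) * exp (- real n * t) - max 0 (- d t) * exp (- real n * t) \<partial>lborel)"
      unfolding ip iN using ii by simp
    also have "\<dots> = (\<integral>t. d t * exp (- real n * t) \<partial>lborel)"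
      by (intro Bochner_Integration.integral_cong) (auto simp: max_def)
    finally show "(\<integral>t. exp (- real n * t) \<partial>P) = (\<integral>t. exp (- real n * t) \<partial>N)"
      using z[of n] by simp
  qed (simp_all add: P_def N_def)
  then have "AE t in lborel. ennreal (max 0 (d t)) = ennreal (max 0 (- d t))"
    unfolding P_def N_def by (intro sigma_finite_measure.density_unique[OF sigma_finite_lborel]) auto
  then show ?thesis
  proof eventually_elim
    case (elim t)
    then have "max 0 (d t) = max 0 (- d t)" by (simp only: ennreal_inj max.cobounded1)
    then have "d t = 0" by linarith
    then show ?case by (auto simp: d_def)
  qed
qed

subsection \<open>The Laplace transform of the Mittag-Leffler series\<close>

text \<open>\<open>v\<close> and \<open>V\<close> are the Laplace transforms at \<open>u\<close> of \<open>g\<close> and of a monotone majorant \<open>G\<close>. Monotonicity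
  of \<open>G\<close> makes the relation stable under series: summability of the transforms of the majorants
  yields summability of the majorants at almost every, hence by monotonicity at every, point.\<close>

definition majorized_laplace :: "real \<Rightarrow> (real \<Rightarrow> real) \<Rightarrow> (real \<Rightarrow> real) \<Rightarrow> real \<Rightarrow> real \<Rightarrow> bool" where
  "majorized_laplace u g G v V \<longleftrightarrow>
     continuous_on {0..} g \<and> mono_on {0..} G \<and> G \<in> borel_measurable borel \<and> g \<in> borel_measurable borel \<and>
     (\<forall>t\<ge>0. \<bar>g t\<bar> \<le> G t) \<and>
     has_bochner_integral lborel (\<lambda>t. indicator {0<..} t * (exp (- u * t) * g t)) v \<and>
     has_bochner_integral lborel (\<lambda>t. indicator {0<..} t * (exp (- u * t) * G t)) V"

text \<open>The conclusion has the same form as the hypothesis, so that the lemma can be iterated,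
  once for each of the three nested sums. Interchanging sum and integral for the nonnegative
  majorants shows that their series is finite at almost every point; since \<open>{t<..}\<close> is
  not a null set, a point of convergence lies to the right of any \<open>t\<close>. The second
  conclusion later justifies pulling factors out of the inner series.\<close>

lemma majorized_laplace_sums:
  assumes L: "\<And>n. majorized_laplace u (g n) (G n) (v n) (V n)"
    and V: "summable V"
  shows "majorized_laplace u (\<lambda>t. \<Sum>n. g n t) (\<lambda>t. \<Sum>n. G n t) (\<Sum>n. v n) (\<Sum>n. V n)"
    and "\<And>t. 0 \<le> t \<Longrightarrow> summable (\<lambda>n. G n t)"
    and "summable v"
proof -
  have m [measurable]: "g n \<in> borel_measurable borel" "G n \<in> borel_measurable borel" for n
    using L[of n] by (auto simp: majorized_laplace_def)
  have le: "\<bar>g n t\<bar> \<le> G n t" if "0 \<le> t" for n t using L[of n] that by (auto simp: majorized_laplace_def)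
  have pos: "0 \<le> G n t" if "0 \<le> t" for n t using le[OF that, of n] by linarith
  have mono: "G n s \<le> G n t" if "0 \<le> s" "s \<le> t" for n s t
    using L[of n] that by (auto simp: majorized_laplace_def mono_on_def)
  let ?g = "\<lambda>n t. indicator {0<..} t * (exp (- u * t) * g n t)"
  let ?G = "\<lambda>n t. indicator {0<..} t * (exp (- u * t) * G n t)"
  have hb: "has_bochner_integral lborel (?g n) (v n)" "has_bochner_integral lborel (?G n) (V n)" for n
    using L[of n] by (auto simp: majorized_laplace_def)
  have V0: "0 \<le> V n" for n
  proof -
    have "0 \<le> integral\<^sup>L lborel (?G n)"
      using pos by (intro integral_nonneg_AE AE_I2) (auto simp: indicator_def)
    then show ?thesis using hb(2)[of n] by (simp add: has_bochner_integral_iff)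
  qed
  have G0: "0 \<le> ?G n t" for n t using pos by (auto simp: indicator_def)
  have nn: "(\<integral>\<^sup>+t. ennreal (?G n t) \<partial>lborel) = ennreal (V n)" for n
  proof -
    have "integrable lborel (?G n)" "integral\<^sup>L lborel (?G n) = V n"
      using hb(2)[of n] by (simp_all add: has_bochner_integral_iff)
    then show ?thesis using nn_integral_eq_integral[of lborel "?G n"] G0 by auto
  qed
  have "(\<integral>\<^sup>+t. (\<Sum>n. ennreal (?G n t)) \<partial>lborel) = (\<Sum>n. \<integral>\<^sup>+t. ennreal (?G n t) \<partial>lborel)"
    by (intro nn_integral_suminf) simp
  also have "\<dots> = (\<Sum>n. ennreal (V n))" by (simp only: nn)
  also have "\<dots> = ennreal (\<Sum>n. V n)" using V V0 by (intro suminf_ennreal2) auto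
  finally have "(\<integral>\<^sup>+t. (\<Sum>n. ennreal (?G n t)) \<partial>lborel) \<noteq> \<infinity>" by simp
  then have "AE t in lborel. (\<Sum>n. ennreal (?G n t)) \<noteq> \<infinity>"
    by (intro nn_integral_PInf_AE) auto
  then have ae: "AE t in lborel. 0 < t \<longrightarrow> summable (\<lambda>n. G n t)"
  proof eventually_elim
    case (elim t)
    show ?case
    proof
      assume t: "0 < t"
      have "summable (\<lambda>n. ?G n t)"
        using elim pos[of t] t by (intro summable_suminf_not_top) (auto simp: indicator_def)
      then show "summable (\<lambda>n. G n t)" using t summable_cmult_iff[of "exp (- u * t)" "\<lambda>n. G n t"]
        by simp
    qed
  qed
  have S: "summable (\<lambda>n. G n t)" if t: "0 \<le> t" for t
  proof -
    have "\<not> (AE s in lborel. s \<notin> {t<..})"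
    proof
      assume "AE s in lborel. s \<notin> {t<..}"
      then have "AE s in lborel. s \<notin> {t<..t+1}" by eventually_elim auto
      then have "emeasure lborel {t<..t+1} = 0"
        using AE_iff_null_sets[of "{t<..t+1}" lborel] by auto
      then show False by simp
    qed
    moreover have "AE s in lborel. s \<notin> {t<..}" if "\<And>s. t < s \<Longrightarrow> \<not> summable (\<lambda>n. G n s)"
      using ae
    proof eventually_elim
      case (elim s)
      then show ?case using that[of s] t by fastforce
    qed
    ultimately obtain s where s: "t < s" "summable (\<lambda>n. G n s)" by metis
    have "norm (G n t) \<le> G n s" for n using pos[OF t, of n] mono[of t s n] s(1) t by simp
    then show ?thesis
      by (rule summable_comparison_test'[OF s(2), of 0])
  qed
  then show "\<And>t. 0 \<le> t \<Longrightarrow> summable (\<lambda>n. G n t)" .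
  have vV: "\<bar>v n\<bar> \<le> V n" for n
  proof -
    have "integrable lborel (?g n)" "integrable lborel (?G n)"
        "v n = integral\<^sup>L lborel (?g n)" "V n = integral\<^sup>L lborel (?G n)"
      using hb[of n] by (simp_all add: has_bochner_integral_iff)
    moreover have "\<bar>?g n t\<bar> \<le> ?G n t" for t
      using le[of t n] by (auto simp: indicator_def abs_mult)
    ultimately show ?thesis using integral_abs_bound_integral[of lborel "?g n" "?G n"] by simp
  qed
  then show "summable v"
    by (intro summable_comparison_test'[OF V, of 0]) simp
  have cont: "continuous_on {0..} (\<lambda>t. \<Sum>n. g n t)"
    unfolding continuous_on_eq_continuous_within
  proof
    fix t :: real assume t: "t \<in> {0..}"
    have "norm (g n x) \<le> G n (t + 1)" if "x \<in> {0..t + 1}" for n x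
      using le[of x n] mono[of x "t + 1" n] that by simp
    then have "uniform_limit {0..t + 1} (\<lambda>n x. \<Sum>i<n. g i x) (\<lambda>x. \<Sum>i. g i x) sequentially"
      by (rule Weierstrass_m_test [OF _ S]) (use t in auto)
    moreover have "continuous_on {0..t + 1} (g n)" for n
      using L[of n] by (auto simp: majorized_laplace_def intro: continuous_on_subset)
    ultimately have "continuous_on {0..t + 1} (\<lambda>x. \<Sum>i. g i x)"
      by (intro uniform_limit_theorem [where F = sequentially]) (auto intro!: always_eventually continuous_on_sum)
    then have "continuous (at t within {0..t + 1}) (\<lambda>x. \<Sum>i. g i x)"
      using t by (simp add: continuous_on_eq_continuous_within)
    moreover have "at t within {0..t + 1} = at t within {0..}"
      by (rule at_within_nhd [of t "{..<t + 1}"]) auto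
    ultimately show "continuous (at t within {0..}) (\<lambda>x. \<Sum>i. g i x)" by simp
  qed
  \<comment> \<open>Stated for arbitrary dominated functions because it serves twice: for the terms
    \<open>g n\<close> and for the majorants \<open>G n\<close> themselves.\<close>
  have hbS: "has_bochner_integral lborel (\<lambda>t. indicator {0<..} t * (exp (- u * t) * (\<Sum>n. f n t))) (\<Sum>n. w n)"
    if f: "\<And>n. has_bochner_integral lborel (\<lambda>t. indicator {0<..} t * (exp (- u * t) * f n t)) (w n)"
      and fG: "\<And>n t. 0 \<le> t \<Longrightarrow> \<bar>f n t\<bar> \<le> G n t" for f w
  proof -
    let ?f = "\<lambda>n t. indicator {0<..} t * (exp (- u * t) * f n t)"
    have i: "integrable lborel (?f n)" for n using f by (auto simp: has_bochner_integral_iff)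
    have ab: "AE t in lborel. summable (\<lambda>n. norm (?f n t))"
    proof (intro AE_I2)
      fix t :: real
      have "summable (\<lambda>n. \<bar>f n t\<bar>)" if "0 < t"
        using that by (intro summable_comparison_test'[OF S[of t], of 0]) (auto simp: fG)
      then show "summable (\<lambda>n. norm (?f n t))" by (auto simp: indicator_def abs_mult)
    qed
    have nle: "(\<integral>t. norm (?f n t) \<partial>lborel) \<le> V n" for n
    proof -
      have "norm (?f n t) \<le> ?G n t" for t
        using fG[of t n] by (auto simp: indicator_def abs_mult)
      moreover have "integrable lborel (?G n)" using hb[of n] by (simp add: has_bochner_integral_iff)
      ultimately have "(\<integral>t. norm (?f n t) \<partial>lborel) \<le> integral\<^sup>L lborel (?G n)"
        using i[of n] by (intro integral_mono integrable_norm)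
      also have "\<dots> = V n" using hb[of n] by (auto simp: has_bochner_integral_iff)
      finally show ?thesis .
    qed
    have nle0: "0 \<le> (\<integral>t. norm (?f n t) \<partial>lborel)" for n by (intro integral_nonneg_AE AE_I2) simp
    have sn: "summable (\<lambda>n. \<integral>t. norm (?f n t) \<partial>lborel)"
      by (rule summable_comparison_test'[OF V, of 0]) (use nle nle0 in \<open>simp add: abs_of_nonneg\<close>)
    have e: "(\<Sum>n. ?f n t) = indicator {0<..} t * (exp (- u * t) * (\<Sum>n. f n t))" for t
    proof (cases "0 < t")
      case True
      then have "summable (\<lambda>n. f n t)"
        by (intro summable_comparison_test'[OF S[of t], of 0]) (auto simp: fG)
      with True show ?thesis by (simp add: suminf_mult)
    qed simp
    have "(\<lambda>n. w n) = (\<lambda>n. integral\<^sup>L lborel (?f n))"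
      using f by (auto simp: has_bochner_integral_iff)
    then show ?thesis
      using integrable_suminf[OF i ab sn] integral_suminf[OF i ab sn]
      unfolding e by (simp add: has_bochner_integral_iff)
  qed
  have mono_sum: "mono_on {0..} (\<lambda>t. \<Sum>n. G n t)"
  proof (rule mono_onI)
    fix r t :: real assume "r \<in> {0..}" "t \<in> {0..}" "r \<le> t"
    then show "(\<Sum>n. G n r) \<le> (\<Sum>n. G n t)"
      using mono[of r t] S[of r] S[of t] by (intro suminf_le) auto
  qed
  have le_sum: "\<bar>\<Sum>n. g n t\<bar> \<le> (\<Sum>n. G n t)" if t: "0 \<le> t" for t
  proof -
    have s: "summable (\<lambda>n. \<bar>g n t\<bar>)"
      by (rule summable_comparison_test'[OF S[OF t], of 0]) (simp add: le t)
    then have "\<bar>\<Sum>n. g n t\<bar> \<le> (\<Sum>n. \<bar>g n t\<bar>)" by (rule summable_rabs)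
    also have "\<dots> \<le> (\<Sum>n. G n t)" by (rule suminf_le[OF le[OF t] s S[OF t]])
    finally show ?thesis .
  qed
  have absG: "\<bar>G n t\<bar> \<le> G n t" if "0 \<le> t" for n t using pos[OF that, of n] by simp
  have "(\<lambda>t. \<Sum>n. G n t) \<in> borel_measurable borel" "(\<lambda>t. \<Sum>n. g n t) \<in> borel_measurable borel"
    by measurable
  then show "majorized_laplace u (\<lambda>t. \<Sum>n. g n t) (\<lambda>t. \<Sum>n. G n t) (\<Sum>n. v n) (\<Sum>n. V n)"
    unfolding majorized_laplace_def
    by (intro conjI allI impI cont mono_sum le_sum hbS[OF hb(1) le] hbS[OF hb(2) absG])
qed

text \<open>This is Euler's Gamma integral after the substitution of \<open>u * t\<close> for the
  variable. The power is kept as \<open>t ^ q * (t powr a) ^ m\<close>, the shape in which it occurs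
  in the Mittag-Leffler series; for positive \<open>t\<close> it equals
  \<open>t powr (a * real m + real q)\<close>.\<close>

lemma has_laplace_power:
  fixes a u :: real
  assumes "0 < a" "0 < u"
  shows "has_bochner_integral lborel (\<lambda>t. indicator {0<..} t * (exp (- u * t) * (t ^ q * (t powr a) ^ m)))
    (Gamma (a * real m + real q + 1) / u powr (a * real m + real q + 1))"
proof -
  define p where "p = a * real m + real q"
  have p: "0 \<le> p" using assms by (simp add: p_def)
  have "((\<lambda>t. t powr (p + 1 - 1) / exp t) has_integral Gamma (p + 1)) {0..}"
    by (rule Gamma_integral_real) (use p in simp)
  then have "(\<integral>\<^sup>+t. ennreal (t powr p / exp t) * indicator {0..} t \<partial>lborel) = ennreal (Gamma (p + 1))"
    by (intro nn_integral_has_integral_lebesgue') auto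
  then have "(\<integral>\<^sup>+t. ennreal (indicator {0..} t * (t powr p / exp t)) \<partial>lborel) = ennreal (Gamma (p + 1))"
    by (simp add: indicator_mult_ennreal mult.commute)
  moreover have "0 \<le> Gamma (p + 1)" using Gamma_real_pos[of "p + 1"] p by simp
  ultimately have "has_bochner_integral lborel (\<lambda>t. indicator {0..} t * (t powr p / exp t)) (Gamma (p + 1))"
    by (intro has_bochner_integral_nn_integral AE_I2) (auto simp: indicator_def)
  then have "has_bochner_integral lborel (\<lambda>t. indicator {0..} (0 + u * t) * ((0 + u * t) powr p / exp (0 + u * t)))
      (Gamma (p + 1) /\<^sub>R \<bar>u\<bar>)"
    by (subst (asm) lborel_has_bochner_integral_real_affine_iff [where c = u and t = 0]) (use assms in auto)
  then have "has_bochner_integral lborel (\<lambda>t. indicator {0..} (0 + u * t) * ((0 + u * t) powr p / exp (0 + u * t)) * (1 / u powr p))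
      ((Gamma (p + 1) /\<^sub>R \<bar>u\<bar>) * (1 / u powr p))"
    by (rule has_bochner_integral_mult_left)
  moreover have "(Gamma (p + 1) /\<^sub>R \<bar>u\<bar>) * (1 / u powr p) = Gamma (p + 1) / u powr (p + 1)"
    using assms by (simp add: powr_add field_simps)
  moreover have "AE t in lborel. indicator {0..} (0 + u * t) * ((0 + u * t) powr p / exp (0 + u * t)) * (1 / u powr p)
     = indicator {0<..} t * (exp (- u * t) * (t ^ q * (t powr a) ^ m))"
    using AE_lborel_singleton[of 0]
  proof eventually_elim
    case (elim t)
    show ?case
    proof (cases "0 < t")
      case True
      then have "t powr p = t ^ q * (t powr a) ^ m"
        by (simp add: p_def powr_add powr_realpow powr_powr [symmetric] mult.commute)
      with True show ?thesis using assms
        by (simp add: powr_mult exp_minus field_simps zero_le_mult_iff)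
    qed (use elim assms in \<open>auto simp: zero_le_mult_iff\<close>)
  qed
  ultimately show ?thesis
    unfolding p_def by (subst (asm) has_bochner_integral_cong_AE) auto
qed

lemma majorized_laplace_power:
  fixes a u c :: real
  assumes "0 < a" "0 < u"
  shows "majorized_laplace u (\<lambda>t. c * (t ^ q * (t powr a) ^ m)) (\<lambda>t. \<bar>c\<bar> * (t ^ q * (t powr a) ^ m))
    (c * (Gamma (a * real m + real q + 1) / u powr (a * real m + real q + 1)))
    (\<bar>c\<bar> * (Gamma (a * real m + real q + 1) / u powr (a * real m + real q + 1)))"
proof -
  have H: "has_bochner_integral lborel (\<lambda>t. indicator {0<..} t * (exp (- u * t) * (d * (t ^ q * (t powr a) ^ m))))
    (d * (Gamma (a * real m + real q + 1) / u powr (a * real m + real q + 1)))" for d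
    using has_bochner_integral_mult_right[OF has_laplace_power[OF assms, of q m], of d]
    by (simp add: mult_ac)
  have "continuous_on {0..} (\<lambda>t. c * (t ^ q * (t powr a) ^ m))"
    using assms by (intro continuous_on_mult continuous_on_power continuous_on_powr' continuous_on_const continuous_on_id) auto
  moreover have "mono_on {0..} (\<lambda>t. \<bar>c\<bar> * (t ^ q * (t powr a) ^ m))"
    using assms by (auto simp: mono_on_def intro!: mult_left_mono mult_mono power_mono powr_mono2)
  ultimately show ?thesis
    unfolding majorized_laplace_def using H by (auto simp: abs_mult)
qed

text \<open>For \<open>c = 0\<close> nothing is known about \<open>f\<close>, but both sides vanish.
  This case occurs at \<open>t = 0\<close>, where the factors \<open>(\<theta> * t) ^ q\<close> with
  positive \<open>q\<close> are zero.\<close>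

lemma suminf_cmult_real:
  fixes c :: real
  assumes "summable (\<lambda>n. c * f n)"
  shows "(\<Sum>n. c * f n) = c * (\<Sum>n. f n)"
  using assms by (cases "c = 0") (simp_all add: suminf_mult summable_cmult_iff)

text \<open>Newton's binomial series with exponent \<open>- r\<close>; the signs of the generalised
  binomial coefficient and of \<open>(- x) ^ n\<close> combine to the Pochhammer symbol. It sums the
  innermost series once the transform has removed the Gamma functions.\<close>

lemma negative_binomial_sums:
  fixes x :: real
  assumes "0 \<le> x" "x < 1"
  shows "(\<lambda>j. pochhammer (real r) j * x ^ j / fact j) sums ((1 / (1 - x)) ^ r)"
proof -
  have "(\<lambda>n. ((- real r) gchoose n) * (- x) ^ n) sums (1 + - x) powr (- real r)"
    by (rule gen_binomial_real) (use assms in auto)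
  moreover have "((- real r) gchoose n) * (- x) ^ n = pochhammer (real r) n * x ^ n / fact n" for n
    by (simp add: gbinomial_pochhammer power_mult_distrib [symmetric] mult.commute mult.left_commute)
  moreover have "(1 + - x) powr (- real r) = (1 / (1 - x)) ^ r"
    using assms by (simp add: powr_minus powr_realpow power_one_over inverse_eq_divide)
  ultimately show ?thesis by simp
qed

text \<open>The factor \<open>exp (- \<theta> * t)\<close> of the survival function is left out
  because it only shifts the argument of the transform from \<open>s\<close> to
  \<open>u = s + \<theta>\<close>.\<close>

definition ml_triple_series :: "real \<Rightarrow> real \<Rightarrow> real \<Rightarrow> real \<Rightarrow> real" where
  "ml_triple_series b \<theta> \<alpha> t = (\<Sum>q. (\<theta> * t) ^ q *
        (\<Sum>r. (- b * t powr \<alpha>) ^ r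
              * ML3 \<alpha> (real r * \<alpha> + real q + 1) (real r) (\<theta> powr \<alpha> * t powr \<alpha>)))"

text \<open>Under the transform the Gamma function in each term cancels. What remains is a negative
  binomial series in \<open>j\<close>, a geometric series in \<open>r\<close> with ratio
  \<open>- y / (1 - x)\<close> and a geometric series in \<open>q\<close> with ratio
  \<open>z\<close>. The two conditions on \<open>u\<close> say \<open>z < 1\<close> and
  \<open>y < 1 - x\<close>; the latter makes the series of majorants, in which \<open>- y\<close>
  becomes \<open>y\<close>, converge as well.\<close>

lemma laplace_ml_triple_series:
  fixes b \<theta> \<alpha> u :: real
  assumes "0 \<le> b" "0 < \<theta>" "0 < \<alpha>" and u: "\<theta> < u" "b < u powr \<alpha> - \<theta> powr \<alpha>"
  shows "continuous_on {0..} (ml_triple_series b \<theta> \<alpha>)"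
    and "has_bochner_integral lborel (\<lambda>t. indicator {0<..} t * (exp (- u * t) * ml_triple_series b \<theta> \<alpha> t))
      ((u powr \<alpha> - \<theta> powr \<alpha>) / ((u - \<theta>) * (u powr \<alpha> - \<theta> powr \<alpha> + b)))"
proof -
  define x y z where "x = (\<theta> / u) powr \<alpha>" and "y = b / u powr \<alpha>" and "z = \<theta> / u"
  have u0: "0 < u" using assms by simp
  have x: "0 \<le> x" "x < 1" unfolding x_def using assms u0 powr_less_mono2[of \<alpha> "\<theta> / u" 1] by auto
  have z: "0 \<le> z" "z < 1" unfolding z_def using assms by auto
  have ua: "0 < u powr \<alpha>" using u0 by simp
  have xu: "x = \<theta> powr \<alpha> / u powr \<alpha>" unfolding x_def using assms u0 by (simp add: powr_divide)
  have y: "0 \<le> y" "y < 1 - x" unfolding y_def xu using assms ua by (auto simp: field_simps)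
  \<comment> \<open>\<open>c q r j\<close> is the coefficient of
    \<open>t ^ q * (t powr \<alpha>) ^ (r + j)\<close> in the triple series and
    \<open>K q r j\<close> the transform of that power.\<close>
  define c where "c q r j = \<theta> ^ q * (- b) ^ r * (pochhammer (real r) j * (\<theta> powr \<alpha>) ^ j /
      (fact j * Gamma (\<alpha> * real j + (real r * \<alpha> + real q + 1))))" for q r j
  define K where "K q r j = Gamma (\<alpha> * real (r + j) + real q + 1) / u powr (\<alpha> * real (r + j) + real q + 1)" for q r j
  have Gpos: "0 < Gamma (\<alpha> * real (r + j) + real q + 1)" for q r j
    using assms by (intro Gamma_real_pos) (simp add: add_nonneg_pos)
  have Geq: "\<alpha> * real j + (real r * \<alpha> + real q + 1) = \<alpha> * real (r + j) + real q + 1" for q r j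
    by (simp add: algebra_simps)
  have up: "u powr (\<alpha> * real (r + j) + real q + 1) = (u powr \<alpha>) ^ r * (u powr \<alpha>) ^ j * u ^ q * u" for q r j
    using u0 by (simp add: powr_add powr_realpow powr_powr [symmetric] distrib_left)
  have cK: "c q r j * K q r j = z ^ q / u * (- y) ^ r * (pochhammer (real r) j * x ^ j / fact j)" for q r j
    unfolding c_def K_def Geq up using Gpos[of r j q] u0 ua
    by (simp add: z_def y_def xu power_divide field_simps power_minus [of b] power_minus [of "b / u powr \<alpha>"])
  have ca: "\<bar>c q r j\<bar> * K q r j = z ^ q / u * y ^ r * (pochhammer (real r) j * x ^ j / fact j)" for q r j
  proof -
    have "0 < K q r j" unfolding K_def using Gpos[of r j q] u0 by simp
    then have "\<bar>c q r j\<bar> * K q r j = \<bar>c q r j * K q r j\<bar>" by (simp add: abs_mult)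
    also have "\<dots> = z ^ q / u * y ^ r * (pochhammer (real r) j * x ^ j / fact j)"
      unfolding cK using u0 x y z by (simp add: abs_mult power_abs pochhammer_prod abs_prod)
    finally show ?thesis .
  qed
  have s1: "(\<lambda>j. z ^ q / u * w ^ r * (pochhammer (real r) j * x ^ j / fact j)) sums (z ^ q / u * (w / (1 - x)) ^ r)" for q r w
    using sums_mult[OF negative_binomial_sums[OF x, of r], of "z ^ q / u * w ^ r"]
    by (simp add: power_divide)
  have s2: "(\<lambda>r. z ^ q / u * (w / (1 - x)) ^ r) sums (z ^ q / u * (1 / (1 - w / (1 - x))))" if "\<bar>w\<bar> < 1 - x" for q w
    using that x by (intro sums_mult geometric_sums) (simp add: abs_divide)
  have s3: "(\<lambda>q. z ^ q / u * w) sums (1 / (1 - z) * (w / u))" for w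
    using sums_mult2[OF geometric_sums[of z], of "w / u"] z by simp
  let ?p = "\<lambda>q r j t. t ^ q * (t powr \<alpha>) ^ (r + j)"
  have L1: "majorized_laplace u (\<lambda>t. c q r j * ?p q r j t) (\<lambda>t. \<bar>c q r j\<bar> * ?p q r j t)
     (c q r j * K q r j) (\<bar>c q r j\<bar> * K q r j)" for q r j
    unfolding K_def by (rule majorized_laplace_power) (use assms u0 in auto)
  \<comment> \<open>The sums are taken from the inside out, over \<open>j\<close>, then
    \<open>r\<close>, then \<open>q\<close>. After each one the values are rewritten in closed form,
    so that the next series is again one of \<open>s2\<close> and \<open>s3\<close>.\<close>
  note L1' = L1 [unfolded cK ca]
  note L2 = majorized_laplace_sums[OF L1' sums_summable[OF s1]]
  note L2' = L2(1) [unfolded sums_unique[OF s1, symmetric]]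
  have ya: "\<bar>y\<bar> < 1 - x" "\<bar>- y\<bar> < 1 - x" using y by auto
  note L3 = majorized_laplace_sums[OF L2' sums_summable[OF s2[OF ya(1)]]]
  note L3' = L3(1) [unfolded sums_unique[OF s2[OF ya(1)], symmetric] sums_unique[OF s2[OF ya(2)], symmetric]]
  note L4 = majorized_laplace_sums[OF L3' sums_summable[OF s3]]
  note L4' = L4(1) [unfolded sums_unique[OF s3, symmetric]]
  \<comment> \<open>In the transformed series all factors stand inside the innermost sum; moving
    them out requires the sums to converge, which the majorants guarantee at every
    \<open>t\<close>.\<close>
  have eq: "ml_triple_series b \<theta> \<alpha> t = (\<Sum>q r j. c q r j * ?p q r j t)" if t: "0 \<le> t" for t
  proof -
    have ce: "c q r j * ?p q r j t = (\<theta> * t) ^ q * ((- b * t powr \<alpha>) ^ r * (pochhammer (real r) j *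
      (\<theta> powr \<alpha> * t powr \<alpha>) ^ j / (fact j * Gamma (\<alpha> * real j + (real r * \<alpha> + real q + 1)))))" for q r j
      unfolding c_def power_mult_distrib power_add by (simp add: mult_ac)
    have s2: "summable (\<lambda>j. \<bar>c q r j\<bar> * ?p q r j t)" for q r by (rule L2(2)[OF t])
    have s3: "summable (\<lambda>r. \<Sum>j. \<bar>c q r j\<bar> * ?p q r j t)" for q by (rule L3(2)[OF t])
    have a1: "summable (\<lambda>j. c q r j * ?p q r j t)" for q r
      by (rule summable_comparison_test'[OF s2[of q r], of 0]) (simp add: abs_mult t)
    have e1: "(\<Sum>j. c q r j * ?p q r j t) = (\<theta> * t) ^ q * ((- b * t powr \<alpha>) ^ r * 
        ML3 \<alpha> (real r * \<alpha> + real q + 1) (real r) (\<theta> powr \<alpha> * t powr \<alpha>))" for q r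
    proof -
      let ?C = "(\<theta> * t) ^ q * (- b * t powr \<alpha>) ^ r"
      let ?f = "\<lambda>j. pochhammer (real r) j * (\<theta> powr \<alpha> * t powr \<alpha>) ^ j /
        (fact j * Gamma (\<alpha> * real j + (real r * \<alpha> + real q + 1)))"
      have "c q r j * ?p q r j t = ?C * ?f j" for j unfolding ce by (simp only: mult.assoc)
      with a1[of q r] suminf_cmult_real[of ?C ?f] show ?thesis
        by (simp only: ML3_def mult.assoc)
    qed
    have a2: "summable (\<lambda>r. \<Sum>j. c q r j * ?p q r j t)" for q
    proof (rule summable_comparison_test'[OF s3[of q], of 0])
      show "norm (\<Sum>j. c q r j * ?p q r j t) \<le> (\<Sum>j. \<bar>c q r j\<bar> * ?p q r j t)" for r
        using L2'[of q r] t by (auto simp: majorized_laplace_def)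
    qed
    have e2: "(\<Sum>r j. c q r j * ?p q r j t) = (\<theta> * t) ^ q * (\<Sum>r. (- b * t powr \<alpha>) ^ r * 
        ML3 \<alpha> (real r * \<alpha> + real q + 1) (real r) (\<theta> powr \<alpha> * t powr \<alpha>))" for q
      using a2[of q] unfolding e1 by (rule suminf_cmult_real)
    show ?thesis unfolding e2 ml_triple_series_def ..
  qed
  have "continuous_on {0..} (\<lambda>t. \<Sum>q r j. c q r j * ?p q r j t)"
    using L4' by (simp add: majorized_laplace_def)
  then show "continuous_on {0..} (ml_triple_series b \<theta> \<alpha>)"
    by (subst continuous_on_cong [OF refl eq]) auto
  have "has_bochner_integral lborel (\<lambda>t. indicator {0<..} t * (exp (- u * t) * (\<Sum>q r j. c q r j * ?p q r j t)))
     (1 / (1 - z) * (1 / (1 - - y / (1 - x)) / u))"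
    using L4' by (simp add: majorized_laplace_def)
  also have "1 / (1 - z) * (1 / (1 - - y / (1 - x)) / u) = 
      (u powr \<alpha> - \<theta> powr \<alpha>) / ((u - \<theta>) * (u powr \<alpha> - \<theta> powr \<alpha> + b))"
  proof -
    have "1 / (1 - z) / u = 1 / (u - \<theta>)" using assms u0 by (simp add: z_def field_simps)
    moreover have "1 - - y / (1 - x) = (1 - x + y) / (1 - x)" using x by (simp add: field_simps)
    moreover have "1 - x = (u powr \<alpha> - \<theta> powr \<alpha>) / u powr \<alpha>" using ua by (simp add: xu field_simps)
    moreover have "1 - x + y = (u powr \<alpha> - \<theta> powr \<alpha> + b) / u powr \<alpha>" using ua by (simp add: xu y_def field_simps)
    ultimately show ?thesis using ua by simp
  qed
  also have "(\<lambda>t. indicator {0<..} t * (exp (- u * t) * (\<Sum>q r j. c q r j * ?p q r j t)))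
     = (\<lambda>t. indicator {0<..} t * (exp (- u * t) * ml_triple_series b \<theta> \<alpha> t))"
    using eq by (auto simp: indicator_def fun_eq_iff)
  finally show "has_bochner_integral lborel (\<lambda>t. indicator {0<..} t * (exp (- u * t) * ml_triple_series b \<theta> \<alpha> t))
      ((u powr \<alpha> - \<theta> powr \<alpha>) / ((u - \<theta>) * (u powr \<alpha> - \<theta> powr \<alpha> + b)))" .
qed

section \<open>Identifying a law on the half-line from the transform of its survival
  function\<close>

text \<open>Fubini: for fixed \<open>x\<close> the integral of \<open>exp (- a * s)\<close> over
  \<open>0 < s < x\<close> is \<open>(1 - exp (- a * x)) / a\<close>, and integrating this over
  \<open>N\<close> gives the stated value.\<close>

lemma laplace_tail:
  fixes N :: "real measure"
  assumes "finite_measure N" and sets: "sets N = sets borel" and pos: "AE x in N. 0 \<le> x" and a: "0 < a"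
  shows "has_bochner_integral lborel (\<lambda>s. indicator {0<..} s * (exp (- a * s) * measure N {s<..}))
    ((measure N UNIV - (\<integral>x. exp (- a * x) \<partial>N)) / a)"
proof -
  interpret N: finite_measure N by fact
  have [measurable_cong]: "sets N = sets borel" by fact
  have sp: "space N = UNIV" using sets by (metis sets_eq_imp_space_eq space_borel)
  interpret P: pair_sigma_finite N lborel ..
  have "cdf N \<in> borel_measurable borel"
  proof -
    interpret B: finite_borel_measure N by standard (simp add: sets)
    show ?thesis by (intro borel_measurable_mono monoI B.cdf_nondecreasing)
  qed
  moreover have tail: "measure N {s<..} = measure N UNIV - cdf N s" for s
  proof -
    have "measure N (UNIV - {..s}) = measure N UNIV - measure N {..s}"
      using N.finite_measure_compl[of "{..s}"] sets sp by simp
    moreover have "UNIV - {..s} = {s<..}" by auto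
    ultimately show ?thesis by (simp add: cdf_def)
  qed
  ultimately have m [measurable]: "(\<lambda>s. measure N {s<..}) \<in> borel_measurable borel" by simp
  have inner: "(\<integral>\<^sup>+s. ennreal (indicator {0<..} s * exp (- a * s)) * indicator {s<..} x \<partial>lborel)
      = ennreal ((1 - exp (- a * x)) / a)" if x: "0 \<le> x" for x
  proof -
    have "(\<integral>\<^sup>+s. ennreal (indicator {0<..} s * exp (- a * s)) * indicator {s<..} x \<partial>lborel) =
       (\<integral>\<^sup>+s. ennreal (exp (- a * s)) * indicator {0..x} s \<partial>lborel)"
      using AE_lborel_singleton[of 0] AE_lborel_singleton[of x]
      by (intro nn_integral_cong_AE, eventually_elim) (auto simp: indicator_def)
    also have "\<dots> = ennreal ((- exp (- a * x) / a) - (- exp (- a * 0) / a))"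
      using x a by (intro nn_integral_FTC_Icc) (auto intro!: derivative_eq_intros)
    finally show ?thesis by (simp add: diff_divide_distrib)
  qed
  have i: "integrable N (\<lambda>x. exp (- a * x))"
    using pos a by (intro N.integrable_const_bound [where B = 1]) (auto elim!: eventually_mono)
  have iv: "(\<integral>x. (1 - exp (- a * x)) / a \<partial>N) = (measure N UNIV - (\<integral>x. exp (- a * x) \<partial>N)) / a"
    using i by (simp add: sp)
  have nn: "AE x in N. 0 \<le> (1 - exp (- a * x)) / a"
    using pos a by (auto elim!: eventually_mono)
  have "(\<integral>\<^sup>+s. ennreal (indicator {0<..} s * (exp (- a * s) * measure N {s<..})) \<partial>lborel)
      = (\<integral>\<^sup>+s. (\<integral>\<^sup>+x. ennreal (indicator {0<..} s * exp (- a * s)) * indicator {s<..} x \<partial>N) \<partial>lborel)"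
  proof (intro nn_integral_cong)
    fix s :: real
    have "(\<integral>\<^sup>+x. ennreal (indicator {0<..} s * exp (- a * s)) * indicator {s<..} x \<partial>N)
       = ennreal (indicator {0<..} s * exp (- a * s)) * emeasure N {s<..}"
      by (subst nn_integral_cmult_indicator) (simp_all add: sets)
    then show "ennreal (indicator {0<..} s * (exp (- a * s) * measure N {s<..}))
        = (\<integral>\<^sup>+x. ennreal (indicator {0<..} s * exp (- a * s)) * indicator {s<..} x \<partial>N)"
      by (simp add: N.emeasure_eq_measure ennreal_mult' flip: mult.assoc)
  qed
  also have "\<dots> = (\<integral>\<^sup>+x. (\<integral>\<^sup>+s. ennreal (indicator {0<..} s * exp (- a * s)) * indicator {s<..} x \<partial>lborel) \<partial>N)"
    unfolding greaterThan_iff indicator_def by (intro P.Fubini') measurable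
  also have "\<dots> = (\<integral>\<^sup>+x. ennreal ((1 - exp (- a * x)) / a) \<partial>N)"
    using pos by (intro nn_integral_cong_AE) (auto elim!: eventually_mono simp only: inner)
  also have "\<dots> = ennreal ((measure N UNIV - (\<integral>x. exp (- a * x) \<partial>N)) / a)"
    unfolding iv[symmetric] using i nn by (intro nn_integral_eq_integral) auto
  finally have "(\<integral>\<^sup>+s. ennreal (indicator {0<..} s * (exp (- a * s) * measure N {s<..})) \<partial>lborel)
      = ennreal ((measure N UNIV - (\<integral>x. exp (- a * x) \<partial>N)) / a)" .
  moreover have "0 \<le> (measure N UNIV - (\<integral>x. exp (- a * x) \<partial>N)) / a"
    unfolding iv[symmetric] by (rule integral_nonneg_AE[OF nn])
  ultimately show ?thesis
    by (intro has_bochner_integral_nn_integral AE_I2) auto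
qed

text \<open>With \<open>p = (s + \<theta>) powr \<alpha> - \<theta> powr \<alpha>\<close> the tail
  has transform \<open>(1 - b / (b + p)) / s = p / (s * (b + p))\<close>, which is that of the
  triple series at \<open>u = s + \<theta>\<close>. The almost sure equality extends to every
  \<open>t\<close> because the tail is right-continuous and the series continuous on
  \<open>{0..}\<close>.\<close>

lemma sojourn_survival_unique:
  fixes N :: "real measure"
  assumes "prob_space N" and sets: "sets N = sets borel" and pos: "AE x in N. 0 \<le> x"
    and b: "0 \<le> lam + real k * mu" and "0 < \<theta>" "0 < \<alpha>"
    and laplace: "\<And>n::nat. (\<integral>x. exp (- real n * x) \<partial>N) = (lam + real k * mu) / (lam + real k * mu + ((real n + \<theta>) powr \<alpha> - \<theta> powr \<alpha>))"
    and t: "0 \<le> t"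
  shows "measure N {t<..} = sojourn_survival k lam mu \<theta> \<alpha> t"
proof -
  define b where "b = lam + real k * mu"
  define f where "f t = exp (- \<theta> * t) * ml_triple_series b \<theta> \<alpha> t" for t
  interpret N: prob_space N by fact
  interpret B: finite_borel_measure N by standard (simp add: sets)
  have sp: "space N = UNIV" using sets by (metis sets_eq_imp_space_eq space_borel)
  have "filterlim (\<lambda>n. (real n + \<theta>) powr \<alpha> - \<theta> powr \<alpha>) at_top sequentially"
    using \<open>0 < \<alpha>\<close> by real_asymp
  then have "eventually (\<lambda>n. b + 1 \<le> (real n + \<theta>) powr \<alpha> - \<theta> powr \<alpha>) sequentially"
    by (simp add: filterlim_at_top)
  then obtain c where c: "\<And>n. n \<ge> c \<Longrightarrow> b + 1 \<le> (real n + \<theta>) powr \<alpha> - \<theta> powr \<alpha>"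
    by (auto simp: eventually_sequentially)
  \<comment> \<open>From \<open>c\<close> on the exponent exceeds \<open>b\<close>, as the transform
    of the series demands; the successor makes the arguments \<open>C + real n\<close> positive, so
    that dividing by them is legitimate.\<close>
  define C where "C = real (Suc c)"
  have L1: "has_bochner_integral lborel (\<lambda>s. indicator {0<..} s * (exp (- (C + real n) * s) * measure N {s<..}))
     ((1 - (\<integral>x. exp (- (C + real n) * x) \<partial>N)) / (C + real n))" for n
    using laplace_tail[OF N.finite_measure_axioms sets pos, of "C + real n"] N.prob_space
    by (simp add: sp C_def)
  have val: "(1 - (\<integral>x. exp (- (C + real n) * x) \<partial>N)) / (C + real n)
    = ((C + real n + \<theta>) powr \<alpha> - \<theta> powr \<alpha>) / (((C + real n + \<theta>) - \<theta>) * ((C + real n + \<theta>) powr \<alpha> - \<theta> powr \<alpha> + b))" for n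
  proof -
    have e: "C + real n = real (Suc c + n)" by (simp add: C_def)
    have "b + 1 \<le> (C + real n + \<theta>) powr \<alpha> - \<theta> powr \<alpha>" unfolding e by (rule c) simp
    moreover have "(\<integral>x. exp (- (C + real n) * x) \<partial>N) = b / (b + ((C + real n + \<theta>) powr \<alpha> - \<theta> powr \<alpha>))"
      unfolding e b_def by (rule laplace)
    moreover have "0 < C + real n" by (simp add: C_def)
    moreover have "(1 - b / (b + p)) / d = p / ((d + \<theta> - \<theta>) * (p + b))" if "b + 1 \<le> p" "0 < d" for p d
      using that b unfolding b_def[symmetric] by (simp add: field_simps)
    ultimately show ?thesis by metis
  qed
  have u: "\<theta> < C + real n + \<theta>" "b < (C + real n + \<theta>) powr \<alpha> - \<theta> powr \<alpha>" for n
  proof -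
    have e: "C + real n = real (Suc c + n)" by (simp add: C_def)
    show "\<theta> < C + real n + \<theta>" by (simp add: C_def)
    show "b < (C + real n + \<theta>) powr \<alpha> - \<theta> powr \<alpha>" using c[of "Suc c + n"] unfolding e by simp
  qed
  have b': "0 \<le> b" using b by (simp add: b_def)
  have L2: "has_bochner_integral lborel (\<lambda>s. indicator {0<..} s * (exp (- (C + real n) * s) * f s))
     (((C + real n + \<theta>) powr \<alpha> - \<theta> powr \<alpha>) / (((C + real n + \<theta>) - \<theta>) * ((C + real n + \<theta>) powr \<alpha> - \<theta> powr \<alpha> + b)))" for n
    using laplace_ml_triple_series(2)[OF b' \<open>0 < \<theta>\<close> \<open>0 < \<alpha>\<close> u, of n]
    unfolding f_def by (simp add: exp_add [symmetric] algebra_simps flip: mult.assoc)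
  have fc: "continuous_on {0..} f"
    unfolding f_def using laplace_ml_triple_series(1)[OF b' \<open>0 < \<theta>\<close> \<open>0 < \<alpha>\<close> u]
    by (intro continuous_intros)
  have ae: "AE s in lborel. 0 < s \<longrightarrow> measure N {s<..} = f s"
    using L1[unfolded val] L2 by (intro laplace_unique_AE [where c = C]) (auto simp: has_bochner_integral_iff)
  have tail: "measure N {s<..} = 1 - cdf N s" for s
  proof -
    have "measure N (UNIV - {..s}) = 1 - measure N {..s}"
      using N.prob_compl[of "{..s}"] sets sp by simp
    moreover have "UNIV - {..s} = {s<..}" by auto
    ultimately show ?thesis by (simp add: cdf_def)
  qed
  \<comment> \<open>An exceptional null set cannot contain an interval, so points of equality
    accumulate at \<open>t\<close> from the right.\<close>
  have "\<exists>s. t < s \<and> s < t + e \<and> measure N {s<..} = f s" if "0 < e" for e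
  proof (rule ccontr)
    assume *: "\<not> ?thesis"
    have "AE s in lborel. s \<notin> {t<..<t + e}"
      using ae by eventually_elim (use t * in auto)
    then have "emeasure lborel {t<..<t + e} = 0"
      using AE_iff_null_sets[of "{t<..<t + e}" lborel] by auto
    with that show False by simp
  qed
  then have "\<exists>s. t < s \<and> s < t + 1 / real (Suc n) \<and> measure N {s<..} = f s" for n by simp
  then obtain s where s: "\<And>n. t < s n" "\<And>n. s n < t + 1 / real (Suc n)" "\<And>n. measure N {s n<..} = f (s n)"
    by metis
  have "s \<longlonglongrightarrow> t"
  proof (rule tendsto_sandwich[of "\<lambda>_. t" s _ "\<lambda>n. t + 1 / real (Suc n)"])
    show "(\<lambda>n. t + 1 / real (Suc n)) \<longlonglongrightarrow> t" by real_asymp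
  qed (use s in \<open>auto intro!: always_eventually less_imp_le\<close>)
  moreover have "s n \<in> {t<..} \<and> s n \<noteq> t" for n using s(1)[of n] by simp
  ultimately have "filterlim s (at_right t) sequentially"
    unfolding filterlim_at by simp
  then have "(\<lambda>n. cdf N (s n)) \<longlonglongrightarrow> cdf N t"
    using B.cdf_is_right_cont[of t] by (auto simp: continuous_within intro: filterlim_compose)
  then have "(\<lambda>n. measure N {s n<..}) \<longlonglongrightarrow> measure N {t<..}"
    unfolding tail by (intro tendsto_intros)
  moreover have "(\<lambda>n. f (s n)) \<longlonglongrightarrow> f t"
  proof (rule continuous_on_tendsto_compose[OF fc \<open>s \<longlonglongrightarrow> t\<close>])
    have "0 \<le> s n" for n using s(1)[of n] t by simp
    then show "eventually (\<lambda>n. s n \<in> {0..}) sequentially" by simp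
  qed (use t in simp)
  ultimately have "measure N {t<..} = f t" unfolding s(3) by (rule LIMSEQ_unique)
  then show ?thesis unfolding f_def ml_triple_series_def sojourn_survival_def b_def .
qed

subsection \<open>Change times of right-continuous processes\<close>

text \<open>The recursion of \<open>jump_time\<close> for an arbitrary process, because it is needed
  twice: for the level process and for the queue itself.\<close>

primrec change_time :: "(real \<Rightarrow> 'w \<Rightarrow> 'a) \<Rightarrow> nat \<Rightarrow> 'w \<Rightarrow> real" where
  "change_time X 0 \<omega> = 0"
| "change_time X (Suc n) \<omega> = Inf {t. t > change_time X n \<omega> \<and> X t \<omega> \<noteq> X (change_time X n \<omega>) \<omega>}"

lemma jump_time_eq_change_time: "jump_time k Q D n \<omega> = change_time (Lproc k Q D) n \<omega>"
  by (induction n) simp_all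

lemma change_time_step_path:
  assumes "\<sigma> 0 = 0" and "\<And>n. \<sigma> n < \<sigma> (Suc n)"
    and path: "\<And>n t. \<sigma> n \<le> t \<Longrightarrow> t < \<sigma> (Suc n) \<Longrightarrow> X t \<omega> = j n" and ne: "\<And>n. j (Suc n) \<noteq> j n"
  shows "change_time X n \<omega> = \<sigma> n"
proof (induction n)
  case (Suc n)
  have v: "X (\<sigma> m) \<omega> = j m" for m using path[of m "\<sigma> m"] assms(2) by simp
  have "Inf {t. t > \<sigma> n \<and> X t \<omega> \<noteq> X (\<sigma> n) \<omega>} = \<sigma> (Suc n)"
  proof (rule cInf_eq_minimum)
    show "\<sigma> (Suc n) \<in> {t. t > \<sigma> n \<and> X t \<omega> \<noteq> X (\<sigma> n) \<omega>}" using assms(2) ne by (simp add: v)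
    show "\<sigma> (Suc n) \<le> t" if "t \<in> {t. t > \<sigma> n \<and> X t \<omega> \<noteq> X (\<sigma> n) \<omega>}" for t
      using that path[of n t] by (auto simp: v intro: leI)
  qed
  then show ?case by (simp add: Suc)
qed (simp add: assms)

lemma increasing_partition:
  fixes T :: "nat \<Rightarrow> real"
  assumes "T 0 \<le> t" and "filterlim T at_top sequentially"
  obtains n where "T n \<le> t" "t < T (Suc n)"
proof -
  have "\<exists>m. t < T m"
    using assms(2) eventually_happens'[of sequentially "\<lambda>m. t < T m"] by (auto simp: filterlim_at_top_dense)
  then have l: "t < T (LEAST m. t < T m)" by (rule LeastI_ex)
  then obtain n where n: "(LEAST m. t < T m) = Suc n"
    using assms(1) by (cases "LEAST m. t < T m") auto
  then have "\<not> t < T n" by (metis lessI not_less_Least)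
  with that[of n] l n show thesis by simp
qed

text \<open>The random time is approximated from the right by times with countably many values, at
  which evaluation is measurable. As the paths are constant just after each time, the approximations
  eventually equal the value at \<open>T \<omega>\<close>.\<close>

lemma measurable_eval_right_continuous:
  fixes X :: "real \<Rightarrow> 'w \<Rightarrow> 'a :: countable"
  assumes X: "\<And>t. X t \<in> measurable N (count_space UNIV)"
    and rc: "\<And>\<omega> t. \<omega> \<in> space N \<Longrightarrow> eventually (\<lambda>u. X u \<omega> = X t \<omega>) (at_right t)"
    and T [measurable]: "T \<in> borel_measurable N"
  shows "(\<lambda>\<omega>. X (T \<omega>) \<omega>) \<in> measurable N (count_space UNIV)"
proof -
  \<comment> \<open>Adding 1 to the floor, instead of taking the ceiling, puts the grid point
    strictly to the right of \<open>x\<close> even when \<open>x\<close> lies on the grid.\<close>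
  define q where "q n x = (real_of_int \<lfloor>real (Suc n) * x\<rfloor> + 1) / real (Suc n)" for n x
  have q: "x < q n x" "q n x \<le> x + 1 / real (Suc n)" for n x
  proof -
    have "real (Suc n) * x < real_of_int \<lfloor>real (Suc n) * x\<rfloor> + 1" by linarith
    then show "x < q n x" unfolding q_def by (simp add: pos_less_divide_eq mult.commute)
    have "real_of_int \<lfloor>real (Suc n) * x\<rfloor> + 1 \<le> real (Suc n) * x + 1" by linarith
    then have "q n x \<le> (real (Suc n) * x + 1) / real (Suc n)"
      unfolding q_def by (intro divide_right_mono) simp_all
    also have "\<dots> = x + 1 / real (Suc n)" by (simp add: add_divide_distrib)
    finally show "q n x \<le> x + 1 / real (Suc n)" .
  qed
  have qr: "filterlim (\<lambda>n. q n x) (at_right x) sequentially" for x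
  proof -
    have "(\<lambda>n. q n x) \<longlonglongrightarrow> x"
    proof (rule tendsto_sandwich[of "\<lambda>_. x" _ _ "\<lambda>n. x + 1 / real (Suc n)"])
      show "(\<lambda>n. x + 1 / real (Suc n)) \<longlonglongrightarrow> x" by real_asymp
    qed (use q in \<open>auto intro!: always_eventually less_imp_le\<close>)
    moreover have "q n x \<in> {x<..} \<and> q n x \<noteq> x" for n using q(1)[of x n] by simp
    ultimately show ?thesis unfolding filterlim_at by simp
  qed
  have m [measurable]: "(\<lambda>\<omega>. X (q n (T \<omega>)) \<omega>) \<in> measurable N (count_space UNIV)" for n
    unfolding q_def
    by (rule measurable_compose_countable[where f = "\<lambda>i \<omega>. X ((real_of_int i + 1) / real (Suc n)) \<omega>"])
      (use X in measurable)
  have eq: "X (T \<omega>) \<omega> = a \<longleftrightarrow> (\<exists>m. \<forall>n\<ge>m. X (q n (T \<omega>)) \<omega> = a)" if "\<omega> \<in> space N" for \<omega> a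
  proof -
    have "eventually (\<lambda>n. X (q n (T \<omega>)) \<omega> = X (T \<omega>) \<omega>) sequentially"
      using rc[OF that] qr by (rule eventually_compose_filterlim)
    then obtain m where "\<And>n. n \<ge> m \<Longrightarrow> X (q n (T \<omega>)) \<omega> = X (T \<omega>) \<omega>"
      by (auto simp: eventually_sequentially)
    then show ?thesis by (metis nle_le)
  qed
  have "{\<omega> \<in> space N. X (T \<omega>) \<omega> = a} = {\<omega> \<in> space N. \<exists>m. \<forall>n\<ge>m. X (q n (T \<omega>)) \<omega> = a}" for a
    using eq by blast
  moreover have "{\<omega> \<in> space N. \<exists>m. \<forall>n\<ge>m. X (q n (T \<omega>)) \<omega> = a} \<in> sets N" for a by measurable
  ultimately have "(\<lambda>\<omega>. X (T \<omega>) \<omega>) -` {a} \<inter> space N \<in> sets N" for a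
    by (simp add: vimage_def Int_def conj_commute)
  then show ?thesis by (subst measurable_count_space_eq2_countable) auto
qed

text \<open>If the path differs from its old value at \<open>t\<close>, it still does so at
  rationals just after \<open>t\<close>; hence whether the infimum lies below \<open>a\<close> can
  be decided on the rationals. A path that never changes again has the infimum of the empty set as
  its next change time, a fixed constant that needs a separate case.\<close>

lemma measurable_change_time:
  fixes X :: "real \<Rightarrow> 'w \<Rightarrow> 'a :: countable"
  assumes X [measurable]: "\<And>t. X t \<in> measurable N (count_space UNIV)"
    and rc: "\<And>\<omega> t. \<omega> \<in> space N \<Longrightarrow> eventually (\<lambda>u. X u \<omega> = X t \<omega>) (at_right t)"
  shows "change_time X n \<in> borel_measurable N"
proof (induction n)
  case 0
  have "change_time X 0 = (\<lambda>_. 0)" by (auto simp: fun_eq_iff)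
  then show ?case by simp
next
  case (Suc n)
  let ?R = "change_time X n"
  note Suc [measurable]
  have [measurable]: "(\<lambda>\<omega>. X (?R \<omega>) \<omega>) \<in> measurable N (count_space UNIV)"
    by (rule measurable_eval_right_continuous[OF X rc Suc])
  define S where "S \<omega> = {t. t > ?R \<omega> \<and> X t \<omega> \<noteq> X (?R \<omega>) \<omega>}" for \<omega>
  \<comment> \<open>The inequality of two random states is phrased with an existential over a
    countable type, which reduces it to events of the form "the state is \<open>a\<close>".\<close>
  define P where "P \<omega> q \<longleftrightarrow> ?R \<omega> < real_of_rat q \<and> \<not> (\<exists>a. X (real_of_rat q) \<omega> = a \<and> X (?R \<omega>) \<omega> = a)" for \<omega> q
  have P [measurable]: "Measurable.pred N (\<lambda>\<omega>. P \<omega> q)" for q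
    unfolding P_def by measurable
  have PS: "P \<omega> q \<longleftrightarrow> real_of_rat q \<in> S \<omega>" for \<omega> q by (auto simp: P_def S_def)
  have rat: "\<exists>q. P \<omega> q \<and> real_of_rat q < a" if \<omega>: "\<omega> \<in> space N" and t: "t \<in> S \<omega>" "t < a" for \<omega> t a
  proof -
    have "eventually (\<lambda>u. X u \<omega> = X t \<omega> \<and> u < a) (at_right t)"
      using rc[OF \<omega>, of t] eventually_at_right_real[OF t(2)] by eventually_elim simp
    then obtain b where b: "t < b" "\<And>u. t < u \<Longrightarrow> u < b \<Longrightarrow> X u \<omega> = X t \<omega> \<and> u < a"
      by (auto simp: eventually_at_right_field)
    obtain q where q: "t < real_of_rat q" "real_of_rat q < b" using of_rat_dense[OF b(1)] by blast
    with b(2) t(1) have "real_of_rat q \<in> S \<omega>" "real_of_rat q < a" by (auto simp: S_def)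
    then show ?thesis using PS by blast
  qed
  have e: "Inf (S \<omega>) < a \<longleftrightarrow> (\<exists>q. P \<omega> q \<and> real_of_rat q < a) \<or> ((\<forall>q. \<not> P \<omega> q) \<and> Inf {} < a)"
    if \<omega>: "\<omega> \<in> space N" for \<omega> a
  proof (cases "S \<omega> = {}")
    case True
    then have "\<not> P \<omega> q" for q by (simp add: PS)
    with True show ?thesis by auto
  next
    case False
    then obtain t where "t \<in> S \<omega>" by auto
    from rat[OF \<omega> this, of "t + 1"] have ex: "\<exists>q. P \<omega> q" by auto
    have "bdd_below (S \<omega>)" by (auto simp: S_def intro!: bdd_belowI[of _ "?R \<omega>"])
    then have "Inf (S \<omega>) < a \<longleftrightarrow> (\<exists>t\<in>S \<omega>. t < a)" using False by (rule cInf_less_iff[rotated])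
    also have "\<dots> \<longleftrightarrow> (\<exists>q. P \<omega> q \<and> real_of_rat q < a)"
      using rat[OF \<omega>] PS by blast
    finally show ?thesis using ex by blast
  qed
  show ?case
    unfolding borel_measurable_iff_less
  proof
    fix a
    have "{\<omega> \<in> space N. change_time X (Suc n) \<omega> < a} = 
       {\<omega> \<in> space N. (\<exists>q. P \<omega> q \<and> real_of_rat q < a) \<or> ((\<forall>q. \<not> P \<omega> q) \<and> Inf {} < a)}"
      using e by (auto simp: S_def)
    also have "\<dots> \<in> sets N" by measurable
    finally show "{\<omega> \<in> space N. change_time X (Suc n) \<omega> < a} \<in> sets N" .
  qed
qed

section \<open>The inverse subordinator and the time-changed process\<close>

lemma inv_sub_nonneg:
  assumes "0 < x" "t < D x \<omega>"
  shows "0 \<le> inv_sub D t \<omega>" "inv_sub D t \<omega> \<le> x"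
proof -
  show "0 \<le> inv_sub D t \<omega>" unfolding inv_sub_def using assms by (intro cInf_greatest) auto
  show "inv_sub D t \<omega> \<le> x" unfolding inv_sub_def using assms
    by (intro cInf_lower bdd_belowI[of _ 0]) auto
qed

text \<open>Shortly after \<open>t\<close> the inverse stays between its value at \<open>t\<close>
  and any larger bound, where \<open>q\<close> is constant. If the path of \<open>D\<close> never
  exceeds \<open>t\<close> at a positive time, it never exceeds a later level either, and both
  inverses are the same infimum of the empty set.\<close>

lemma inv_sub_right_continuous:
  assumes q: "\<And>t. 0 \<le> t \<Longrightarrow> eventually (\<lambda>u. q u = q t) (at_right t)"
  shows "eventually (\<lambda>u. q (inv_sub D u \<omega>) = q (inv_sub D t \<omega>)) (at_right t)"
proof (cases "{x. 0 < x \<and> D x \<omega> > t} = {}")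
  case True
  have "eventually (\<lambda>u. t < u) (at_right t)" by (simp add: eventually_at_filter)
  then show ?thesis
  proof eventually_elim
    case (elim u)
    then have "{x. 0 < x \<and> D x \<omega> > u} = {}" using True by force
    with True show ?case unfolding inv_sub_def by metis
  qed
next
  case False
  let ?y = "inv_sub D t \<omega>"
  obtain z where "0 < z" "t < D z \<omega>" using False by auto
  then have "0 \<le> ?y" by (rule inv_sub_nonneg(1))
  from q[OF this] obtain b where b: "?y < b" "\<And>u. ?y < u \<Longrightarrow> u < b \<Longrightarrow> q u = q ?y"
    by (auto simp: eventually_at_right_field)
  have "\<exists>x\<in>{x. 0 < x \<and> D x \<omega> > t}. x < b"
    using cInf_lessD[OF False] b(1) unfolding inv_sub_def by blast
  then obtain x where x: "0 < x" "t < D x \<omega>" "x < b" by auto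
  have "eventually (\<lambda>u. u \<in> {t<..<D x \<omega>}) (at_right t)"
    using x(2) by (rule eventually_at_right_real)
  then show ?thesis
  proof eventually_elim
    case (elim u)
    then have "inv_sub D u \<omega> \<le> x" using x by (intro inv_sub_nonneg) auto
    moreover have "?y \<le> inv_sub D u \<omega>"
      using elim x unfolding inv_sub_def by (intro cInf_superset_mono bdd_belowI[of _ 0]) auto
    ultimately show ?case using b(2)[of "inv_sub D u \<omega>"] x(3) by fastforce
  qed
qed

text \<open>Applied with two consecutive jump times as \<open>a\<close> and \<open>b\<close>, this
  tells in which holding interval of the queue the inverse lies.\<close>

lemma inv_sub_mem:
  assumes a: "\<And>x. 0 \<le> x \<Longrightarrow> x < a \<Longrightarrow> D x \<omega> \<le> t" and x: "0 < x" "x < b" "t < D x \<omega>"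
  shows "a \<le> inv_sub D t \<omega>" "inv_sub D t \<omega> < b"
proof -
  show "inv_sub D t \<omega> < b" using inv_sub_nonneg(2)[of x t D \<omega>, OF x(1,3)] x(2) by simp
  show "a \<le> inv_sub D t \<omega>"
    unfolding inv_sub_def
  proof (rule cInf_greatest)
    show "{x. 0 < x \<and> D x \<omega> > t} \<noteq> {}" using x by auto
    fix y assume "y \<in> {x. 0 < x \<and> D x \<omega> > t}"
    then show "a \<le> y" using a[of y] by (auto intro: leI)
  qed
qed

text \<open>The queue is specified at nonnegative times only; freezing it at time 0 gives a process
  that is right-continuous on the whole line.\<close>

lemma right_continuous_max_0:
  fixes q :: "real \<Rightarrow> 'a"
  assumes "\<And>t. 0 \<le> t \<Longrightarrow> eventually (\<lambda>u. q u = q t) (at_right t)"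
  shows "eventually (\<lambda>u. q (max 0 u) = q (max 0 t)) (at_right t)"
proof (cases "0 \<le> t")
  case True
  have "eventually (\<lambda>u. t < u) (at_right t)" by (simp add: eventually_at_filter)
  with assms[OF True] show ?thesis by eventually_elim (use True in auto)
next
  case False
  then have "eventually (\<lambda>u. u \<in> {t<..<0}) (at_right t)" by (intro eventually_at_right_real) simp
  then show ?thesis by eventually_elim (use False in auto)
qed

lemma measurable_Lproc:
  fixes Q :: "real \<Rightarrow> 'w \<Rightarrow> nat \<times> nat"
  assumes Q [measurable]: "\<And>t. Q t \<in> measurable M (count_space UNIV)"
    and rc: "\<And>\<omega> t. \<omega> \<in> space M \<Longrightarrow> 0 \<le> t \<Longrightarrow> eventually (\<lambda>u. Q u \<omega> = Q t \<omega>) (at_right t)"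
    and D [measurable]: "\<And>t. D t \<in> borel_measurable M"
    and mono: "\<And>\<omega>. \<omega> \<in> space M \<Longrightarrow> mono_on {0..} (\<lambda>t. D t \<omega>)"
  shows "Lproc k Q D t \<in> measurable M (count_space UNIV)"
proof -
  let ?X = "\<lambda>t. Q (max 0 t)"
  define P where "P \<omega> q \<longleftrightarrow> 0 < real_of_rat q \<and> t < D (real_of_rat q) \<omega>" for \<omega> q
  have P [measurable]: "Measurable.pred M (\<lambda>\<omega>. P \<omega> q)" for q
    unfolding P_def by measurable
  have rat: "\<exists>q. P \<omega> q \<and> real_of_rat q < a"
    if \<omega>: "\<omega> \<in> space M" and x: "0 < x" "t < D x \<omega>" "x < a" for \<omega> x a
  proof -
    obtain q where q: "x < real_of_rat q" "real_of_rat q < a" using of_rat_dense[OF x(3)] by blast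
    then have "0 < real_of_rat q" using x by linarith
    then have "D x \<omega> \<le> D (real_of_rat q) \<omega>"
      using x q by (intro mono_onD[OF mono[OF \<omega>]]) auto
    with \<open>0 < real_of_rat q\<close> q x show ?thesis unfolding P_def by (intro exI[of _ q]) linarith
  qed
  have e: "inv_sub D t \<omega> < a \<longleftrightarrow> (\<exists>q. P \<omega> q \<and> real_of_rat q < a) \<or> ((\<forall>q. \<not> P \<omega> q) \<and> Inf {} < a)"
    if \<omega>: "\<omega> \<in> space M" for \<omega> a
  proof (cases "{x. 0 < x \<and> D x \<omega> > t} = {}")
    case True
    then have "\<not> P \<omega> q" for q by (auto simp: P_def)
    then show ?thesis unfolding inv_sub_def True by simp
  next
    case False
    then obtain x where x: "0 < x" "t < D x \<omega>" by auto
    from rat[OF \<omega> this, of "x + 1"] have ex: "\<exists>q. P \<omega> q" by auto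
    have "bdd_below {x. 0 < x \<and> D x \<omega> > t}" by (auto intro!: bdd_belowI[of _ 0])
    then have "inv_sub D t \<omega> < a \<longleftrightarrow> (\<exists>x\<in>{x. 0 < x \<and> D x \<omega> > t}. x < a)"
      unfolding inv_sub_def using False by (rule cInf_less_iff[rotated])
    also have "\<dots> \<longleftrightarrow> (\<exists>q. P \<omega> q \<and> real_of_rat q < a)"
      using rat[OF \<omega>] unfolding P_def by blast
    finally show ?thesis using ex by blast
  qed
  have Y [measurable]: "inv_sub D t \<in> borel_measurable M"
    unfolding borel_measurable_iff_less
  proof
    fix a
    have "{\<omega> \<in> space M. inv_sub D t \<omega> < a} = 
       {\<omega> \<in> space M. (\<exists>q. P \<omega> q \<and> real_of_rat q < a) \<or> ((\<forall>q. \<not> P \<omega> q) \<and> Inf {} < a)}"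
      using e by auto
    also have "\<dots> \<in> sets M" by measurable
    finally show "{\<omega> \<in> space M. inv_sub D t \<omega> < a} \<in> sets M" .
  qed
  have "eventually (\<lambda>u. ?X u \<omega> = ?X s \<omega>) (at_right s)" if "\<omega> \<in> space M" for \<omega> s
    using right_continuous_max_0[of "\<lambda>t. Q t \<omega>"] rc[OF that] by simp
  then have [measurable]: "(\<lambda>\<omega>. ?X (inv_sub D t \<omega>) \<omega>) \<in> measurable M (count_space UNIV)"
    by (rule measurable_eval_right_continuous[where X = ?X, rotated 1]) (auto simp: Q)
  have "(\<lambda>\<omega>. gk k (if \<exists>q. P \<omega> q then ?X (inv_sub D t \<omega>) \<omega> else Q (Inf {}) \<omega>)) \<in> measurable M (count_space UNIV)"
    by measurable
  moreover have "Lproc k Q D t \<omega> = gk k (if \<exists>q. P \<omega> q then ?X (inv_sub D t \<omega>) \<omega> else Q (Inf {}) \<omega>)"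
    if \<omega>: "\<omega> \<in> space M" for \<omega>
  proof (cases "\<exists>q. P \<omega> q")
    case True
    then obtain q where "0 < real_of_rat q" "t < D (real_of_rat q) \<omega>" by (auto simp: P_def)
    then have "0 \<le> inv_sub D t \<omega>" by (rule inv_sub_nonneg(1))
    with True show ?thesis by (simp add: Lproc_def)
  next
    case False
    have e: "{x. 0 < x \<and> D x \<omega> > t} = {}"
    proof (intro equals0I)
      fix x assume "x \<in> {x. 0 < x \<and> D x \<omega> > t}"
      with False rat[OF \<omega>, of x "x + 1"] show False by simp
    qed
    show ?thesis using False unfolding Lproc_def inv_sub_def e by simp
  qed
  ultimately show ?thesis by (simp cong: measurable_cong)
qed

lemma Lproc_right_continuous:
  assumes "\<And>t. 0 \<le> t \<Longrightarrow> eventually (\<lambda>u. Q u \<omega> = Q t \<omega>) (at_right t)"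
  shows "eventually (\<lambda>u. Lproc k Q D u \<omega> = Lproc k Q D t \<omega>) (at_right t)"
  using inv_sub_right_continuous[of "\<lambda>t. Q t \<omega>" D \<omega> t, OF assms]
  unfolding Lproc_def by (auto elim: eventually_mono)

subsection \<open>Replacing test functions in product expectations\<close>

text \<open>By positivity the tail at 0 shows that \<open>c\<close> is the total mass, so
  \<open>N\<close> is a multiple of an exponential law. The transform is obtained by comparing two
  evaluations of the integral of \<open>exp (- a * s)\<close> against the tail; \<open>a = 0\<close>
  is separate because this divides by \<open>a\<close>.\<close>

lemma exponential_tail_laplace:
  fixes N :: "real measure"
  assumes "finite_measure N" and sets: "sets N = sets borel" and pos: "AE x in N. 0 < x"
    and q: "0 < q" and tail: "\<And>s. 0 \<le> s \<Longrightarrow> measure N {s<..} = c * exp (- q * s)" and a: "0 \<le> a"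
  shows "(\<integral>x. exp (- a * x) \<partial>N) = c * (q / (q + a))"
proof -
  interpret N: finite_measure N by fact
  have sp: "space N = UNIV" using sets by (metis sets_eq_imp_space_eq space_borel)
  have "measure N UNIV = measure N {0<..}"
    using pos by (intro N.finite_measure_eq_AE) (auto simp: sets)
  then have tot: "measure N UNIV = c" using tail[of 0] by simp
  show ?thesis
  proof (cases "a = 0")
    case True
    with q tot show ?thesis by (simp add: sp)
  next
    case False
    with a have a: "0 < a" by simp
    have pos0: "AE x in N. 0 \<le> x" using pos by eventually_elim simp
    have h1: "has_bochner_integral lborel (\<lambda>s. indicator {0<..} s * (exp (- a * s) * measure N {s<..}))
        ((c - (\<integral>x. exp (- a * x) \<partial>N)) / a)"
      using laplace_tail[OF N.finite_measure_axioms sets pos0 a] tot by simp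
    have e: "indicator {0<..} s * (exp (- a * s) * measure N {s<..}) = c * (indicator {0<..} s * (exp (- (a + q) * s) * (s ^ 0 * (s powr 1) ^ 0)))" for s :: real
      by (auto simp: indicator_def tail algebra_simps simp flip: exp_add)
    have h2: "has_bochner_integral lborel (\<lambda>s. c * (indicator {0<..} s * (exp (- (a + q) * s) * (s ^ 0 * (s powr 1) ^ 0)))) (c * (1 / (a + q)))"
      using has_bochner_integral_mult_right[OF has_laplace_power[of 1 "a + q" 0 0], of c] a q by simp
    have "(c - (\<integral>x. exp (- a * x) \<partial>N)) / a = c * (1 / (a + q))"
      by (rule has_bochner_integral_eq[OF h1[unfolded e] h2])
    then show ?thesis using a q by (simp add: field_simps)
  qed
qed

context prob_space
begin

text \<open>\<open>N\<close> is the law of \<open>Z\<close> under the weight \<open>U\<close>. It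
  turns expectations of products with a fixed factor \<open>U\<close> into integrals against a
  one-dimensional finite measure, to which uniqueness results apply.\<close>

lemma weighted_distr:
  assumes U [measurable]: "U \<in> borel_measurable M" and U01: "AE \<omega> in M. 0 \<le> U \<omega> \<and> U \<omega> \<le> (1::real)"
    and Z [measurable]: "Z \<in> borel_measurable M"
  defines "N \<equiv> distr (density M (\<lambda>\<omega>. ennreal (U \<omega>))) borel (Z :: 'a \<Rightarrow> real)"
  shows "finite_measure N" "sets N = sets borel"
    and "\<And>f. f \<in> borel_measurable borel \<Longrightarrow> (\<integral>x. f x \<partial>N) = expectation (\<lambda>\<omega>. U \<omega> * (f (Z \<omega>) :: real))"
    and "\<And>B. B \<in> sets borel \<Longrightarrow> measure N B = expectation (\<lambda>\<omega>. U \<omega> * indicator B (Z \<omega>))"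
    and "\<And>P. {x. P x} \<in> sets borel \<Longrightarrow> AE \<omega> in M. P (Z \<omega>) \<Longrightarrow> AE x in N. P x"
proof -
  have "emeasure (density M (\<lambda>\<omega>. ennreal (U \<omega>))) (space M) = (\<integral>\<^sup>+\<omega>. ennreal (U \<omega>) \<partial>M)"
    by (subst emeasure_density) (auto intro!: nn_integral_cong simp: indicator_def)
  also have "\<dots> \<le> (\<integral>\<^sup>+\<omega>. 1 \<partial>M)"
    using U01 by (intro nn_integral_mono_AE) (auto elim!: eventually_mono simp: ennreal_le_1)
  also have "\<dots> < \<infinity>" by (simp add: emeasure_space_1)
  finally have "finite_measure (density M (\<lambda>\<omega>. ennreal (U \<omega>)))"
    by (intro finite_measureI) auto
  then show fin: "finite_measure N"
    unfolding N_def by (rule finite_measure.finite_measure_distr) simp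
  show sets: "sets N = sets borel" by (simp add: N_def)
  show int: "(\<integral>x. f x \<partial>N) = expectation (\<lambda>\<omega>. U \<omega> * (f (Z \<omega>) :: real))" if [measurable]: "f \<in> borel_measurable borel" for f
    unfolding N_def using U01
    by (subst integral_distr, simp, simp, subst integral_density) (auto elim: eventually_mono)
  have [measurable_cong]: "sets N = sets borel" by fact
  show "measure N B = expectation (\<lambda>\<omega>. U \<omega> * indicator B (Z \<omega>))" if [measurable]: "B \<in> sets borel" for B
    using int[of "indicator B"] sets by (simp add: sets_eq_imp_space_eq)
  show "AE x in N. P x" if [measurable]: "{x. P x} \<in> sets borel" and "AE \<omega> in M. P (Z \<omega>)" for P
    unfolding N_def using that by (subst AE_distr_iff) (auto simp: AE_density elim: eventually_mono)
qed

text \<open>\<open>replace\<close> is a one-dimensional statement valid for every weight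
  \<open>U\<close>: values on the test functions \<open>f\<close> determine those on
  \<open>g\<close>. Taking the other coordinates as the weight exchanges one factor at a time. It is
  used to pass from tails to exponentials for holding times, and from exponentials to indicators of
  Borel sets for sojourn times.\<close>

lemma iterated_replacement:
  fixes Z :: "nat \<Rightarrow> 'a \<Rightarrow> real"
  assumes I: "finite I"
    and W [measurable]: "W \<in> borel_measurable M" and W01: "AE \<omega> in M. 0 \<le> W \<omega> \<and> W \<omega> \<le> (1::real)"
    and Z [measurable]: "\<And>i. i \<in> I \<Longrightarrow> Z i \<in> borel_measurable M" and Zpos: "AE \<omega> in M. \<forall>i\<in>I. 0 \<le> Z i \<omega>"
    and fA: "\<And>i p. i \<in> I \<Longrightarrow> p \<in> A i \<Longrightarrow> f i p \<in> borel_measurable borel \<and> (\<forall>x\<ge>0. 0 \<le> f i p x \<and> f i p x \<le> 1)"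
    and gB: "\<And>i r. i \<in> I \<Longrightarrow> r \<in> B i \<Longrightarrow> g i r \<in> borel_measurable borel \<and> (\<forall>x\<ge>0. 0 \<le> g i r x \<and> g i r x \<le> 1)"
    and base: "\<And>p. (\<And>i. i \<in> I \<Longrightarrow> p i \<in> A i) \<Longrightarrow>
      expectation (\<lambda>\<omega>. W \<omega> * (\<Prod>i\<in>I. f i (p i) (Z i \<omega>))) = c * (\<Prod>i\<in>I. v i (p i))"
    and replace: "\<And>i U d r. i \<in> I \<Longrightarrow> U \<in> borel_measurable M \<Longrightarrow> AE \<omega> in M. 0 \<le> U \<omega> \<and> U \<omega> \<le> 1 \<Longrightarrow>
      (\<And>p. p \<in> A i \<Longrightarrow> expectation (\<lambda>\<omega>. U \<omega> * f i p (Z i \<omega>)) = d * v i p) \<Longrightarrow> r \<in> B i \<Longrightarrow>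
      expectation (\<lambda>\<omega>. U \<omega> * g i r (Z i \<omega>)) = d * w i r"
    and r: "\<And>i. i \<in> I \<Longrightarrow> r i \<in> B i"
  shows "expectation (\<lambda>\<omega>. W \<omega> * (\<Prod>i\<in>I. g i (r i) (Z i \<omega>))) = c * (\<Prod>i\<in>I. w i (r i))"
proof -
  \<comment> \<open>Coordinates in \<open>K\<close> already carry the new test functions. The
    parameters \<open>p\<close> of the others stay arbitrary, since replacing coordinate
    \<open>k\<close> uses the hypothesis for all \<open>p(k := p')\<close>.\<close>
  have "expectation (\<lambda>\<omega>. W \<omega> * ((\<Prod>i\<in>K. g i (r i) (Z i \<omega>)) * (\<Prod>i\<in>I - K. f i (p i) (Z i \<omega>)))) =
      c * ((\<Prod>i\<in>K. w i (r i)) * (\<Prod>i\<in>I - K. v i (p i)))"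
    if "finite K" "K \<subseteq> I" "\<And>i. i \<in> I - K \<Longrightarrow> p i \<in> A i" for K p
    using that
  proof (induction K arbitrary: p rule: finite_induct)
    case empty
    then show ?case using base[of p] by simp
  next
    case (insert k K)
    let ?U = "\<lambda>\<omega>. W \<omega> * ((\<Prod>i\<in>K. g i (r i) (Z i \<omega>)) * (\<Prod>i\<in>I - insert k K. f i (p i) (Z i \<omega>)))"
    let ?d = "c * ((\<Prod>i\<in>K. w i (r i)) * (\<Prod>i\<in>I - insert k K. v i (p i)))"
    have k: "k \<in> I" "k \<notin> K" using insert by auto
    have IK: "I - K = insert k (I - insert k K)" using k by auto
    have fin: "finite (I - insert k K)" using I by simp
    have [measurable]: "(\<lambda>\<omega>. g i (r i) (Z i \<omega>)) \<in> borel_measurable M" if "i \<in> K" for i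
      using that gB[of i "r i"] r[of i] insert.prems by (intro measurable_compose[OF Z]) auto
    have [measurable]: "(\<lambda>\<omega>. f i (p i) (Z i \<omega>)) \<in> borel_measurable M" if "i \<in> I - insert k K" for i
      using that fA[of i "p i"] insert.prems by (intro measurable_compose[OF Z]) auto
    have m: "?U \<in> borel_measurable M"
      by (intro borel_measurable_times borel_measurable_prod W) auto
    have b: "AE \<omega> in M. 0 \<le> ?U \<omega> \<and> ?U \<omega> \<le> 1"
      using W01 Zpos
    proof eventually_elim
      case (elim \<omega>)
      have "0 \<le> (\<Prod>i\<in>K. g i (r i) (Z i \<omega>)) \<and> (\<Prod>i\<in>K. g i (r i) (Z i \<omega>)) \<le> 1"
        using gB r elim insert.prems by (intro conjI prod_nonneg prod_le_1) blast+
      moreover have "0 \<le> (\<Prod>i\<in>I - insert k K. f i (p i) (Z i \<omega>)) \<and> (\<Prod>i\<in>I - insert k K. f i (p i) (Z i \<omega>)) \<le> 1"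
        using fA elim insert.prems by (intro conjI prod_nonneg prod_le_1) blast+
      ultimately show ?case using elim(1) by (auto intro!: mult_le_one mult_nonneg_nonneg)
    qed
    have "expectation (\<lambda>\<omega>. ?U \<omega> * f k p' (Z k \<omega>)) = ?d * v k p'" if "p' \<in> A k" for p'
    proof -
      have e1: "(\<Prod>i\<in>I - K. f i ((p(k := p')) i) (Z i \<omega>)) = f k p' (Z k \<omega>) * (\<Prod>i\<in>I - insert k K. f i (p i) (Z i \<omega>))" for \<omega>
        unfolding IK using fin by (subst prod.insert) (auto intro!: prod.cong)
      have e2: "(\<Prod>i\<in>I - K. v i ((p(k := p')) i)) = v k p' * (\<Prod>i\<in>I - insert k K. v i (p i))"
        unfolding IK using fin by (subst prod.insert) (auto intro!: prod.cong)
      have "expectation (\<lambda>\<omega>. W \<omega> * ((\<Prod>i\<in>K. g i (r i) (Z i \<omega>)) * (\<Prod>i\<in>I - K. f i ((p(k := p')) i) (Z i \<omega>)))) =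
          c * ((\<Prod>i\<in>K. w i (r i)) * (\<Prod>i\<in>I - K. v i ((p(k := p')) i)))"
        using that insert.prems by (intro insert.IH) auto
      then show ?thesis unfolding e1 e2 by (simp add: mult_ac)
    qed
    from replace[OF k(1) m b this r[OF k(1)]] show ?case
      using insert.hyps by (simp add: mult_ac)
  qed
  from this[of I] show ?thesis using I by simp
qed

lemma expectation_eq_countable_partition:
  fixes V :: "'a \<Rightarrow> 'c :: countable" and f g :: "'a \<Rightarrow> real"
  assumes V: "V \<in> measurable M (count_space UNIV)"
    and f: "integrable M f" and g: "integrable M g"
    and eq: "\<And>v. expectation (\<lambda>\<omega>. indicator {v} (V \<omega>) * f \<omega>) = expectation (\<lambda>\<omega>. indicator {v} (V \<omega>) * g \<omega>)"
  shows "expectation f = expectation g"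
proof -
  have Vm [measurable]: "(\<lambda>\<omega>. to_nat (V \<omega>)) \<in> measurable M (count_space UNIV)"
    using V by measurable
  have lim: "(\<lambda>n. \<Sum>m<n. expectation (\<lambda>\<omega>. indicator {m} (to_nat (V \<omega>)) * h \<omega>)) \<longlonglongrightarrow> expectation h"
    if h: "integrable M h" for h :: "'a \<Rightarrow> real"
  proof -
    have [measurable]: "h \<in> borel_measurable M" using h by simp
    have "(\<lambda>n. expectation (\<lambda>\<omega>. indicator {..<n} (to_nat (V \<omega>)) * h \<omega>)) \<longlonglongrightarrow> expectation h"
    proof (rule integral_dominated_convergence[where w = "\<lambda>\<omega>. \<bar>h \<omega>\<bar>"])
      show "AE \<omega> in M. (\<lambda>n. indicator {..<n} (to_nat (V \<omega>)) * h \<omega>) \<longlonglongrightarrow> h \<omega>"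
      proof (intro AE_I2 tendsto_eventually)
        fix \<omega>
        show "eventually (\<lambda>n. indicator {..<n} (to_nat (V \<omega>)) * h \<omega> = h \<omega>) sequentially"
          using eventually_gt_at_top[of "to_nat (V \<omega>)"] by eventually_elim simp
      qed
    qed (use h in \<open>auto simp: indicator_def\<close>)
    moreover have "expectation (\<lambda>\<omega>. indicator {..<n} (to_nat (V \<omega>)) * h \<omega>) =
        (\<Sum>m<n. expectation (\<lambda>\<omega>. indicator {m} (to_nat (V \<omega>)) * h \<omega>))" for n
    proof -
      have i: "integrable M (\<lambda>\<omega>. indicator {m} (to_nat (V \<omega>)) * h \<omega>)" for m
        by (rule Bochner_Integration.integrable_bound[OF h]) (auto simp: indicator_def)
      have e: "indicator {..<n} (to_nat (V \<omega>)) * h \<omega> = (\<Sum>m<n. indicator {m} (to_nat (V \<omega>)) * h \<omega>)" for \<omega>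
        by (induction n) (auto simp: indicator_def less_Suc_eq)
      show ?thesis unfolding e using i by (rule Bochner_Integration.integral_sum)
    qed
    ultimately show ?thesis by simp
  qed
  have "expectation (\<lambda>\<omega>. indicator {m} (to_nat (V \<omega>)) * f \<omega>) = expectation (\<lambda>\<omega>. indicator {m} (to_nat (V \<omega>)) * g \<omega>)" for m
  proof (cases "m \<in> range (to_nat :: 'c \<Rightarrow> nat)")
    case True
    then obtain v :: 'c where "m = to_nat v" by auto
    then have "indicator {m} (to_nat (V \<omega>)) = (indicator {v} (V \<omega>) :: real)" for \<omega> by (simp add: indicator_def)
    then show ?thesis using eq[of v] by simp
  next
    case False
    then have "indicator {m} (to_nat (V \<omega>)) = (0 :: real)" for \<omega> by (auto simp: indicator_def)
    then show ?thesis by simp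
  qed
  with lim[OF f] lim[OF g] show ?thesis by (simp add: LIMSEQ_unique)
qed

end

subsection \<open>Sojourn times along a path of the jump chain\<close>

definition erlang_states :: "nat \<Rightarrow> (nat \<times> nat) set" where
  "erlang_states k = {(0,0)} \<union> {x. 1 \<le> fst x \<and> 1 \<le> snd x \<and> snd x \<le> k}"

lemma exit_rate_eq_sum:
  assumes "finite F" "x \<notin> F" and "\<And>y. y \<noteq> x \<Longrightarrow> y \<notin> F \<Longrightarrow> erlang_rate k lam mu x y = 0"
  shows "exit_rate k lam mu x = (\<Sum>y\<in>F. erlang_rate k lam mu x y)"
proof -
  have "exit_rate k lam mu x = infsum (erlang_rate k lam mu x) F"
    unfolding exit_rate_def using assms by (intro infsum_cong_neutral) auto
  then show ?thesis using assms by simp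
qed

lemma exit_rate_empty: "exit_rate k lam mu (0,0) = lam"
  by (subst exit_rate_eq_sum[where F = "{(1,k)}"]) (auto simp: erlang_rate_def)

text \<open>An arrival and the completion of the current phase are the only transitions, and their
  targets differ; only the target of the completion depends on the state, whence the cases. That the
  rate is the same in all busy states is what makes the sojourn times identically
  distributed.\<close>

lemma exit_rate_busy:
  assumes "x \<in> erlang_states k" "x \<noteq> (0,0)"
  shows "exit_rate k lam mu x = lam + real k * mu"
proof -
  obtain n s where x: "x = (n, s)" "1 \<le> n" "1 \<le> s" "s \<le> k"
    using assms by (cases x) (auto simp: erlang_states_def)
  consider "2 \<le> s" | "s = 1" "2 \<le> n" | "s = 1" "n = 1" using x by linarith
  then show ?thesis
  proof cases
    case 1
    with x show ?thesis
      by (subst exit_rate_eq_sum[where F = "{(n + 1, s), (n, s - 1)}"]) (auto simp: erlang_rate_def)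
  next
    case 2
    then have "n - 1 \<noteq> n + 1" by simp
    with 2 x show ?thesis
      by (subst exit_rate_eq_sum[where F = "{(n + 1, s), (n - 1, k)}"]) (auto simp: erlang_rate_def)
  next
    case 3
    with x show ?thesis
      by (subst exit_rate_eq_sum[where F = "{(n + 1, s), (0, 0)}"]) (auto simp: erlang_rate_def)
  qed
qed

text \<open>In a busy state an arrival raises the level by \<open>k\<close> and a completed phase
  lowers it by 1, also when it ends a service; from the empty state the level jumps to
  \<open>k\<close>. So every jump of the queue is visible in the level process.\<close>

lemma jump_prob_nonzero:
  assumes "1 \<le> k" "x \<in> erlang_states k" "jump_prob k lam mu x y \<noteq> 0"
  shows "y \<in> erlang_states k" "gk k y \<noteq> gk k x" "x = (0,0) \<Longrightarrow> y = (1,k)"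
proof -
  have ne: "y \<noteq> x" and r: "erlang_rate k lam mu x y \<noteq> 0"
    using assms(3) by (auto simp: jump_prob_def split: if_splits)
  have "y \<in> erlang_states k \<and> gk k y \<noteq> gk k x \<and> (x = (0,0) \<longrightarrow> y = (1,k))"
  proof (cases "x = (0,0)")
    case True
    with r have "y = (1,k)" by (auto simp: erlang_rate_def split: if_splits)
    with True assms(1) show ?thesis by (simp add: erlang_states_def gk_def)
  next
    case False
    then obtain n s where x: "x = (Suc n, s)" "1 \<le> s" "s \<le> k"
      using assms(2) by (cases x; cases "fst x") (auto simp: erlang_states_def)
    from r consider "y = (Suc (Suc n), s)" | "2 \<le> s" "y = (Suc n, s - 1)"
      | "s = 1" "1 \<le> n" "y = (n, k)" | "s = 1" "n = 0" "y = (0,0)"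
      using x by (auto simp: erlang_rate_def split: if_splits)
    then show ?thesis
    proof cases
      case 3
      then obtain m where "n = Suc m" by (cases n) auto
      with 3 x assms(1) show ?thesis by (auto simp: erlang_states_def gk_def)
    qed (use x assms(1) in \<open>auto simp: erlang_states_def gk_def\<close>)
  qed
  then show "y \<in> erlang_states k" "gk k y \<noteq> gk k x" "x = (0,0) \<Longrightarrow> y = (1,k)" by auto
qed

lemma gk_eq_0_iff: "x \<in> erlang_states k \<Longrightarrow> gk k x = 0 \<longleftrightarrow> x = (0,0)"
  by (auto simp: erlang_states_def gk_def)

text \<open>The grid point to the left of \<open>x\<close>; it is strictly smaller than \<open>x\<close> unless \<open>x = 0\<close>, so that the
  subordinator at the grid points approximates its left limit.\<close>

definition left_grid :: "nat \<Rightarrow> real \<Rightarrow> nat" where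
  "left_grid m x = nat (\<lceil>real (Suc m) * x\<rceil> - 1)"

lemma left_grid_mem:
  assumes "0 \<le> x"
  shows "real (left_grid m x) / real (Suc m) \<in> insert 0 {0..<x}" "x \<le> real (left_grid m x) / real (Suc m) + 1 / real (Suc m)"
proof -
  let ?N = "real (Suc m)"
  have N: "0 < ?N" by simp
  show "real (left_grid m x) / ?N \<in> insert 0 {0..<x}"
  proof (cases "1 < \<lceil>?N * x\<rceil>")
    case True
    then have "real (left_grid m x) < ?N * x" unfolding left_grid_def by linarith
    then have "real (left_grid m x) / ?N < x" using N by (simp only: pos_divide_less_eq mult.commute)
    then show ?thesis by simp
  qed (simp add: left_grid_def)
  have "?N * x \<le> real (left_grid m x) + 1" unfolding left_grid_def by linarith
  then have "x \<le> (real (left_grid m x) + 1) / ?N" using N by (simp only: pos_le_divide_eq mult.commute)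
  then show "x \<le> real (left_grid m x) / ?N + 1 / ?N" by (simp add: add_divide_distrib)
qed

lemma left_grid_mono: "x \<le> y \<Longrightarrow> left_grid m x \<le> left_grid m y"
  unfolding left_grid_def by (intro nat_mono diff_right_mono ceiling_mono mult_left_mono) auto

lemma left_grid_tendsto: 
  assumes "0 \<le> x"
  shows "(\<lambda>m. real (left_grid m x) / real (Suc m)) \<longlonglongrightarrow> x"
proof (rule tendsto_sandwich[of "\<lambda>m. x - 1 / real (Suc m)" _ _ "\<lambda>_. x"])
  show "(\<lambda>m. x - 1 / real (Suc m)) \<longlonglongrightarrow> x" by real_asymp
  have "x - 1 / real (Suc m) \<le> real (left_grid m x) / real (Suc m)" for m
    using left_grid_mem(2)[OF assms, of m] by linarith
  then show "eventually (\<lambda>m. x - 1 / real (Suc m) \<le> real (left_grid m x) / real (Suc m)) sequentially"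
    by (rule always_eventually[OF allI])
  have "real (left_grid m x) / real (Suc m) \<le> x" for m
    using left_grid_mem(1)[OF assms, of m] assms by auto
  then show "eventually (\<lambda>m. real (left_grid m x) / real (Suc m) \<le> x) sequentially"
    by (rule always_eventually[OF allI])
qed simp

text \<open>The grid points remain strictly left of \<open>x\<close>, so a jump of \<open>d\<close>
  at \<open>x\<close> is never seen, and they eventually pass every \<open>y < x\<close>;
  monotonicity of \<open>d\<close> does the rest.\<close>

lemma left_limit_via_grid:
  fixes d :: "real \<Rightarrow> real"
  assumes mono: "mono_on {0..} d" and x: "0 \<le> x"
  shows "(\<lambda>m. d (real (left_grid m x) / real (Suc m))) \<longlonglongrightarrow> (SUP y\<in>insert 0 {0..<x}. d y)"
proof (rule order_tendstoI)
  let ?g = "\<lambda>m. real (left_grid m x) / real (Suc m)"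
  have bdd: "bdd_above (d ` insert 0 {0..<x})"
    by (intro bdd_aboveI[of _ "d x"]) (use x in \<open>auto intro!: mono_onD[OF mono]\<close>)
  have le: "d (?g m) \<le> (SUP y\<in>insert 0 {0..<x}. d y)" for m
    using left_grid_mem(1)[OF x, of m] bdd by (intro cSUP_upper)
  show "eventually (\<lambda>m. d (?g m) < a) sequentially" if "(SUP y\<in>insert 0 {0..<x}. d y) < a" for a
  proof (rule always_eventually[OF allI])
    show "d (?g m) < a" for m using le[of m] that by linarith
  qed
  show "eventually (\<lambda>m. a < d (?g m)) sequentially" if a: "a < (SUP y\<in>insert 0 {0..<x}. d y)" for a
  proof -
    obtain y where y: "y \<in> insert 0 {0..<x}" "a < d y"
      using a less_cSUP_iff[OF insert_not_empty bdd] by blast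
    have "eventually (\<lambda>m. y \<le> ?g m) sequentially"
    proof (cases "y = 0")
      case False
      with y have "y < x" by simp
      from order_tendstoD(1)[OF left_grid_tendsto[OF x] this] show ?thesis
        by eventually_elim simp
    qed simp
    then show ?thesis
    proof eventually_elim
      case (elim m)
      have "d y \<le> d (?g m)" using elim y x by (intro mono_onD[OF mono]) auto
      with y(2) show ?case by linarith
    qed
  qed
qed

text \<open>Fixes a jump chain \<open>J\<close> and holding times \<open>H\<close> that witness
  \<open>erlang_ctmc\<close>.\<close>

locale tempered_erlang = prob_space M for M :: "'w measure" +
  fixes Q :: "real \<Rightarrow> 'w \<Rightarrow> nat \<times> nat" and D :: "real \<Rightarrow> 'w \<Rightarrow> real" and k :: nat and lam mu \<theta> \<alpha> :: real
    and J :: "nat \<Rightarrow> 'w \<Rightarrow> nat \<times> nat" and H :: "nat \<Rightarrow> 'w \<Rightarrow> real"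
  assumes k: "1 \<le> k" and lam: "0 < lam" and mu: "0 < mu" and \<theta>: "0 < \<theta>" and \<alpha>: "0 < \<alpha>"
    and J_measurable [measurable]: "\<And>n. J n \<in> measurable M (count_space UNIV)"
    and H_measurable [measurable]: "\<And>n. H n \<in> borel_measurable M"
    and joint_law: "\<And>n (x :: nat \<Rightarrow> nat \<times> nat) (s :: nat \<Rightarrow> real). (\<And>i. i \<le> n \<Longrightarrow> 0 \<le> s i) \<Longrightarrow>
           measure M {\<omega> \<in> space M. \<forall>i\<le>n. J i \<omega> = x i \<and> H i \<omega> > s i} =
             (if x 0 = (0,0) then 1 else 0)
             * (\<Prod>i<n. jump_prob k lam mu (x i) (x (Suc i)))
             * (\<Prod>i\<le>n. exp (- exit_rate k lam mu (x i) * s i))"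
    and H_pos: "\<And>\<omega> i. \<omega> \<in> space M \<Longrightarrow> 0 < H i \<omega>"
    and H_sum: "\<And>\<omega>. \<omega> \<in> space M \<Longrightarrow> filterlim (\<lambda>n. \<Sum>i<n. H i \<omega>) at_top sequentially"
    and Q_path: "\<And>\<omega> t n. \<omega> \<in> space M \<Longrightarrow> (\<Sum>i<n. H i \<omega>) \<le> t \<Longrightarrow> t < (\<Sum>i<Suc n. H i \<omega>) \<Longrightarrow> Q t \<omega> = J n \<omega>"
    and subordinator: "tempered_subordinator M \<theta> \<alpha> D"
    and indep: "indep_processes M Q D"
begin

definition T :: "nat \<Rightarrow> 'w \<Rightarrow> real" where "T n \<omega> = (\<Sum>i<n. H i \<omega>)"

definition psi :: "real \<Rightarrow> real" where "psi s = (s + \<theta>) powr \<alpha> - \<theta> powr \<alpha>"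

text \<open>The left limit of the subordinator at the \<open>n\<close>-th jump time of the queue;
  inserting 0 keeps the index set nonempty for \<open>n = 0\<close>, where the value is
  \<open>D 0 \<omega>\<close>.\<close>

definition tau :: "nat \<Rightarrow> 'w \<Rightarrow> real" where "tau n \<omega> = (SUP x\<in>insert 0 {0..<T n \<omega>}. D x \<omega>)"

definition valid_path :: "nat \<Rightarrow> (nat \<Rightarrow> nat \<times> nat) \<Rightarrow> bool" where
  "valid_path n x \<longleftrightarrow> x 0 = (0,0) \<and> (\<forall>i<n. jump_prob k lam mu (x i) (x (Suc i)) \<noteq> 0)"

lemma D_measurable [measurable]: "D t \<in> borel_measurable M"
  using subordinator by (simp add: tempered_subordinator_def)

lemma D_path: "\<omega> \<in> space M \<Longrightarrow> D 0 \<omega> = 0" "\<omega> \<in> space M \<Longrightarrow> mono_on {0..} (\<lambda>t. D t \<omega>)"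
  using subordinator by (simp_all add: tempered_subordinator_def)

lemma D_stationary: "0 \<le> s \<Longrightarrow> s \<le> t \<Longrightarrow> distr M borel (\<lambda>\<omega>. D t \<omega> - D s \<omega>) = distr M borel (D (t - s))"
  using subordinator by (simp add: tempered_subordinator_def)

lemma D_laplace: "0 \<le> s \<Longrightarrow> 0 \<le> t \<Longrightarrow> expectation (\<lambda>\<omega>. exp (- s * D t \<omega>)) = exp (- t * psi s)"
  using subordinator by (simp add: tempered_subordinator_def psi_def)

lemma D_increment_laplace:
  assumes "0 \<le> s" "0 \<le> t" "t \<le> u"
  shows "expectation (\<lambda>\<omega>. exp (- s * (D u \<omega> - D t \<omega>))) = exp (- (u - t) * psi s)"
proof -
  have "expectation (\<lambda>\<omega>. exp (- s * (D u \<omega> - D t \<omega>))) = (\<integral>x. exp (- s * x) \<partial>distr M borel (\<lambda>\<omega>. D u \<omega> - D t \<omega>))"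
    by (subst integral_distr) auto
  also have "\<dots> = expectation (\<lambda>\<omega>. exp (- s * D (u - t) \<omega>))"
    unfolding D_stationary[OF assms(2,3)] by (subst integral_distr) auto
  finally show ?thesis using D_laplace[of s "u - t"] assms by simp
qed

lemma psi_nonneg: "0 \<le> s \<Longrightarrow> 0 \<le> psi s"
  unfolding psi_def using \<theta> \<alpha> by (simp add: powr_mono2)

text \<open>An exponential Markov bound: the event that \<open>D\<close> does not grow between
  \<open>p\<close> and \<open>q\<close> has probability at most
  \<open>exp (- (q - p) * psi n)\<close> for every \<open>n\<close>, and \<open>psi n\<close> tends
  to infinity. Rational pairs suffice since paths are monotone. Without strict growth the inverse
  could jump over a whole holding interval and the level process would miss a state.\<close>

lemma AE_D_strict: "AE \<omega> in M. strict_mono_on {0..} (\<lambda>t. D t \<omega>)"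
proof -
  have "AE \<omega> in M. D (real_of_rat p) \<omega> < D (real_of_rat q) \<omega>" if pq: "0 \<le> p" "p < q" for p q
  proof -
    let ?p = "real_of_rat p" and ?q = "real_of_rat q"
    have r: "0 \<le> ?p" "?p < ?q" using pq by (simp_all add: of_rat_less)
    let ?E = "{\<omega> \<in> space M. D ?q \<omega> \<le> D ?p \<omega>}"
    have "prob ?E \<le> exp (- (?q - ?p) * psi (real n))" for n
    proof -
      have X: "0 \<le> D ?q \<omega> - D ?p \<omega>" if "\<omega> \<in> space M" for \<omega>
      proof -
        have "D ?p \<omega> \<le> D ?q \<omega>"
          by (rule mono_onD[OF D_path(2)[OF that]]) (use r in \<open>auto simp del: zero_le_of_rat_iff\<close>)
        then show ?thesis by simp
      qed
      have "prob ?E = expectation (indicator ?E)" by simp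
      also have "\<dots> \<le> expectation (\<lambda>\<omega>. exp (- real n * (D ?q \<omega> - D ?p \<omega>)))"
      proof (rule integral_mono)
        show "integrable M (\<lambda>\<omega>. exp (- real n * (D ?q \<omega> - D ?p \<omega>)))"
          using X by (intro integrable_const_bound[where B = 1]) (auto intro!: AE_I2)
        show "indicator ?E \<omega> \<le> exp (- real n * (D ?q \<omega> - D ?p \<omega>))" if "\<omega> \<in> space M" for \<omega>
          using X[OF that] by (auto simp: indicator_def)
        show "integrable M (indicator ?E :: 'w \<Rightarrow> real)"
          by (intro integrable_real_indicator) (auto simp: less_top [symmetric])
      qed
      also have "\<dots> = exp (- (?q - ?p) * psi (real n))"
        using r by (intro D_increment_laplace) auto
      finally show ?thesis .
    qed
    moreover have "(\<lambda>n. exp (- (?q - ?p) * psi (real n))) \<longlonglongrightarrow> 0"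
    proof -
      have "(\<lambda>n. exp (- d * ((real n + \<theta>) powr \<alpha> - \<theta> powr \<alpha>))) \<longlonglongrightarrow> 0" if "0 < d" for d
        using that \<alpha> by real_asymp
      from this[of "?q - ?p"] r(2) show ?thesis unfolding psi_def by (simp only: diff_gt_0_iff_gt)
    qed
    ultimately have "prob ?E \<le> 0" by (intro LIMSEQ_le_const) auto
    then have "prob ?E = 0" by (simp add: measure_le_0_iff)
    then have "AE \<omega> in M. \<omega> \<notin> ?E" by (subst (asm) prob_eq_0) auto
    then show ?thesis by (rule AE_mp) (auto intro!: AE_I2)
  qed
  then have "AE \<omega> in M. \<forall>p q. 0 \<le> p \<longrightarrow> p < q \<longrightarrow> D (real_of_rat p) \<omega> < D (real_of_rat q) \<omega>"
    unfolding AE_all_countable by auto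
  then show ?thesis
  proof (rule AE_mp, intro AE_I2 impI)
    fix \<omega> assume \<omega>: "\<omega> \<in> space M" and *: "\<forall>p q. 0 \<le> p \<longrightarrow> p < q \<longrightarrow> D (real_of_rat p) \<omega> < D (real_of_rat q) \<omega>"
    note mono = D_path(2)[OF \<omega>]
    show "strict_mono_on {0..} (\<lambda>t. D t \<omega>)"
    proof (rule strict_mono_onI)
      fix x y :: real assume x: "x \<in> {0..}" "y \<in> {0..}" "x < y"
      obtain p where p: "x < real_of_rat p" "real_of_rat p < y" using of_rat_dense[OF x(3)] by blast
      obtain q where q: "real_of_rat p < real_of_rat q" "real_of_rat q < y" using of_rat_dense[OF p(2)] by blast
      from x have "0 \<le> x" by simp
      with p have "0 < real_of_rat p" by linarith
      then have p0: "0 < p" by simp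
      have "D x \<omega> \<le> D (real_of_rat p) \<omega>" using p x p0 by (intro mono_onD[OF mono]) auto
      also have "\<dots> < D (real_of_rat q) \<omega>" using * p0 q(1) by (simp add: of_rat_less)
      also have "\<dots> \<le> D y \<omega>"
      proof (rule mono_onD[OF mono])
        have "0 \<le> real_of_rat q" using \<open>0 < real_of_rat p\<close> q(1) by linarith
        then show "real_of_rat q \<in> {0..}" "real_of_rat q \<le> y" using q by (simp_all only: atLeast_iff less_imp_le)
      qed (use x q in auto)
      finally show "D x \<omega> < D y \<omega>" .
    qed
  qed
qed

lemma T_simps: "T 0 \<omega> = 0" "T (Suc n) \<omega> = T n \<omega> + H n \<omega>"
  by (simp_all add: T_def)

lemma T_less: "\<omega> \<in> space M \<Longrightarrow> T n \<omega> < T (Suc n) \<omega>"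
  using H_pos by (simp add: T_simps)

lemma T_nonneg: "\<omega> \<in> space M \<Longrightarrow> 0 \<le> T n \<omega>"
  unfolding T_def by (intro sum_nonneg) (simp add: H_pos less_imp_le)

lemma Q_eq_J: "\<omega> \<in> space M \<Longrightarrow> T n \<omega> \<le> t \<Longrightarrow> t < T (Suc n) \<omega> \<Longrightarrow> Q t \<omega> = J n \<omega>"
  unfolding T_def by (rule Q_path)

lemma Q_right_continuous:
  assumes \<omega>: "\<omega> \<in> space M" and t: "0 \<le> t"
  shows "eventually (\<lambda>u. Q u \<omega> = Q t \<omega>) (at_right t)"
proof -
  obtain n where n: "T n \<omega> \<le> t" "t < T (Suc n) \<omega>"
    using increasing_partition[of "\<lambda>n. T n \<omega>" t] H_sum[OF \<omega>] t by (auto simp: T_def)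
  from n(2) have "eventually (\<lambda>u. u \<in> {t<..<T (Suc n) \<omega>}) (at_right t)" by (rule eventually_at_right_real)
  then show ?thesis
    by eventually_elim (use n Q_eq_J[OF \<omega>] in auto)
qed

lemma valid_path_states:
  assumes "valid_path n x"
  shows "i \<le> n \<Longrightarrow> x i \<in> erlang_states k"
proof (induction i)
  case 0
  then show ?case using assms by (simp add: valid_path_def erlang_states_def)
next
  case (Suc i)
  then show ?case using assms jump_prob_nonzero(1)[OF k, of "x i" lam mu "x (Suc i)"] by (auto simp: valid_path_def)
qed

lemma prob_path:
  "measure M {\<omega> \<in> space M. \<forall>i\<le>n. J i \<omega> = x i} =
    (if x 0 = (0,0) then 1 else 0) * (\<Prod>i<n. jump_prob k lam mu (x i) (x (Suc i)))"
proof -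
  have "{\<omega> \<in> space M. \<forall>i\<le>n. J i \<omega> = x i} = {\<omega> \<in> space M. \<forall>i\<le>n. J i \<omega> = x i \<and> H i \<omega> > 0}"
    using H_pos by auto
  then show ?thesis using joint_law[of n "\<lambda>_. 0" x] by simp
qed

text \<open>Finite prefixes are encoded as lists to have only countably many of them, each invalid
  one being a null event.\<close>

lemma AE_valid_path: "AE \<omega> in M. \<forall>n. valid_path n (\<lambda>i. J i \<omega>)"
proof -
  have "AE \<omega> in M. \<not> (\<forall>i\<le>n. J i \<omega> = l ! i)" if "\<not> valid_path n (\<lambda>i. l ! i)" for n l
  proof -
    have "measure M {\<omega> \<in> space M. \<forall>i\<le>n. J i \<omega> = l ! i} = 0"
      using that unfolding prob_path valid_path_def by (auto simp: prod_zero_iff)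
    then have "AE \<omega> in M. \<omega> \<notin> {\<omega> \<in> space M. \<forall>i\<le>n. J i \<omega> = l ! i}"
      by (subst (asm) prob_eq_0) auto
    then show ?thesis by (rule AE_mp) (auto intro!: AE_I2)
  qed
  then have "AE \<omega> in M. \<forall>n l. \<not> valid_path n (\<lambda>i. l ! i) \<longrightarrow> \<not> (\<forall>i\<le>n. J i \<omega> = l ! i)"
    unfolding AE_all_countable by auto
  then show ?thesis
  proof (eventually_elim, intro allI)
    fix \<omega> n assume *: "\<forall>n l. \<not> valid_path n (\<lambda>i. l ! i) \<longrightarrow> \<not> (\<forall>i\<le>n. J i \<omega> = l ! i)"
    define l where "l = map (\<lambda>i. J i \<omega>) [0..<Suc n]"
    have l: "l ! i = J i \<omega>" if "i \<le> n" for i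
      unfolding l_def using that by (subst nth_map) (auto simp del: upt_Suc)
    then have "valid_path n (\<lambda>i. l ! i)" using * by metis
    then show "valid_path n (\<lambda>i. J i \<omega>)" using l by (simp add: valid_path_def)
  qed
qed

lemma AE_jump_changes_level: "AE \<omega> in M. \<forall>n. gk k (J (Suc n) \<omega>) \<noteq> gk k (J n \<omega>)"
  using AE_valid_path
proof (eventually_elim, intro allI)
  fix \<omega> n assume "\<forall>n. valid_path n (\<lambda>i. J i \<omega>)"
  then have v: "valid_path (Suc n) (\<lambda>i. J i \<omega>)" ..
  then show "gk k (J (Suc n) \<omega>) \<noteq> gk k (J n \<omega>)"
    using jump_prob_nonzero(2)[OF k valid_path_states[OF v, of n], of lam mu "J (Suc n) \<omega>"]
    by (simp add: valid_path_def)
qed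

lemma tau_upper: "\<omega> \<in> space M \<Longrightarrow> 0 \<le> x \<Longrightarrow> x < T n \<omega> \<Longrightarrow> D x \<omega> \<le> tau n \<omega>"
  and tau_nonneg: "\<omega> \<in> space M \<Longrightarrow> 0 \<le> tau n \<omega>"
  and less_tau_iff: "\<omega> \<in> space M \<Longrightarrow> t < tau n \<omega> \<longleftrightarrow> (\<exists>x\<in>insert 0 {0..<T n \<omega>}. t < D x \<omega>)"
proof -
  assume \<omega>: "\<omega> \<in> space M"
  have bdd: "bdd_above ((\<lambda>x. D x \<omega>) ` insert 0 {0..<T n \<omega>})"
    by (intro bdd_aboveI[of _ "D (T n \<omega>) \<omega>"]) (use T_nonneg[OF \<omega>] in \<open>auto intro!: mono_onD[OF D_path(2)[OF \<omega>]]\<close>)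
  show "D x \<omega> \<le> tau n \<omega>" if "0 \<le> x" "x < T n \<omega>"
    unfolding tau_def using that bdd by (intro cSUP_upper) auto
  have "D 0 \<omega> \<le> tau n \<omega>" unfolding tau_def using bdd by (intro cSUP_upper) auto
  then show "0 \<le> tau n \<omega>" using D_path(1)[OF \<omega>] by simp
  show "t < tau n \<omega> \<longleftrightarrow> (\<exists>x\<in>insert 0 {0..<T n \<omega>}. t < D x \<omega>)"
    unfolding tau_def using bdd by (intro less_cSUP_iff) auto
qed

text \<open>If \<open>tau n \<omega> \<le> t < tau (Suc n) \<omega>\<close>, then \<open>D\<close>
  is at most \<open>t\<close> before \<open>T n\<close> and exceeds \<open>t\<close> already at some
  point before \<open>T (Suc n)\<close>; so the inverse lies in the \<open>n\<close>-th holding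
  interval, where the queue is in state \<open>J n\<close>.\<close>

lemma AE_jump_time: "AE \<omega> in M. \<forall>n. jump_time k Q D n \<omega> = tau n \<omega> \<and> Lproc k Q D (jump_time k Q D n \<omega>) \<omega> = gk k (J n \<omega>)"
  using AE_D_strict AE_jump_changes_level AE_space
proof (eventually_elim, intro allI)
  fix \<omega> n
  assume strict: "strict_mono_on {0..} (\<lambda>t. D t \<omega>)" and ne: "\<forall>n. gk k (J (Suc n) \<omega>) \<noteq> gk k (J n \<omega>)"
    and \<omega>: "\<omega> \<in> space M"
  have t0: "tau 0 \<omega> = 0" using D_path(1)[OF \<omega>] by (simp add: tau_def T_simps)
  have less: "tau n \<omega> < tau (Suc n) \<omega>" for n
  proof -
    \<comment> \<open>Two intermediate points are needed: \<open>D a\<close> bounds the earlier left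
      limit from above, \<open>D b\<close> the later one from below, and strict growth separates
      them.\<close>
    obtain a where a: "T n \<omega> < a" "a < T (Suc n) \<omega>" using dense[OF T_less[OF \<omega>]] by blast
    obtain b where b: "a < b" "b < T (Suc n) \<omega>" using dense[OF a(2)] by blast
    have "tau n \<omega> \<le> D a \<omega>"
      unfolding tau_def using a T_nonneg[OF \<omega>, of n]
      by (intro cSUP_least) (auto intro!: mono_onD[OF D_path(2)[OF \<omega>]])
    also have "\<dots> < D b \<omega>" using a b T_nonneg[OF \<omega>, of n] by (intro strict_mono_onD[OF strict]) auto
    also have "\<dots> \<le> tau (Suc n) \<omega>" using a b T_nonneg[OF \<omega>, of n] by (intro tau_upper \<omega>) auto
    finally show ?thesis .
  qed
  have path: "Lproc k Q D t \<omega> = gk k (J n \<omega>)" if t: "tau n \<omega> \<le> t" "t < tau (Suc n) \<omega>" for n t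
  proof -
    have t0: "0 \<le> t" using tau_nonneg[OF \<omega>, of n] t by simp
    obtain x where x: "x \<in> insert 0 {0..<T (Suc n) \<omega>}" "t < D x \<omega>"
      using t(2) less_tau_iff[OF \<omega>] by blast
    with t0 D_path(1)[OF \<omega>] have "x \<noteq> 0" by auto
    with x(1) have x': "0 < x" "x < T (Suc n) \<omega>" by auto
    have "D x \<omega> \<le> t" if "0 \<le> x" "x < T n \<omega>" for x
      using tau_upper[OF \<omega> that] t(1) by simp
    from inv_sub_mem[of "T n \<omega>" D \<omega> t, OF this x'(1) x'(2) x(2)]
    have "T n \<omega> \<le> inv_sub D t \<omega>" "inv_sub D t \<omega> < T (Suc n) \<omega>" by auto
    then show ?thesis unfolding Lproc_def using Q_eq_J[OF \<omega>] by simp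
  qed
  have "change_time (Lproc k Q D) n \<omega> = tau n \<omega>"
    using t0 less path ne by (intro change_time_step_path[where j = "\<lambda>n. gk k (J n \<omega>)"]) auto
  then show "jump_time k Q D n \<omega> = tau n \<omega> \<and> Lproc k Q D (jump_time k Q D n \<omega>) \<omega> = gk k (J n \<omega>)"
    using path[OF order_refl less, of n] by (simp add: jump_time_eq_change_time)
qed

end

lemma left_grid_measurable [measurable]: "left_grid m \<in> measurable borel (count_space UNIV)"
  unfolding left_grid_def by measurable

context tempered_erlang
begin

section \<open>Joint transform of the holding times on a path event\<close>

abbreviation path_event :: "nat \<Rightarrow> (nat \<Rightarrow> nat \<times> nat) \<Rightarrow> 'w set" where
  "path_event n x \<equiv> {\<omega> \<in> space M. \<forall>i\<le>n. J i \<omega> = x i}"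

lemma exit_rate_pos:
  assumes "valid_path n x" "i \<le> n"
  shows "0 < exit_rate k lam mu (x i)"
  using valid_path_states[OF assms] exit_rate_empty[of k lam mu] exit_rate_busy[of "x i" k lam mu] lam mu k
  by (cases "x i = (0,0)") (simp_all add: add_pos_nonneg)

text \<open>The prescribed law gives the joint tails; each tail is exchanged for an exponential,
  with the remaining factors as weight.\<close>

lemma holding_times_laplace:
  assumes x: "valid_path n x" and a: "\<And>i. i \<le> n \<Longrightarrow> 0 \<le> a i"
  shows "expectation (\<lambda>\<omega>. indicator (path_event n x) \<omega> * (\<Prod>i\<le>n. exp (- a i * H i \<omega>))) =
    prob (path_event n x) * (\<Prod>i\<le>n. exit_rate k lam mu (x i) / (exit_rate k lam mu (x i) + a i))"
proof (rule iterated_replacement[where A = "\<lambda>_. {0..}" and B = "\<lambda>_. {0..}" and f = "\<lambda>i s. indicator {s<..}"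
      and v = "\<lambda>i s. exp (- exit_rate k lam mu (x i) * s)" and Z = H and g = "\<lambda>i s x. exp (- s * x)"
      and w = "\<lambda>i s. exit_rate k lam mu (x i) / (exit_rate k lam mu (x i) + s)"])
  show "AE \<omega> in M. \<forall>i\<in>{..n}. 0 \<le> H i \<omega>"
    using H_pos by (intro AE_I2) (auto intro: less_imp_le)
  show "expectation (\<lambda>\<omega>. indicator (path_event n x) \<omega> * (\<Prod>i\<le>n. indicator {p i<..} (H i \<omega>))) =
    prob (path_event n x) * (\<Prod>i\<le>n. exp (- exit_rate k lam mu (x i) * p i))"
    if p: "\<And>i. i \<in> {..n} \<Longrightarrow> p i \<in> {0..}" for p
  proof -
    let ?E = "{\<omega> \<in> space M. \<forall>i\<le>n. J i \<omega> = x i \<and> H i \<omega> > p i}"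
    have "(\<Prod>i\<le>n. indicator {p i<..} (H i \<omega>)) = (if \<forall>i\<le>n. p i < H i \<omega> then 1 else 0 :: real)" for \<omega>
      by (auto simp: indicator_def prod_zero_iff intro!: prod.neutral)
    then have "indicator (path_event n x) \<omega> * (\<Prod>i\<le>n. indicator {p i<..} (H i \<omega>)) = (indicator ?E \<omega> :: real)" for \<omega>
      by (auto simp: indicator_def)
    then have "expectation (\<lambda>\<omega>. indicator (path_event n x) \<omega> * (\<Prod>i\<le>n. indicator {p i<..} (H i \<omega>))) = prob ?E"
      by simp
    also have "\<dots> = prob (path_event n x) * (\<Prod>i\<le>n. exp (- exit_rate k lam mu (x i) * p i))"
      using p unfolding prob_path by (intro joint_law) auto
    finally show ?thesis .
  qed
  show "expectation (\<lambda>\<omega>. U \<omega> * exp (- r * H i \<omega>)) = d * (exit_rate k lam mu (x i) / (exit_rate k lam mu (x i) + r))"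
    if i: "i \<in> {..n}" and U: "U \<in> borel_measurable M" "AE \<omega> in M. 0 \<le> U \<omega> \<and> U \<omega> \<le> 1"
      and base: "\<And>p. p \<in> {0..} \<Longrightarrow> expectation (\<lambda>\<omega>. U \<omega> * indicator {p<..} (H i \<omega>)) = d * exp (- exit_rate k lam mu (x i) * p)"
      and r: "r \<in> {0..}" for i U d r
  proof -
    note W = weighted_distr[OF U H_measurable[of i]]
    have "AE x in distr (density M (\<lambda>\<omega>. ennreal (U \<omega>))) borel (H i). 0 < x"
      using H_pos by (intro W(5)) (auto intro!: AE_I2)
    with W base i r x show ?thesis
      by (subst W(3)[symmetric], simp, intro exponential_tail_laplace) (auto intro: exit_rate_pos)
  qed
qed (use a in \<open>auto simp: indicator_def\<close>)

section \<open>Measurability and almost sure form of the sojourn times\<close>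

lemma Q_measurable [measurable]: "Q t \<in> measurable M (count_space UNIV)"
proof -
  have "(\<lambda>\<omega> t. Q t \<omega>) \<in> measurable M (Pi\<^sub>M UNIV (\<lambda>_. count_space UNIV))"
    using indep by (simp add: indep_processes_def)
  from measurable_compose[OF this measurable_component_singleton[of t]] show ?thesis by simp
qed

lemma Lproc_measurable: "Lproc k Q D t \<in> measurable M (count_space UNIV)"
  using D_path Q_right_continuous by (intro measurable_Lproc) auto

lemma Lproc_right_cont: "\<omega> \<in> space M \<Longrightarrow> eventually (\<lambda>u. Lproc k Q D u \<omega> = Lproc k Q D t \<omega>) (at_right t)"
  using Q_right_continuous by (rule Lproc_right_continuous)

lemma jump_time_measurable [measurable]: "jump_time k Q D n \<in> borel_measurable M"
proof -
  have "jump_time k Q D n = change_time (Lproc k Q D) n" by (simp add: fun_eq_iff jump_time_eq_change_time)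
  then show ?thesis using Lproc_measurable Lproc_right_cont by (simp add: measurable_change_time)
qed

lemma Lproc_jump_time_measurable [measurable]:
  "(\<lambda>\<omega>. Lproc k Q D (jump_time k Q D n \<omega>) \<omega>) \<in> measurable M (count_space UNIV)"
  using Lproc_measurable Lproc_right_cont by (rule measurable_eval_right_continuous) auto

lemma sojourn_measurable [measurable]: "sojourn k Q D n \<in> borel_measurable M"
  unfolding sojourn_def [abs_def] by measurable

lemma tau_mono: 
  assumes \<omega>: "\<omega> \<in> space M" shows "tau n \<omega> \<le> tau (Suc n) \<omega>"
proof (rule ccontr)
  assume "\<not> ?thesis"
  then have "tau (Suc n) \<omega> < tau n \<omega>" by simp
  then obtain x where x: "x \<in> insert 0 {0..<T n \<omega>}" "tau (Suc n) \<omega> < D x \<omega>"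
    using less_tau_iff[OF \<omega>, of "tau (Suc n) \<omega>" n] by blast
  have "x = 0 \<or> 0 \<le> x \<and> x < T (Suc n) \<omega>" using x T_less[OF \<omega>, of n] by auto
  then have "D x \<omega> \<le> tau (Suc n) \<omega>"
    using tau_upper[OF \<omega>, of x "Suc n"] tau_nonneg[OF \<omega>, of "Suc n"] D_path(1)[OF \<omega>] by auto
  with x show False by simp
qed

lemma AE_sojourn: "AE \<omega> in M. \<forall>n. sojourn k Q D n \<omega> = tau (Suc n) \<omega> - tau n \<omega> \<and> 0 \<le> sojourn k Q D n \<omega>"
  using AE_jump_time AE_space by eventually_elim (simp add: sojourn_def tau_mono del: jump_time.simps)

section \<open>The independent sigma-algebras of the queue and the subordinator\<close>

definition Q_algebra :: "'w measure" where
  "Q_algebra = vimage_algebra (space M) (\<lambda>\<omega> t. Q t \<omega>) (Pi\<^sub>M UNIV (\<lambda>_. count_space UNIV))"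

definition D_algebra :: "'w measure" where
  "D_algebra = vimage_algebra (space M) (\<lambda>\<omega> t. D t \<omega>) (Pi\<^sub>M UNIV (\<lambda>_. borel))"

lemma sets_Q_algebra: "sets Q_algebra = {(\<lambda>\<omega> t. Q t \<omega>) -` A \<inter> space M | A. A \<in> sets (Pi\<^sub>M UNIV (\<lambda>_. count_space UNIV))}"
  unfolding Q_algebra_def by (intro sets_vimage_algebra2) (auto simp: space_PiM)

lemma sets_D_algebra: "sets D_algebra = {(\<lambda>\<omega> t. D t \<omega>) -` A \<inter> space M | A. A \<in> sets (Pi\<^sub>M UNIV (\<lambda>_. borel))}"
  unfolding D_algebra_def by (intro sets_vimage_algebra2) (auto simp: space_PiM)

lemma space_algebras [simp]: "space Q_algebra = space M" "space D_algebra = space M"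
  by (simp_all add: Q_algebra_def D_algebra_def)

lemma algebras_subset: "sets Q_algebra \<subseteq> sets M" "sets D_algebra \<subseteq> sets M"
  using indep unfolding sets_Q_algebra sets_D_algebra indep_processes_def by (auto intro: measurable_sets)

lemma Q_algebra_imp_measurable: "f \<in> measurable Q_algebra N \<Longrightarrow> f \<in> measurable M N"
  and D_algebra_imp_measurable: "f \<in> measurable D_algebra N \<Longrightarrow> f \<in> measurable M N"
  using algebras_subset by (auto simp: measurable_def)

lemma Q_algebra_measurable: "Q t \<in> measurable Q_algebra (count_space UNIV)"
proof -
  have "(\<lambda>\<omega> t. Q t \<omega>) \<in> measurable Q_algebra (Pi\<^sub>M UNIV (\<lambda>_. count_space UNIV))"
    unfolding Q_algebra_def by (rule measurable_vimage_algebra1) (auto simp: space_PiM)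
  from measurable_compose[OF this measurable_component_singleton[of t]] show ?thesis by simp
qed

lemma D_algebra_measurable: "D t \<in> measurable D_algebra borel"
proof -
  have "(\<lambda>\<omega> t. D t \<omega>) \<in> measurable D_algebra (Pi\<^sub>M UNIV (\<lambda>_. borel))"
    unfolding D_algebra_def by (rule measurable_vimage_algebra1) (auto simp: space_PiM)
  from measurable_compose[OF this measurable_component_singleton[of t]] show ?thesis by simp
qed

lemma expectation_mult_indep:
  assumes U: "U \<in> borel_measurable Q_algebra" "integrable M U" and V: "V \<in> borel_measurable D_algebra" "integrable M V"
  shows "expectation (\<lambda>\<omega>. U \<omega> * V \<omega> :: real) = expectation U * expectation V"
proof (rule indep_var_lebesgue_integral)
  have "indep_set (sets Q_algebra) (sets D_algebra)"
    using indep unfolding sets_Q_algebra sets_D_algebra indep_processes_def by blast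
  moreover have "sigma_sets (space M) {U -` A \<inter> space M |A. A \<in> sets borel} \<subseteq> sets Q_algebra"
    using sets.sigma_sets_subset[of "{U -` A \<inter> space M |A. A \<in> sets borel}" Q_algebra] measurable_sets[OF U(1)] by auto
  moreover have "sigma_sets (space M) {V -` A \<inter> space M |A. A \<in> sets borel} \<subseteq> sets D_algebra"
    using sets.sigma_sets_subset[of "{V -` A \<inter> space M |A. A \<in> sets borel}" D_algebra] measurable_sets[OF V(1)] by auto
  ultimately have "indep_set (sigma_sets (space M) {U -` A \<inter> space M |A. A \<in> sets borel})
      (sigma_sets (space M) {V -` A \<inter> space M |A. A \<in> sets borel})"
    unfolding indep_set_def by (elim indep_sets_mono_sets) (auto split: bool.split)
  then show "indep_var borel U borel V"
    using U V by (simp add: indep_var_eq)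
qed (use U V in auto)

text \<open>The jump times \<open>T\<close> are sums of holding times, about whose independence of
  \<open>D\<close> nothing is assumed. \<open>R\<close> computes them from the queue alone, so it is
  measurable for \<open>Q_algebra\<close>, and almost surely it agrees with
  \<open>T\<close>.\<close>

definition R :: "nat \<Rightarrow> 'w \<Rightarrow> real" where "R n = change_time (\<lambda>t. Q (max 0 t)) n"

lemma Q_max_right_cont:
  assumes "\<omega> \<in> space M" shows "eventually (\<lambda>u. Q (max 0 u) \<omega> = Q (max 0 t) \<omega>) (at_right t)"
  using right_continuous_max_0[of "\<lambda>t. Q t \<omega>"] Q_right_continuous[OF assms] by simp

lemma R_measurable: "R n \<in> borel_measurable Q_algebra"
  and Q_R_measurable: "(\<lambda>\<omega>. Q (max 0 (R n \<omega>)) \<omega>) \<in> measurable Q_algebra (count_space UNIV)"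
proof -
  have rc: "eventually (\<lambda>u. Q (max 0 u) \<omega> = Q (max 0 t) \<omega>) (at_right t)" if "\<omega> \<in> space Q_algebra" for \<omega> t
    using that Q_max_right_cont by simp
  show R: "R n \<in> borel_measurable Q_algebra"
    unfolding R_def using Q_algebra_measurable rc by (rule measurable_change_time)
  show "(\<lambda>\<omega>. Q (max 0 (R n \<omega>)) \<omega>) \<in> measurable Q_algebra (count_space UNIV)"
    using measurable_eval_right_continuous[of "\<lambda>t. Q (max 0 t)", OF Q_algebra_measurable rc R] .
qed

lemma AE_R: "AE \<omega> in M. \<forall>n. R n \<omega> = T n \<omega> \<and> Q (max 0 (R n \<omega>)) \<omega> = J n \<omega>"
  using AE_jump_changes_level AE_space
proof (eventually_elim, intro allI)
  fix \<omega> n assume ne: "\<forall>n. gk k (J (Suc n) \<omega>) \<noteq> gk k (J n \<omega>)" and \<omega>: "\<omega> \<in> space M"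
  have path: "Q (max 0 t) \<omega> = J n \<omega>" if "T n \<omega> \<le> t" "t < T (Suc n) \<omega>" for n t
    using Q_eq_J[OF \<omega> that] T_nonneg[OF \<omega>, of n] that by (simp add: max_def)
  have "J (Suc n) \<omega> \<noteq> J n \<omega>" for n using ne by metis
  then have R: "R n \<omega> = T n \<omega>"
    unfolding R_def using T_less[OF \<omega>] path
    by (intro change_time_step_path[where j = "\<lambda>n. J n \<omega>" and \<sigma> = "\<lambda>n. T n \<omega>"]) (auto simp: T_simps(1))
  with path[OF order_refl T_less[OF \<omega>]] show "R n \<omega> = T n \<omega> \<and> Q (max 0 (R n \<omega>)) \<omega> = J n \<omega>" by simp
qed

lemma D_increments_laplace:
  assumes s: "\<And>i. 0 \<le> s i" and ts: "0 \<le> ts 0" "\<And>i. i < n \<Longrightarrow> ts i \<le> ts (Suc i)"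
  shows "expectation (\<lambda>\<omega>. \<Prod>i<n. exp (- s i * (D (ts (Suc i)) \<omega> - D (ts i) \<omega>)))
    = (\<Prod>i<n. exp (- (ts (Suc i) - ts i) * psi (s i)))"
proof -
  have ts0: "0 \<le> ts i" if "i \<le> n" for i
    using that by (induction i) (use ts in \<open>auto intro: order_trans\<close>)
  have "indep_vars (\<lambda>_. borel) (\<lambda>i \<omega>. D (ts (Suc i)) \<omega> - D (ts i) \<omega>) {..<n}"
    using subordinator ts by (simp add: tempered_subordinator_def)
  then have ind: "indep_vars (\<lambda>_. borel) (\<lambda>i \<omega>. exp (- s i * (D (ts (Suc i)) \<omega> - D (ts i) \<omega>))) {..<n}"
    by (rule indep_vars_compose2[where Y = "\<lambda>i x. exp (- s i * x)"]) auto
  have "integrable M (\<lambda>\<omega>. exp (- s i * (D (ts (Suc i)) \<omega> - D (ts i) \<omega>)))" if i: "i \<in> {..<n}" for i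
  proof (rule integrable_const_bound[where B = 1])
    show "AE \<omega> in M. norm (exp (- s i * (D (ts (Suc i)) \<omega> - D (ts i) \<omega>))) \<le> 1"
    proof (intro AE_I2)
      fix \<omega> assume "\<omega> \<in> space M"
      then have "D (ts i) \<omega> \<le> D (ts (Suc i)) \<omega>"
        using i ts ts0[of i] ts0[of "Suc i"] by (intro mono_onD[OF D_path(2)]) auto
      then show "norm (exp (- s i * (D (ts (Suc i)) \<omega> - D (ts i) \<omega>))) \<le> 1"
        using s[of i] by (simp add: mult_nonneg_nonneg)
    qed
  qed simp
  from indep_vars_lebesgue_integral[OF _ ind this]
  have "expectation (\<lambda>\<omega>. \<Prod>i<n. exp (- s i * (D (ts (Suc i)) \<omega> - D (ts i) \<omega>))) =
    (\<Prod>i<n. expectation (\<lambda>\<omega>. exp (- s i * (D (ts (Suc i)) \<omega> - D (ts i) \<omega>))))" by simp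
  also have "\<dots> = (\<Prod>i<n. exp (- (ts (Suc i) - ts i) * psi (s i)))"
    using s ts ts0 by (intro prod.cong refl D_increment_laplace) auto
  finally show ?thesis .
qed

section \<open>Grid approximation of the jump times\<close>

abbreviation grid :: "nat \<Rightarrow> real \<Rightarrow> real" where "grid m x \<equiv> real (left_grid m x) / real (Suc m)"

lemma D_grid_measurable [measurable]: "(\<lambda>\<omega>. D (grid m (R i \<omega>)) \<omega>) \<in> borel_measurable M"
proof -
  have [measurable]: "R i \<in> borel_measurable M" using Q_algebra_imp_measurable[OF R_measurable] .
  show ?thesis
    by (rule measurable_compose_countable[where f = "\<lambda>j \<omega>. D (real j / real (Suc m)) \<omega>"]) auto
qed

lemma grid_bounds:
  assumes s: "\<And>i. 0 \<le> s i" and U: "\<And>\<omega>. \<omega> \<in> space M \<Longrightarrow> 0 \<le> U \<omega> \<and> U \<omega> \<le> (1 :: real)"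
  shows "AE \<omega> in M. norm (U \<omega> * (\<Prod>i<n. exp (- s i * (D (grid m (R (Suc i) \<omega>)) \<omega> - D (grid m (R i \<omega>)) \<omega>)))) \<le> 1"
    and "AE \<omega> in M. norm (U \<omega> * (\<Prod>i<n. exp (- (grid m (R (Suc i) \<omega>) - grid m (R i \<omega>)) * psi (s i)))) \<le> 1"
proof -
  have b: "norm (U \<omega> * (\<Prod>i<n. f i)) \<le> 1" if "\<omega> \<in> space M" "\<And>i. 0 \<le> f i \<and> f i \<le> 1" for \<omega> and f :: "nat \<Rightarrow> real"
  proof -
    have "0 \<le> (\<Prod>i<n. f i)" "(\<Prod>i<n. f i) \<le> 1" using that(2) by (auto intro!: prod_nonneg prod_le_1)
    with U[OF that(1)] show ?thesis by (auto intro!: mult_le_one)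
  qed
  have mono: "AE \<omega> in M. \<forall>i. grid m (R i \<omega>) \<le> grid m (R (Suc i) \<omega>)"
    using AE_R AE_space
    by eventually_elim (auto intro!: divide_right_mono left_grid_mono less_imp_le[OF T_less])
  show "AE \<omega> in M. norm (U \<omega> * (\<Prod>i<n. exp (- s i * (D (grid m (R (Suc i) \<omega>)) \<omega> - D (grid m (R i \<omega>)) \<omega>)))) \<le> 1"
    using mono AE_space
  proof eventually_elim
    case (elim \<omega>)
    have "D (grid m (R i \<omega>)) \<omega> \<le> D (grid m (R (Suc i) \<omega>)) \<omega>" for i
      using elim by (intro mono_onD[OF D_path(2)]) auto
    with s show ?case by (intro b elim(2)) simp
  qed
  show "AE \<omega> in M. norm (U \<omega> * (\<Prod>i<n. exp (- (grid m (R (Suc i) \<omega>) - grid m (R i \<omega>)) * psi (s i)))) \<le> 1"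
    using mono AE_space
  proof eventually_elim
    case (elim \<omega>)
    have "0 \<le> (grid m (R (Suc i) \<omega>) - grid m (R i \<omega>)) * psi (s i)" for i
      using elim(1) s psi_nonneg by (intro mult_nonneg_nonneg) auto
    then show ?case
      by (intro b elim(2)) (simp only: mult_minus_left exp_ge_zero exp_le_one_iff neg_le_0_iff_le simp_thms)
  qed
qed

text \<open>Conditionally on the queue the grid times are deterministic, so that the independent increments
  of the subordinator apply.\<close>

lemma grid_laplace:
  assumes s: "\<And>i. 0 \<le> s i" and U [measurable]: "U \<in> borel_measurable Q_algebra"
    and U01: "\<And>\<omega>. \<omega> \<in> space M \<Longrightarrow> 0 \<le> U \<omega> \<and> U \<omega> \<le> (1 :: real)"
  shows "expectation (\<lambda>\<omega>. U \<omega> * (\<Prod>i<n. exp (- s i * (D (grid m (R (Suc i) \<omega>)) \<omega> - D (grid m (R i \<omega>)) \<omega>))))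
    = expectation (\<lambda>\<omega>. U \<omega> * (\<Prod>i<n. exp (- (grid m (R (Suc i) \<omega>) - grid m (R i \<omega>)) * psi (s i))))"
    (is "expectation ?f = expectation ?g")
proof -
  note R_measurable [measurable]
  \<comment> \<open>The vector of grid indices takes countably many values, and on each cell
    \<open>V \<omega> = v\<close> the random grid times become the constants
    \<open>ts\<close>.\<close>
  define V where "V \<omega> = map (\<lambda>i. left_grid m (R i \<omega>)) [0..<Suc n]" for \<omega>
  have Vnth: "V \<omega> ! i = left_grid m (R i \<omega>)" if "i \<le> n" for i \<omega>
    unfolding V_def using that by (subst nth_map) (auto simp del: upt_Suc)
  have V_F [measurable]: "V \<in> measurable Q_algebra (count_space UNIV)"
  proof (subst measurable_count_space_eq2_countable, intro conjI ballI)
    fix v :: "nat list"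
    have "V -` {v} \<inter> space Q_algebra = {\<omega> \<in> space Q_algebra. length v = Suc n \<and> (\<forall>i\<in>{..n}. left_grid m (R i \<omega>) = v ! i)}"
      using Vnth by (auto simp: list_eq_iff_nth_eq[of _ v] V_def less_Suc_eq_le simp del: upt_Suc)
    also have "\<dots> \<in> sets Q_algebra" by measurable
    finally show "V -` {v} \<inter> space Q_algebra \<in> sets Q_algebra" .
  qed auto
  have UM [measurable]: "U \<in> borel_measurable M" and RM [measurable]: "\<And>i. R i \<in> borel_measurable M"
    using Q_algebra_imp_measurable U R_measurable by blast+
  have f: "integrable M ?f" by (rule integrable_const_bound[OF grid_bounds(1)[OF s U01]]) auto
  have g: "integrable M ?g" by (rule integrable_const_bound[OF grid_bounds(2)[OF s U01]]) auto
  show ?thesis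
  proof (rule expectation_eq_countable_partition[OF Q_algebra_imp_measurable[OF V_F] f g])
    fix v
    show "expectation (\<lambda>\<omega>. indicator {v} (V \<omega>) * ?f \<omega>) = expectation (\<lambda>\<omega>. indicator {v} (V \<omega>) * ?g \<omega>)"
    proof (cases "\<forall>i<n. v ! i \<le> v ! Suc i")
      case True
      define ts where "ts i = real (v ! i) / real (Suc m)" for i
      let ?U = "\<lambda>\<omega>. indicator {v} (V \<omega>) * U \<omega>"
      let ?Y = "\<lambda>\<omega>. \<Prod>i<n. exp (- s i * (D (ts (Suc i)) \<omega> - D (ts i) \<omega>))"
      have gr: "grid m (R i \<omega>) = ts i" if "V \<omega> = v" "i \<le> n" for i \<omega>
        using Vnth[OF that(2), of \<omega>] that(1) by (simp add: ts_def)
      have ts: "0 \<le> ts i" "i < n \<Longrightarrow> ts i \<le> ts (Suc i)" for i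
        using True by (auto simp: ts_def intro!: divide_right_mono)
      have fe: "indicator {v} (V \<omega>) * ?f \<omega> = ?U \<omega> * ?Y \<omega>" for \<omega>
        using gr[of \<omega>] by (cases "V \<omega> = v") (auto intro!: prod.cong)
      have ge: "indicator {v} (V \<omega>) * ?g \<omega> = ?U \<omega> * (\<Prod>i<n. exp (- (ts (Suc i) - ts i) * psi (s i)))" for \<omega>
        using gr[of \<omega>] by (cases "V \<omega> = v") (auto intro!: prod.cong)
      have Um: "?U \<in> borel_measurable Q_algebra" by measurable
      have Ui: "integrable M ?U"
        using U01 Q_algebra_imp_measurable[OF Um]
        by (intro integrable_const_bound[where B = 1] AE_I2) (auto simp: indicator_def)
      have Ym: "?Y \<in> borel_measurable D_algebra" using D_algebra_measurable by measurable
      have Yi: "integrable M ?Y"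
      proof (rule integrable_const_bound[where B = 1])
        show "AE \<omega> in M. norm (?Y \<omega>) \<le> 1"
        proof (intro AE_I2)
          fix \<omega> assume \<omega>: "\<omega> \<in> space M"
          have "0 \<le> s i * (D (ts (Suc i)) \<omega> - D (ts i) \<omega>)" if "i < n" for i
            using ts that s mono_onD[OF D_path(2)[OF \<omega>], of "ts i" "ts (Suc i)"] by (intro mult_nonneg_nonneg) auto
          then show "norm (?Y \<omega>) \<le> 1" by (auto simp: abs_prod intro!: prod_le_1)
        qed
      qed (use D_algebra_imp_measurable[OF Ym] in auto)
      have "expectation (\<lambda>\<omega>. indicator {v} (V \<omega>) * ?f \<omega>) = expectation ?U * expectation ?Y"
        unfolding fe by (rule expectation_mult_indep[OF Um Ui Ym Yi])
      also have "expectation ?Y = (\<Prod>i<n. exp (- (ts (Suc i) - ts i) * psi (s i)))"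
        by (rule D_increments_laplace) (use s ts in auto)
      finally show ?thesis unfolding ge by simp
    next
      case False
      \<comment> \<open>The increments of \<open>D\<close> can be used only at nondecreasing times.
        A vector \<open>v\<close> that is not nondecreasing has probability zero, because the jump
        times increase, so both sides vanish.\<close>
      then obtain j where j: "j < n" "\<not> v ! j \<le> v ! Suc j" by auto
      have "AE \<omega> in M. V \<omega> \<noteq> v"
        using AE_R AE_space
      proof eventually_elim
        case (elim \<omega>)
        then have "left_grid m (R j \<omega>) \<le> left_grid m (R (Suc j) \<omega>)"
          using T_less[OF elim(2), of j] by (intro left_grid_mono) simp
        with j Vnth[of j \<omega>] Vnth[of "Suc j" \<omega>] show ?case by auto
      qed
      then have z: "AE \<omega> in M. indicator {v} (V \<omega>) * h \<omega> = (0::real)" for h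
        by eventually_elim simp
      show ?thesis by (simp only: integral_eq_zero_AE[OF z])
    qed
  qed
qed

text \<open>The grid identity in the limit of a vanishing mesh: on the left the subordinator at the
  grid points tends to \<open>tau\<close>, on the right the grid points tend to \<open>T\<close>.
  Both integrands are bounded by 1 almost surely. The weight \<open>U\<close> leaves room for a path
  event.\<close>

lemma sojourn_holding_laplace:
  assumes s: "\<And>i. 0 \<le> s i" and U: "U \<in> borel_measurable Q_algebra"
    and U01: "\<And>\<omega>. \<omega> \<in> space M \<Longrightarrow> 0 \<le> U \<omega> \<and> U \<omega> \<le> (1 :: real)"
  shows "expectation (\<lambda>\<omega>. U \<omega> * (\<Prod>i<n. exp (- s i * sojourn k Q D i \<omega>)))
    = expectation (\<lambda>\<omega>. U \<omega> * (\<Prod>i<n. exp (- psi (s i) * H i \<omega>)))"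
proof -
  note [measurable] = Q_algebra_imp_measurable[OF U] Q_algebra_imp_measurable[OF R_measurable]
  have l1: "(\<lambda>m. expectation (\<lambda>\<omega>. U \<omega> * (\<Prod>i<n. exp (- s i * (D (grid m (R (Suc i) \<omega>)) \<omega> - D (grid m (R i \<omega>)) \<omega>)))))
     \<longlonglongrightarrow> expectation (\<lambda>\<omega>. U \<omega> * (\<Prod>i<n. exp (- s i * sojourn k Q D i \<omega>)))"
  proof (rule integral_dominated_convergence[where w = "\<lambda>_. 1"])
    show "AE \<omega> in M. (\<lambda>m. U \<omega> * (\<Prod>i<n. exp (- s i * (D (grid m (R (Suc i) \<omega>)) \<omega> - D (grid m (R i \<omega>)) \<omega>))))
       \<longlonglongrightarrow> U \<omega> * (\<Prod>i<n. exp (- s i * sojourn k Q D i \<omega>))"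
      using AE_R AE_sojourn AE_space
    proof eventually_elim
      case (elim \<omega>)
      have "(\<lambda>m. D (grid m (R i \<omega>)) \<omega>) \<longlonglongrightarrow> tau i \<omega>" for i
        using left_limit_via_grid[OF D_path(2)[OF elim(3)] T_nonneg[OF elim(3), of i]] elim(1)
        by (simp add: tau_def)
      with elim(2) show ?case by (auto intro!: tendsto_intros)
    qed
  qed (use grid_bounds(1)[OF s U01] in auto)
  have l2: "(\<lambda>m. expectation (\<lambda>\<omega>. U \<omega> * (\<Prod>i<n. exp (- (grid m (R (Suc i) \<omega>) - grid m (R i \<omega>)) * psi (s i)))))
     \<longlonglongrightarrow> expectation (\<lambda>\<omega>. U \<omega> * (\<Prod>i<n. exp (- psi (s i) * H i \<omega>)))"
  proof (rule integral_dominated_convergence[where w = "\<lambda>_. 1"])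
    show "AE \<omega> in M. (\<lambda>m. U \<omega> * (\<Prod>i<n. exp (- (grid m (R (Suc i) \<omega>) - grid m (R i \<omega>)) * psi (s i))))
       \<longlonglongrightarrow> U \<omega> * (\<Prod>i<n. exp (- psi (s i) * H i \<omega>))"
      using AE_R AE_space
    proof eventually_elim
      case (elim \<omega>)
      have g: "(\<lambda>m. grid m (R i \<omega>)) \<longlonglongrightarrow> T i \<omega>" for i
        using left_grid_tendsto[OF T_nonneg[OF elim(2), of i]] elim(1) by simp
      have "- psi (s i) * H i \<omega> = - (T (Suc i) \<omega> - T i \<omega>) * psi (s i)" for i by (simp add: T_simps)
      then show ?case using g by (auto intro!: tendsto_intros simp only:)
    qed
  qed (use grid_bounds(2)[OF s U01] in auto)
  have e: "(\<lambda>m. expectation (\<lambda>\<omega>. U \<omega> * (\<Prod>i<n. exp (- s i * (D (grid m (R (Suc i) \<omega>)) \<omega> - D (grid m (R i \<omega>)) \<omega>)))))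
      = (\<lambda>m. expectation (\<lambda>\<omega>. U \<omega> * (\<Prod>i<n. exp (- (grid m (R (Suc i) \<omega>) - grid m (R i \<omega>)) * psi (s i)))))"
    by (intro ext grid_laplace[OF s U U01])
  show ?thesis by (rule LIMSEQ_unique[OF l1[unfolded e] l2])
qed

text \<open>The path event is defined through \<open>J\<close> and need not belong to
  \<open>Q_algebra\<close>; it is replaced by the almost surely equal event that the queue visits
  the states \<open>x i\<close> at the times \<open>R i\<close>.\<close>

lemma sojourn_path_laplace:
  assumes x: "valid_path n x" and s: "\<And>i. 0 \<le> s i"
  shows "expectation (\<lambda>\<omega>. indicator (path_event n x) \<omega> * (\<Prod>i\<le>n. exp (- s i * sojourn k Q D i \<omega>))) =
    prob (path_event n x) * (\<Prod>i\<le>n. exit_rate k lam mu (x i) / (exit_rate k lam mu (x i) + psi (s i)))"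
proof -
  let ?U = "\<lambda>\<omega>. if \<forall>i\<in>{..n}. Q (max 0 (R i \<omega>)) \<omega> = x i then 1 else 0 :: real"
  note Q_R_measurable [measurable]
  have U: "?U \<in> borel_measurable Q_algebra" by measurable
  have ae: "AE \<omega> in M. ?U \<omega> = indicator (path_event n x) \<omega>"
    using AE_R AE_space
  proof eventually_elim
    case (elim \<omega>)
    then have "Q (max 0 (R i \<omega>)) \<omega> = J i \<omega>" for i by blast
    with elim(2) show ?case by (simp only:) (auto simp: indicator_def)
  qed
  note [measurable] = Q_algebra_imp_measurable[OF U]
  have "expectation (\<lambda>\<omega>. indicator (path_event n x) \<omega> * (\<Prod>i\<le>n. exp (- s i * sojourn k Q D i \<omega>))) =
      expectation (\<lambda>\<omega>. ?U \<omega> * (\<Prod>i<Suc n. exp (- s i * sojourn k Q D i \<omega>)))"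
    unfolding lessThan_Suc_atMost using ae by (intro integral_cong_AE) (auto elim: eventually_mono)
  also have "\<dots> = expectation (\<lambda>\<omega>. ?U \<omega> * (\<Prod>i<Suc n. exp (- psi (s i) * H i \<omega>)))"
    by (rule sojourn_holding_laplace[OF s U]) auto
  also have "\<dots> = expectation (\<lambda>\<omega>. indicator (path_event n x) \<omega> * (\<Prod>i\<le>n. exp (- psi (s i) * H i \<omega>)))"
    unfolding lessThan_Suc_atMost using ae by (intro integral_cong_AE) (auto elim: eventually_mono)
  finally show ?thesis
    using holding_times_laplace[OF x, of "\<lambda>i. psi (s i)"] psi_nonneg s by simp
qed

end

subsection \<open>Sojourn times in busy states\<close>

lemma measurable_enumerate:
  fixes S :: "'a \<Rightarrow> nat set"
  assumes "\<And>n. Measurable.pred M (\<lambda>\<omega>. n \<in> S \<omega>)"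
  shows "(\<lambda>\<omega>. enumerate (S \<omega>) m) \<in> measurable M (count_space UNIV)"
  using assms
proof (induction m arbitrary: S)
  case 0
  show ?case unfolding enumerate_0 using 0 by (rule measurable_Least)
next
  case (Suc m)
  note Suc.prems [measurable]
  have [measurable]: "(\<lambda>\<omega>. LEAST n. n \<in> S \<omega>) \<in> measurable M (count_space UNIV)"
    using Suc.prems by (rule measurable_Least)
  have "Measurable.pred M (\<lambda>\<omega>. n \<in> S \<omega> - {LEAST n. n \<in> S \<omega>})" for n
  proof -
    have "Measurable.pred M (\<lambda>\<omega>. n \<in> S \<omega> \<and> \<not> n = (LEAST n. n \<in> S \<omega>))" by measurable
    then show ?thesis by simp
  qed
  from Suc.IH[OF this] show ?case unfolding enumerate_Suc .
qed

text \<open>With the set of busy indices as \<open>S\<close>, this lets the position of a busy visit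
  be read off a finite prefix of the jump chain.\<close>

lemma enumerate_cong_initial:
  fixes S :: "nat set"
  assumes "infinite S" "infinite S'" and eq: "\<And>n. n \<le> N \<Longrightarrow> n \<in> S \<longleftrightarrow> n \<in> S'"
  shows "enumerate S m \<le> N \<Longrightarrow> enumerate S' m = enumerate S m"
proof (induction m)
  case 0
  have "enumerate S 0 \<in> S" using assms(1) by (rule enumerate_in_set)
  then have "enumerate S 0 \<in> S'" using eq 0 by blast
  moreover have "enumerate S 0 \<le> n" if "n \<in> S'" for n
  proof (rule ccontr)
    assume *: "\<not> ?thesis"
    then have "n \<in> S" using that eq 0 by simp
    with * show False by (simp add: enumerate_0 Least_le)
  qed
  ultimately show ?case unfolding enumerate_0[of S'] by (rule Least_equality)
next
  case (Suc m)
  let ?e = "enumerate S m" and ?f = "enumerate S (Suc m)"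
  have lt: "?e < ?f" using assms(1) by (rule enumerate_step)
  with Suc have e: "enumerate S' m = ?e" by simp
  have f: "?f = (LEAST s. s \<in> S \<and> ?e < s)" using assms(1) by (rule enumerate_Suc'')
  have "?f \<in> S" using assms(1) by (rule enumerate_in_set)
  then have "?f \<in> S'" using eq Suc.prems by blast
  moreover have "?f \<le> n" if "n \<in> S' \<and> ?e < n" for n
  proof (rule ccontr)
    assume *: "\<not> ?thesis"
    then have "n \<in> S \<and> ?e < n" using that eq Suc.prems by simp
    then have "?f \<le> n" unfolding f by (rule Least_le)
    with * show False by simp
  qed
  ultimately have "(LEAST s. s \<in> S' \<and> enumerate S' m < s) = ?f"
    unfolding e using lt by (intro Least_equality) auto
  then show ?case unfolding enumerate_Suc''[OF assms(2)] .
qed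

text \<open>Consecutive elements are at most 2 apart and the first is at most 1; the odd numbers
  attain the bound \<open>2 * m + 1\<close>.\<close>

lemma enumerate_le_of_gaps:
  assumes gap: "\<And>n. n \<in> S \<or> Suc n \<in> S"
  shows "infinite S" "enumerate S m \<le> 2 * m + 1"
proof -
  show inf: "infinite S"
    unfolding infinite_nat_iff_unbounded_le using gap by (metis le_SucI order_refl)
  show "enumerate S m \<le> 2 * m + 1"
  proof (induction m)
    case 0
    have "(LEAST n. n \<in> S) \<le> 1" using gap[of 0] by (auto intro: Least_le dest: Least_le)
    then show ?case by (simp add: enumerate_0)
  next
    case (Suc m)
    let ?e = "enumerate S m"
    have "(LEAST s. s \<in> S \<and> ?e < s) \<le> ?e + 2"
    proof (cases "Suc ?e \<in> S")
      case True
      then have "(LEAST s. s \<in> S \<and> ?e < s) \<le> Suc ?e" by (intro Least_le) simp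
      then show ?thesis by simp
    next
      case False
      with gap[of "Suc ?e"] show ?thesis by (intro Least_le) simp
    qed
    with Suc show ?case by (simp add: enumerate_Suc''[OF inf])
  qed
qed

context tempered_erlang
begin

text \<open>The common law of the busy sojourns. The chain starts empty and jumps to
  \<open>(1,k)\<close>, so the sojourn with index 1 is almost surely a busy one and represents this
  law.\<close>

definition nu :: "real measure" where "nu = distr M borel (sojourn k Q D 1)"

lemma prob_space_nu: "prob_space nu" and sets_nu [measurable_cong]: "sets nu = sets borel"
  unfolding nu_def by (auto intro: prob_space_distr)

lemma AE_nu_nonneg: "AE x in nu. 0 \<le> x"
  unfolding nu_def using AE_sojourn by (subst AE_distr_iff) (auto elim: eventually_mono)

lemma psi_0 [simp]: "psi 0 = 0"
  by (simp add: psi_def)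

lemma nu_laplace:
  assumes "0 \<le> s"
  shows "(\<integral>x. exp (- s * x) \<partial>nu) = (lam + real k * mu) / (lam + real k * mu + psi s)"
proof -
  define x :: "nat \<Rightarrow> nat \<times> nat" where "x i = (if i = 0 then (0,0) else (1,k))" for i
  have "jump_prob k lam mu (0,0) (1,k) \<noteq> 0"
    using lam by (simp add: jump_prob_def erlang_rate_def exit_rate_empty)
  then have x: "valid_path 1 x" by (simp add: valid_path_def x_def)
  have ae: "AE \<omega> in M. \<omega> \<in> path_event 1 x"
    using AE_valid_path AE_space
  proof eventually_elim
    case (elim \<omega>)
    then have v: "valid_path 1 (\<lambda>i. J i \<omega>)" by blast
    then have "J 0 \<omega> = (0,0)" "jump_prob k lam mu (J 0 \<omega>) (J 1 \<omega>) \<noteq> 0" by (auto simp: valid_path_def)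
    with jump_prob_nonzero(3)[OF k valid_path_states[OF v, of 0]] have "J 1 \<omega> = (1,k)" by simp
    with elim \<open>J 0 \<omega> = (0,0)\<close> show ?case by (auto simp: x_def le_Suc_eq)
  qed
  then have p1: "prob (path_event 1 x) = 1" by (subst prob_eq_1) auto
  \<comment> \<open>The parameter 0 at index 0 removes the initial sojourn in the empty state from
    the product.\<close>
  let ?s = "\<lambda>i::nat. if i = 1 then s else 0"
  have "(\<integral>x. exp (- s * x) \<partial>nu) = expectation (\<lambda>\<omega>. exp (- s * sojourn k Q D 1 \<omega>))"
    unfolding nu_def by (subst integral_distr) auto
  also have "\<dots> = expectation (\<lambda>\<omega>. indicator (path_event 1 x) \<omega> * (\<Prod>i\<le>1. exp (- ?s i * sojourn k Q D i \<omega>)))"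
    using ae by (intro integral_cong_AE) (auto elim: eventually_mono)
  also have "\<dots> = (lam + real k * mu) / (lam + real k * mu + psi s)"
  proof -
    have "exit_rate k lam mu (x 0) = lam" "exit_rate k lam mu (x 1) = lam + real k * mu"
      using exit_rate_empty exit_rate_busy[of "(1,k)" k] k by (simp_all add: x_def erlang_states_def)
    then show ?thesis using lam assms by (subst sojourn_path_laplace[OF x]) (use p1 in auto)
  qed
  finally show ?thesis .
qed

lemma nu_tail: "0 \<le> t \<Longrightarrow> measure nu {t<..} = sojourn_survival k lam mu \<theta> \<alpha> t"
  using nu_laplace lam mu \<theta> \<alpha> by (intro sojourn_survival_unique prob_space_nu sets_nu AE_nu_nonneg) (auto simp: psi_def)

lemma sojourn_path_law:
  assumes x: "valid_path n x" and B: "\<And>i. i \<le> n \<Longrightarrow> B i \<in> (if x i = (0,0) then {UNIV} else sets borel)"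
  shows "expectation (\<lambda>\<omega>. indicator (path_event n x) \<omega> * (\<Prod>i\<le>n. indicator (B i) (sojourn k Q D i \<omega>))) =
    prob (path_event n x) * (\<Prod>i\<le>n. measure nu (B i))"
proof (rule iterated_replacement[where A = "\<lambda>_. UNIV :: nat set" and B = "\<lambda>i. if x i = (0,0) then {UNIV} else sets borel"
      and f = "\<lambda>i p z. exp (- real p * z)" and g = "\<lambda>i B. indicator B" and Z = "sojourn k Q D"
      and v = "\<lambda>i p. exit_rate k lam mu (x i) / (exit_rate k lam mu (x i) + psi (real p))"
      and w = "\<lambda>i B. measure nu B"])
  interpret nu: prob_space nu by (rule prob_space_nu)
  have nu1: "measure nu UNIV = 1" using nu.prob_space by (simp add: nu_def)
  show "AE \<omega> in M. \<forall>i\<in>{..n}. 0 \<le> sojourn k Q D i \<omega>"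
    using AE_sojourn by eventually_elim blast
  show "expectation (\<lambda>\<omega>. indicator (path_event n x) \<omega> * (\<Prod>i\<le>n. exp (- real (p i) * sojourn k Q D i \<omega>))) =
    prob (path_event n x) * (\<Prod>i\<le>n. exit_rate k lam mu (x i) / (exit_rate k lam mu (x i) + psi (real (p i))))" for p
    by (rule sojourn_path_laplace[OF x]) simp
  show "expectation (\<lambda>\<omega>. U \<omega> * indicator r (sojourn k Q D i \<omega>)) = d * measure nu r"
    if i: "i \<in> {..n}" and U: "U \<in> borel_measurable M" "AE \<omega> in M. 0 \<le> U \<omega> \<and> U \<omega> \<le> 1"
      and base: "\<And>p. p \<in> UNIV \<Longrightarrow> expectation (\<lambda>\<omega>. U \<omega> * exp (- real p * sojourn k Q D i \<omega>)) =
        d * (exit_rate k lam mu (x i) / (exit_rate k lam mu (x i) + psi (real p)))"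
      and r: "r \<in> (if x i = (0,0) then {UNIV} else sets borel)" for i U d r
  proof -
    have q: "0 < exit_rate k lam mu (x i)" using exit_rate_pos[OF x] i by simp
    have d: "expectation U = d" using base[of 0] q by simp
    show ?thesis
    proof (cases "x i = (0,0)")
      case True
      with r have "r = UNIV" by simp
      then show ?thesis using d nu1 by simp
    next
      case False
      have qb: "exit_rate k lam mu (x i) = lam + real k * mu"
        using valid_path_states[OF x] i False by (intro exit_rate_busy) auto
      have rB: "r \<in> sets borel" using r False by simp
      note W = weighted_distr[OF U sojourn_measurable[of i]]
      let ?N = "distr (density M (\<lambda>\<omega>. ennreal (U \<omega>))) borel (sojourn k Q D i)"
      have d0: "0 \<le> d" unfolding d[symmetric] using U(2) by (intro integral_nonneg_AE) (auto elim: eventually_mono)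
      \<comment> \<open>The total mass of the weighted law is \<open>d\<close>, and its transform is
        \<open>d\<close> times that of \<open>nu\<close>.\<close>
      have "?N = density nu (\<lambda>_. ennreal d)"
      proof (rule finite_measure_laplace_unique)
        show "finite_measure ?N" "sets ?N = sets borel" by (rule W)+
        show "AE z in ?N. 0 \<le> z" using AE_sojourn by (intro W(5)) (auto elim: eventually_mono)
        show "finite_measure (density nu (\<lambda>_. ennreal d))"
          by (intro finite_measureI) (simp add: emeasure_density_const nu.emeasure_space_1 ennreal_mult_eq_top_iff)
        show "sets (density nu (\<lambda>_. ennreal d)) = sets borel" by (simp add: sets_nu)
        show "AE z in density nu (\<lambda>_. ennreal d). 0 \<le> z"
          using AE_nu_nonneg by (subst AE_density) (auto elim: eventually_mono)
        fix p :: nat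
        have "(\<integral>z. exp (- real p * z) \<partial>density nu (\<lambda>_. ennreal d)) = d * (\<integral>z. exp (- real p * z) \<partial>nu)"
          using d0 by (subst integral_density) auto
        also have "\<dots> = expectation (\<lambda>\<omega>. U \<omega> * exp (- real p * sojourn k Q D i \<omega>))"
          using base[of p] unfolding qb by (subst nu_laplace) auto
        also have "\<dots> = (\<integral>z. exp (- real p * z) \<partial>?N)" by (subst W(3)) auto
        finally show "(\<integral>z. exp (- real p * z) \<partial>?N) = (\<integral>z. exp (- real p * z) \<partial>density nu (\<lambda>_. ennreal d))" by simp
      qed
      then have "measure ?N r = measure (density nu (\<lambda>_. ennreal d)) r" by simp
      also have "\<dots> = d * measure nu r"
        using rB d0 by (simp add: measure_def emeasure_density_const sets_nu enn2real_mult)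
      finally show ?thesis using W(4)[OF rB] by simp
    qed
  qed
qed (use B in \<open>auto simp: indicator_def split: if_splits\<close>)

lemma nz_sojourn_measurable [measurable]: "nz_sojourn k Q D m \<in> borel_measurable M"
proof -
  have "(\<lambda>\<omega>. enumerate {n. Lproc k Q D (jump_time k Q D n \<omega>) \<omega> \<noteq> 0} m) \<in> measurable M (count_space UNIV)"
    by (rule measurable_enumerate) simp
  from measurable_compose_countable[OF sojourn_measurable this] show ?thesis
    unfolding nz_sojourn_def [abs_def] .
qed

lemma busy_gap:
  assumes "valid_path (Suc n) x"
  shows "x n \<noteq> (0,0) \<or> x (Suc n) \<noteq> (0,0)"
proof (rule ccontr)
  assume *: "\<not> ?thesis"
  moreover have "jump_prob k lam mu (x n) (x (Suc n)) \<noteq> 0"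
    using assms by (simp add: valid_path_def)
  ultimately have "x (Suc n) = (1,k)"
    using jump_prob_nonzero(3)[OF k valid_path_states[OF assms, of n], of lam mu "x (Suc n)"] by simp
  with * show False by simp
qed

lemma AE_nz_sojourn:
  "AE \<omega> in M. \<forall>m. nz_sojourn k Q D m \<omega> = sojourn k Q D (enumerate {n. J n \<omega> \<noteq> (0,0)} m) \<omega>"
  using AE_jump_time AE_valid_path
proof eventually_elim
  case (elim \<omega>)
  have "gk k (J n \<omega>) \<noteq> 0 \<longleftrightarrow> J n \<omega> \<noteq> (0,0)" for n
    using gk_eq_0_iff[of "J n \<omega>" k] valid_path_states[of n "\<lambda>i. J i \<omega>" n] elim(2) by simp
  then have "{n. Lproc k Q D (jump_time k Q D n \<omega>) \<omega> \<noteq> 0} = {n. J n \<omega> \<noteq> (0,0)}"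
    using elim(1) by metis
  then show ?case by (simp add: nz_sojourn_def)
qed

text \<open>Conditioning on the first \<open>2 * m + 2\<close> states of the jump chain fixes the indices of the first
  \<open>m + 1\<close> visits to busy states, because no two consecutive states are empty.\<close>

lemma nz_sojourn_law:
  assumes B: "\<And>i. B i \<in> sets borel"
  shows "expectation (\<lambda>\<omega>. \<Prod>i\<le>m. indicator (B i) (nz_sojourn k Q D i \<omega>)) = (\<Prod>i\<le>m. measure nu (B i))"
proof -
  interpret nu: prob_space nu by (rule prob_space_nu)
  have nu1: "measure nu UNIV = 1" using nu.prob_space by (simp add: nu_def)
  \<comment> \<open>By \<open>enumerate_le_of_gaps\<close> the busy visits \<open>0\<close> to
    \<open>m\<close> have index at most \<open>2 * m + 1\<close>.\<close>
  define K where "K = 2 * m + 1"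
  define V where "V \<omega> = map (\<lambda>i. J i \<omega>) [0..<Suc K]" for \<omega>
  have Vnth: "V \<omega> ! i = J i \<omega>" if "i \<le> K" for i \<omega>
    unfolding V_def using that by (subst nth_map) (auto simp del: upt_Suc)
  have V_M [measurable]: "V \<in> measurable M (count_space UNIV)"
  proof (subst measurable_count_space_eq2_countable, intro conjI ballI)
    fix v :: "(nat \<times> nat) list"
    have "V -` {v} \<inter> space M = {\<omega> \<in> space M. length v = Suc K \<and> (\<forall>i\<in>{..K}. J i \<omega> = v ! i)}"
      using Vnth by (auto simp: list_eq_iff_nth_eq[of _ v] V_def less_Suc_eq_le simp del: upt_Suc)
    also have "\<dots> \<in> sets M" by measurable
    finally show "V -` {v} \<inter> space M \<in> sets M" .
  qed auto
  note B [measurable]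
  let ?f = "\<lambda>\<omega>. \<Prod>i\<le>m. indicator (B i) (nz_sojourn k Q D i \<omega>) :: real" and ?c = "\<Prod>i\<le>m. measure nu (B i)"
  have fi: "integrable M ?f"
    by (rule integrable_const_bound[where B = 1]) (auto simp: abs_prod indicator_def intro!: AE_I2 prod_le_1)
  have "expectation ?f = expectation (\<lambda>_. ?c)"
  proof (rule expectation_eq_countable_partition[OF V_M fi])
    fix v
    let ?good = "\<lambda>\<omega>. \<omega> \<in> space M \<and> (\<forall>n. valid_path n (\<lambda>i. J i \<omega>)) \<and>
      (\<forall>m. nz_sojourn k Q D m \<omega> = sojourn k Q D (enumerate {n. J n \<omega> \<noteq> (0,0)} m) \<omega>)"
    have good: "AE \<omega> in M. ?good \<omega>"
      using AE_space AE_valid_path AE_nz_sojourn by eventually_elim simp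
    show "expectation (\<lambda>\<omega>. indicator {v} (V \<omega>) * ?f \<omega>) = expectation (\<lambda>\<omega>. indicator {v} (V \<omega>) * ?c)"
    proof (cases "\<exists>\<omega>. ?good \<omega> \<and> V \<omega> = v")
      case False
      have z: "AE \<omega> in M. indicator {v} (V \<omega>) * h \<omega> = (0::real)" for h
        using good by eventually_elim (use False in \<open>auto simp: indicator_def\<close>)
      show ?thesis by (simp only: integral_eq_zero_AE[OF z])
    next
      case True
      \<comment> \<open>Any good point of the cell \<open>V \<omega> = v\<close> represents it: its
        path \<open>x\<close> is valid at all lengths and agrees up to \<open>K\<close> with every
        other path in the cell. A cell without good points is a null set.\<close>
      then obtain \<omega>0 where \<omega>0: "?good \<omega>0" "V \<omega>0 = v" by blast
      define x where "x i = J i \<omega>0" for i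
      define S where "S = {n. x n \<noteq> (0,0)}"
      define e where "e = enumerate S"
      have vx: "valid_path n x" for n using \<omega>0(1) by (simp add: x_def [abs_def])
      have gap: "n \<in> S \<or> Suc n \<in> S" for n using busy_gap[OF vx, of n] by (auto simp: S_def)
      have S: "infinite S" using gap by (rule enumerate_le_of_gaps(1))
      have eK: "e i \<le> K" if "i \<le> m" for i
        using enumerate_le_of_gaps(2)[of S i] gap that by (simp add: e_def K_def)
      have inj: "inj_on e {..m}" unfolding e_def using S by (meson inj_enumerate inj_on_subset subset_UNIV)
      have Vv: "V \<omega> = v \<longleftrightarrow> (\<forall>i\<le>K. J i \<omega> = x i)" for \<omega>
      proof -
        have "V \<omega> = V \<omega>0 \<longleftrightarrow> (\<forall>i\<le>K. V \<omega> ! i = V \<omega>0 ! i)"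
          by (auto simp: list_eq_iff_nth_eq V_def less_Suc_eq_le simp del: upt_Suc)
        then show ?thesis unfolding \<omega>0(2) [symmetric] using Vnth by (simp add: x_def)
      qed
      \<comment> \<open>The sets are moved to the path positions of the busy visits. All other
        positions, including the empty states, get \<open>UNIV\<close> and contribute a factor
        1.\<close>
      define B' where "B' j = (if j \<in> e ` {..m} then B (the_inv_into {..m} e j) else UNIV)" for j
      have reindex: "(\<Prod>j\<le>K. h j (B' j)) = (\<Prod>i\<le>m. h (e i) (B i))" if "\<And>j. h j UNIV = 1"
        for h :: "nat \<Rightarrow> real set \<Rightarrow> real"
      proof -
        have "(\<Prod>j\<le>K. h j (B' j)) = (\<Prod>j\<in>e ` {..m}. h j (B' j))"
          using eK that by (intro prod.mono_neutral_right) (auto simp: B'_def)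
        also have "\<dots> = (\<Prod>i\<le>m. h (e i) (B' (e i)))" using inj by (simp add: prod.reindex)
        also have "\<dots> = (\<Prod>i\<le>m. h (e i) (B i))"
          using inj by (intro prod.cong refl) (simp add: B'_def the_inv_into_f_f)
        finally show ?thesis .
      qed
      have "AE \<omega> in M. indicator {v} (V \<omega>) * ?f \<omega> =
          indicator (path_event K x) \<omega> * (\<Prod>j\<le>K. indicator (B' j) (sojourn k Q D j \<omega>))"
        using good
      proof eventually_elim
        case (elim \<omega>)
        show ?case
        proof (cases "V \<omega> = v")
          case True
          \<comment> \<open>The busy set of this path may differ from \<open>S\<close> beyond
            \<open>K\<close>, but the visits up to \<open>m\<close> lie within the common prefix, so
            their indices coincide.\<close>
          let ?S = "{n. J n \<omega> \<noteq> (0,0)}"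
          have "infinite ?S"
          proof (rule enumerate_le_of_gaps(1))
            fix n
            have "valid_path (Suc n) (\<lambda>i. J i \<omega>)" using elim by blast
            from busy_gap[OF this] show "n \<in> ?S \<or> Suc n \<in> ?S" by simp
          qed
          then have "enumerate ?S i = e i" if "i \<le> m" for i
            unfolding e_def using eK[OF that] True Vv S
            by (intro enumerate_cong_initial[of S ?S K]) (auto simp: S_def e_def)
          then have "?f \<omega> = (\<Prod>i\<le>m. indicator (B i) (sojourn k Q D (e i) \<omega>))"
            using elim by (intro prod.cong) auto
          also have "\<dots> = (\<Prod>j\<le>K. indicator (B' j) (sojourn k Q D j \<omega>))"
            by (rule reindex [symmetric]) simp
          finally show ?thesis using True Vv[of \<omega>] elim by simp
        next
          case False
          then have "\<omega> \<notin> path_event K x" using Vv[of \<omega>] by simp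
          with False show ?thesis by simp
        qed
      qed
      moreover have B'm [measurable]: "B' j \<in> sets borel" for j by (auto simp: B'_def B)
      ultimately have "expectation (\<lambda>\<omega>. indicator {v} (V \<omega>) * ?f \<omega>) =
          expectation (\<lambda>\<omega>. indicator (path_event K x) \<omega> * (\<Prod>j\<le>K. indicator (B' j) (sojourn k Q D j \<omega>)))"
        by (intro integral_cong_AE) auto
      also have "\<dots> = prob (path_event K x) * (\<Prod>j\<le>K. measure nu (B' j))"
      proof (rule sojourn_path_law[OF vx])
        fix j assume "j \<le> K"
        have "x (e i) \<noteq> (0,0)" for i using enumerate_in_set[OF S, of i] by (simp add: e_def S_def)
        then show "B' j \<in> (if x j = (0,0) then {UNIV} else sets borel)"
          by (auto simp: B'_def B)
      qed
      also have "\<dots> = prob (path_event K x) * ?c"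
        using nu1 by (subst reindex[of "\<lambda>_. measure nu"]) auto
      also have "\<dots> = expectation (\<lambda>\<omega>. indicator (path_event K x) \<omega> * ?c)" by simp
      also have "\<dots> = expectation (\<lambda>\<omega>. indicator {v} (V \<omega>) * ?c)"
        by (intro Bochner_Integration.integral_cong refl) (auto simp: indicator_def Vv)
      finally show ?thesis .
    qed
  qed simp
  then show ?thesis by (simp add: prob_space)
qed

lemma nz_sojourn_prob:
  assumes "\<And>i. B i \<in> sets borel"
  shows "prob {\<omega> \<in> space M. \<forall>i\<le>m. nz_sojourn k Q D i \<omega> \<in> B i} = (\<Prod>i\<le>m. measure nu (B i))"
proof -
  note assms [measurable]
  have e: "(\<Prod>i\<le>m. indicator (B i) (nz_sojourn k Q D i \<omega>)) = (if \<forall>i\<le>m. nz_sojourn k Q D i \<omega> \<in> B i then 1 else 0 :: real)" for \<omega>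
    by (auto simp: indicator_def prod_zero_iff intro!: prod.neutral)
  have "expectation (\<lambda>\<omega>. \<Prod>i\<le>m. indicator (B i) (nz_sojourn k Q D i \<omega>) :: real) =
     expectation (indicator {\<omega> \<in> space M. \<forall>i\<le>m. nz_sojourn k Q D i \<omega> \<in> B i})"
    unfolding e by (intro Bochner_Integration.integral_cong) (auto simp: indicator_def)
  then show ?thesis using nz_sojourn_law[of B m] assms by simp
qed

lemma nz_sojourn_prob_finite:
  assumes "finite I" and B: "\<And>i. i \<in> I \<Longrightarrow> B i \<in> sets borel"
  shows "prob {\<omega> \<in> space M. \<forall>i\<in>I. nz_sojourn k Q D i \<omega> \<in> B i} = (\<Prod>i\<in>I. measure nu (B i))"
proof -
  interpret nu: prob_space nu by (rule prob_space_nu)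
  have nu1: "measure nu UNIV = 1" using nu.prob_space by (simp add: nu_def)
  obtain m where m: "I \<subseteq> {..m}" using assms(1) finite_nat_iff_bounded_le by blast
  let ?B = "\<lambda>i. if i \<in> I then B i else UNIV"
  have "{\<omega> \<in> space M. \<forall>i\<in>I. nz_sojourn k Q D i \<omega> \<in> B i} = {\<omega> \<in> space M. \<forall>i\<le>m. nz_sojourn k Q D i \<omega> \<in> ?B i}"
    using m by auto
  then have "prob {\<omega> \<in> space M. \<forall>i\<in>I. nz_sojourn k Q D i \<omega> \<in> B i} = (\<Prod>i\<le>m. measure nu (?B i))"
    using nz_sojourn_prob[of ?B m] B by simp
  also have "\<dots> = (\<Prod>i\<in>I. measure nu (?B i))"
    using m nu1 by (intro prod.mono_neutral_right) auto
  finally show ?thesis by simp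
qed

lemma nz_sojourn_distr: "distr M borel (nz_sojourn k Q D m) = nu"
proof (rule measure_eqI)
  interpret nu: prob_space nu by (rule prob_space_nu)
  show "sets (distr M borel (nz_sojourn k Q D m)) = sets nu" by (simp add: sets_nu)
  fix A assume "A \<in> sets (distr M borel (nz_sojourn k Q D m))"
  then have [measurable]: "A \<in> sets borel" by simp
  have "{\<omega> \<in> space M. \<forall>i\<in>{m}. nz_sojourn k Q D i \<omega> \<in> A} = nz_sojourn k Q D m -` A \<inter> space M" by auto
  then have "prob (nz_sojourn k Q D m -` A \<inter> space M) = measure nu A"
    using nz_sojourn_prob_finite[of "{m}" "\<lambda>_. A"] by simp
  then show "emeasure (distr M borel (nz_sojourn k Q D m)) A = emeasure nu A"
    by (simp add: emeasure_distr emeasure_eq_measure nu.emeasure_eq_measure)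
qed

lemma nz_sojourn_indep: "indep_vars (\<lambda>_. borel) (nz_sojourn k Q D) UNIV"
  unfolding indep_vars_def2
proof (intro conjI ballI indep_setsI)
  fix A :: "nat \<Rightarrow> 'w set" and I :: "nat set"
  assume I: "I \<noteq> {}" "finite I" and A: "\<forall>i\<in>I. A i \<in> {nz_sojourn k Q D i -` B \<inter> space M |B. B \<in> sets borel}"
  then have "\<forall>i\<in>I. \<exists>B. A i = nz_sojourn k Q D i -` B \<inter> space M \<and> B \<in> sets borel" by blast
  from bchoice[OF this] obtain B where
    B: "\<And>i. i \<in> I \<Longrightarrow> A i = nz_sojourn k Q D i -` B i \<inter> space M \<and> B i \<in> sets borel"
    by blast
  have "(\<Inter>i\<in>I. A i) = {\<omega> \<in> space M. \<forall>i\<in>I. nz_sojourn k Q D i \<omega> \<in> B i}"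
    using B I(1) by auto
  then have "prob (\<Inter>i\<in>I. A i) = (\<Prod>i\<in>I. measure nu (B i))"
    using nz_sojourn_prob_finite[OF I(2), of B] B by simp
  also have "\<dots> = (\<Prod>i\<in>I. prob (A i))"
  proof (rule prod.cong[OF refl])
    fix i assume "i \<in> I"
    with B[OF this] show "measure nu (B i) = prob (A i)"
      unfolding nz_sojourn_distr[of i, symmetric] by (simp add: measure_distr)
  qed
  finally show "prob (\<Inter>i\<in>I. A i) = (\<Prod>i\<in>I. prob (A i))" .
qed (auto intro: measurable_sets)

lemma nz_sojourn_survival:
  assumes "0 \<le> t"
  shows "prob {\<omega> \<in> space M. nz_sojourn k Q D m \<omega> > t} = sojourn_survival k lam mu \<theta> \<alpha> t"
  using nz_sojourn_prob_finite[of "{m}" "\<lambda>_. {t<..}"] nu_tail[OF assms] by simp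

end

theorem theorem4p5:
  fixes M :: "'w measure" and Q :: "real \<Rightarrow> 'w \<Rightarrow> nat \<times> nat" and D :: "real \<Rightarrow> 'w \<Rightarrow> real"
    and k :: nat and lam mu \<theta> \<alpha> :: real
  assumes "prob_space M"
    and "k \<ge> 1" and "lam > 0" and "mu > 0" and "\<theta> > 0" and "0 < \<alpha>" and "\<alpha> < 1"
    and "erlang_ctmc M k lam mu Q"
    and "tempered_subordinator M \<theta> \<alpha> D"
    and "indep_processes M Q D"
  shows "prob_space.indep_vars M (\<lambda>_. borel) (nz_sojourn k Q D) UNIV
     \<and> (\<forall>m. distr M borel (nz_sojourn k Q D m) = distr M borel (nz_sojourn k Q D 0))
     \<and> (\<forall>m t. 0 \<le> t \<longrightarrow>
          measure M {\<omega> \<in> space M. nz_sojourn k Q D m \<omega> > t} = sojourn_survival k lam mu \<theta> \<alpha> t)"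
proof -
  interpret prob_space M by fact
  from \<open>erlang_ctmc M k lam mu Q\<close> obtain J :: "nat \<Rightarrow> 'w \<Rightarrow> nat \<times> nat" and H :: "nat \<Rightarrow> 'w \<Rightarrow> real" where
    J: "\<forall>n. J n \<in> measurable M (count_space UNIV)" and H: "\<forall>n. H n \<in> borel_measurable M"
    and law: "\<forall>n (x :: nat \<Rightarrow> nat \<times> nat) (s :: nat \<Rightarrow> real). (\<forall>i\<le>n. 0 \<le> s i) \<longrightarrow>
           measure M {\<omega> \<in> space M. \<forall>i\<le>n. J i \<omega> = x i \<and> H i \<omega> > s i} =
             (if x 0 = (0,0) then 1 else 0)
             * (\<Prod>i<n. jump_prob k lam mu (x i) (x (Suc i)))
             * (\<Prod>i\<le>n. exp (- exit_rate k lam mu (x i) * s i))"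
    and pos: "\<forall>\<omega>\<in>space M. (\<forall>i. 0 < H i \<omega>) \<and> filterlim (\<lambda>n. \<Sum>i<n. H i \<omega>) at_top sequentially"
    and path: "\<forall>\<omega>\<in>space M. \<forall>t n. (\<Sum>i<n. H i \<omega>) \<le> t \<and> t < (\<Sum>i\<le>n. H i \<omega>) \<longrightarrow> Q t \<omega> = J n \<omega>"
    unfolding erlang_ctmc_def by blast
  interpret tempered_erlang M Q D k lam mu \<theta> \<alpha> J H
  proof
    show "Q t \<omega> = J n \<omega>" if "\<omega> \<in> space M" "(\<Sum>i<n. H i \<omega>) \<le> t" "t < (\<Sum>i<Suc n. H i \<omega>)" for \<omega> t n
      using path that unfolding lessThan_Suc_atMost by blast
  qed (use assms J H law pos in auto)
  show ?thesis
    using nz_sojourn_indep nz_sojourn_distr nz_sojourn_survival by simp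
qed

end
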